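(* Consider the following property $(\ast)$ of a space $Y$: $Y$ is f-Type I and locally metrizable, $Y$ contains a non-Lindelöf closed subspace narrow in $Y$, and any closed subspace which is f-narrow in $Y$ is discrete outside of a Lindelöf subset. Then: (a) there is a space $Y$ with $(\ast)$ such that each non-Lindelöf closed subset of $Y$ contains an uncountable closed discrete subset; (b) under $\diamondsuit^*$, there is a space $Y$ with $(\ast)$ such that each non-Lindelöf closed subset of $Y$ contains an uncountable closed discrete subset and $Y$ is moreover collectionwise Hausdorff; (c) if there is a Suslin tree, there is a space $Y$ with $(\ast)$ which has an open dense subspace that is $\omega_1$-compact and locally compact.
   Context: "Space" means Hausdorff topological space. The longray $\mathbb{L}_{\ge 0}$ is $\omega_1\times[0,1)$ with the lexicographic order topology; $\alpha\in\omega_1$ is identified with $\langle\alpha,0\rangle$. A function into $\mathbb{L}_{\ge 0}$ is bounded if its range is contained in a strict initial segment. $Y$ is f-Type I (functionally Type I, in itself) if there is a continuous $s:Y\to\mathbb{L}_{\ge 0}$ such that $s^{-1}([0,\alpha])$ is Lindelöf for each $\alpha\in\omega_1$. A systematic cover of $Y$ indexed by $\omega_1$ is an open cover $\{U_\alpha:\alpha\in\omega_1\}$ with $\overline{U_\alpha}\subset U_\beta$ whenever $\alpha<\beta$. A closed $D\subset Y$ is narrow in $Y$ if for every systematic cover $\{U_\alpha:\alpha\in\omega_1\}$ of $Y$, either $D\subset U_\alpha$ for some $\alpha$ or $\overline{U_\alpha}\cap D$ is Lindelöf for each $\alpha$. It is f-narrow (functionally narrow) in $Y$ if for every continuous $f:Y\to\mathbb{L}_{\ge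 0}$, either $f\upharpoonright D$ is bounded or $f^{-1}([0,\alpha])\cap D$ is Lindelöf for each $\alpha\in\omega_1$. A subspace $D$ is discrete outside of a Lindelöf subset if there is a Lindelöf $L\subset Y$ such that $D - L$ is discrete. A space is collectionwise Hausdorff if the points of any closed discrete subspace $\{d_\alpha:\alpha\in\kappa\}$ can be expanded to a pairwise disjoint family of open sets $O_\alpha\ni d_\alpha$. A space is $\omega_1$-compact if its closed discrete subspaces are at most countable. $\diamondsuit^*$: there are countable families $\mathcal{A}_\alpha\subset\mathcal{P}(\alpha)$ ($\alpha<\omega_1$) such that for every $E\subset\omega_1$ the set $\{\alpha: E\cap\alpha\in\mathcal{A}_\alpha\}$ contains a closed unbounded subset of $\omega_1$. A Suslin tree is a tree of height $\omega_1$ whose chains and antichains are at most countable. *)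

theory Defs
  imports "HOL-Analysis.Analysis"
begin

unbundle cardinal_syntax

section \<open>The ordinal \<open>\<omega>\<^sub>1\<close>\<close>

text \<open>
  The cardinal successor of \<open>natLeq\<close> is a well-order whose type is the first uncountable ordinal;
  the type \<open>omega1\<close> is its field, so that the ordinal \<open>\<alpha>\<close>, as the set of the smaller ordinals,
  is \<open>{..<\<alpha>}\<close>.
\<close>

lemma Well_order_cardSuc_natLeq: "Well_order (cardSuc natLeq)"
  using cardSuc_Card_order[OF natLeq_Card_order] by (simp add: card_order_on_def)

typedef omega1 = "Field (cardSuc natLeq)"
proof -
  have "\<not> finite (Field (cardSuc natLeq))"
    using cardSuc_finite[OF natLeq_Card_order] by (simp add: Field_natLeq)
  then show ?thesis by (metis ex_in_conv finite.emptyI)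
qed

instantiation omega1 :: linorder
begin

definition less_eq_omega1 :: "omega1 \<Rightarrow> omega1 \<Rightarrow> bool" where
  "less_eq_omega1 x y \<longleftrightarrow> (Rep_omega1 x, Rep_omega1 y) \<in> cardSuc natLeq"

definition less_omega1 :: "omega1 \<Rightarrow> omega1 \<Rightarrow> bool" where
  "less_omega1 x y \<longleftrightarrow> x \<le> y \<and> x \<noteq> y"

instance
proof
  have lin: "Linear_order (cardSuc natLeq)"
    using Well_order_cardSuc_natLeq by (simp add: well_order_on_def)
  then have "refl_on (Field (cardSuc natLeq)) (cardSuc natLeq)"
    and "trans (cardSuc natLeq)" and "antisym (cardSuc natLeq)"
    and "total_on (Field (cardSuc natLeq)) (cardSuc natLeq)"
    by (auto simp: order_on_defs)
  note r = this
  fix x y z :: omega1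
  show anti: "x \<le> y \<Longrightarrow> y \<le> x \<Longrightarrow> x = y" for x y :: omega1
    using r(3) by (auto simp: less_eq_omega1_def antisym_def simp flip: Rep_omega1_inject)
  show "(x < y) = (x \<le> y \<and> \<not> y \<le> x)"
    using anti r(1) Rep_omega1 by (auto simp: less_omega1_def less_eq_omega1_def refl_on_def)
  show "x \<le> x"
    using r(1) Rep_omega1 by (auto simp: less_eq_omega1_def refl_on_def)
  show "x \<le> y \<Longrightarrow> y \<le> z \<Longrightarrow> x \<le> z"
    using r(2) by (auto simp: less_eq_omega1_def trans_def)
  show "x \<le> y \<or> y \<le> x"
    using r(1,4) Rep_omega1[of x] Rep_omega1[of y]
    by (cases "x = y") (auto simp: less_eq_omega1_def total_on_def refl_on_def Rep_omega1_inject)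
qed

end

instantiation omega1 :: linorder_topology
begin

definition open_omega1 :: "omega1 set \<Rightarrow> bool" where
  "open_omega1 = generate_topology (range lessThan \<union> range greaterThan)"

instance
  by standard (rule open_omega1_def)

end

instance omega1 :: wellorder
proof
  fix P :: "omega1 \<Rightarrow> bool" and a
  assume step: "\<And>x. (\<And>y. y < x \<Longrightarrow> P y) \<Longrightarrow> P x"
  have wf: "wf (inv_image (cardSuc natLeq - Id) Rep_omega1)"
    using Well_order_cardSuc_natLeq by (simp add: well_order_on_def)
  show "P a"
    using wf
  proof (induction a rule: wf_induct_rule)
    case (less x)
    show ?case
      by (rule step, rule less)
        (auto simp: less_omega1_def less_eq_omega1_def in_inv_image Rep_omega1_inject)
  qed
qed

lemma countable_iff_ordLeq_natLeq: "countable A \<longleftrightarrow> |A| \<le>o natLeq"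
proof -
  have "countable A \<longleftrightarrow> |A| \<le>o |UNIV :: nat set|"
    unfolding countable_def card_of_ordLeq[symmetric] by auto
  then show ?thesis
    using card_of_nat ordLeq_ordIso_trans ordIso_symmetric by blast
qed

lemma uncountable_UNIV_omega1: "uncountable (UNIV :: omega1 set)"
proof
  assume "countable (UNIV :: omega1 set)"
  then have "countable (range Rep_omega1)" by simp
  then have "countable (Field (cardSuc natLeq))"
    using type_definition.Rep_range[OF type_definition_omega1] by simp
  then have "|Field (cardSuc natLeq)| \<le>o natLeq"
    by (simp add: countable_iff_ordLeq_natLeq)
  moreover have "|Field (cardSuc natLeq)| =o cardSuc natLeq"
    by (simp add: card_of_Field_ordIso cardSuc_Card_order natLeq_Card_order)
  ultimately have "cardSuc natLeq \<le>o natLeq"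
    by (meson ordIso_ordLeq_trans ordIso_symmetric)
  then show False
    using cardSuc_greater[OF natLeq_Card_order] not_ordLess_ordLeq by blast
qed

lemma countable_lessThan_omega1: "countable {..<\<alpha> :: omega1}"
proof -
  let ?r = "cardSuc natLeq" and ?a = "Rep_omega1 \<alpha>"
  have "|underS ?r ?a| <o ?r"
    by (rule card_of_underS) (auto simp: cardSuc_Card_order natLeq_Card_order Rep_omega1)
  then have "|underS ?r ?a| \<le>o natLeq"
    using cardSuc_ordLeq_ordLess[OF natLeq_Card_order card_of_Card_order] by blast
  then have "countable (underS ?r ?a)"
    by (simp add: countable_iff_ordLeq_natLeq)
  moreover have "Rep_omega1 ` {..<\<alpha>} \<subseteq> underS ?r ?a"
    by (auto simp: underS_def less_omega1_def less_eq_omega1_def Rep_omega1_inject)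
  ultimately have "countable (Rep_omega1 ` {..<\<alpha>})"
    by (rule countable_subset[rotated])
  then show ?thesis
    by (rule countable_image_inj_on) (simp add: inj_on_def Rep_omega1_inject)
qed

definition club :: "omega1 set \<Rightarrow> bool" where
  "club C \<longleftrightarrow> closed C \<and> \<not> bdd_above C"

definition diamond_star :: bool where
  "diamond_star \<longleftrightarrow>
    (\<exists>\<A> :: omega1 \<Rightarrow> omega1 set set.
      (\<forall>\<alpha>. countable (\<A> \<alpha>) \<and> \<A> \<alpha> \<subseteq> Pow {..<\<alpha>}) \<and>
      (\<forall>E. \<exists>C. club C \<and> C \<subseteq> {\<alpha>. E \<inter> {..<\<alpha>} \<in> \<A> \<alpha>}))"


section \<open>Suslin trees\<close>

text \<open>Trees are given by reflexive partial orders, with the field as the set of nodes.\<close>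

definition order_tree :: "'b rel \<Rightarrow> bool" where
  "order_tree r \<longleftrightarrow>
    Partial_order r \<and> (\<forall>t\<in>Field r. Well_order (Restr r (underS r t)))"

definition tree_level :: "'b rel \<Rightarrow> omega1 \<Rightarrow> 'b set" where
  "tree_level r \<alpha> =
    {t \<in> Field r. Restr r (underS r t) =o {(\<beta>, \<gamma>). \<beta> \<le> \<gamma> \<and> \<gamma> < \<alpha>}}"

definition height_omega1 :: "'b rel \<Rightarrow> bool" where
  "height_omega1 r \<longleftrightarrow>
    Field r = (\<Union>\<alpha>. tree_level r \<alpha>) \<and> (\<forall>\<alpha>. tree_level r \<alpha> \<noteq> {})"

definition tree_antichain :: "'b rel \<Rightarrow> 'b set \<Rightarrow> bool" where
  "tree_antichain r A \<longleftrightarrow> A \<subseteq> Field r \<and> (\<forall>a\<in>A. \<forall>b\<in>A. a \<noteq> b \<longrightarrow> (a, b) \<notin> r)"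

definition Suslin_tree :: "'b rel \<Rightarrow> bool" where
  "Suslin_tree r \<longleftrightarrow>
    order_tree r \<and> height_omega1 r \<and>
    (\<forall>C\<in>Chains r. countable C) \<and> (\<forall>A. tree_antichain r A \<longrightarrow> countable A)"


section \<open>The longray\<close>

typedef longray = "(UNIV :: omega1 set) \<times> {0..<1 :: real}"
  by auto

instantiation longray :: linorder
begin

definition less_eq_longray :: "longray \<Rightarrow> longray \<Rightarrow> bool" where
  "less_eq_longray x y \<longleftrightarrow>
    fst (Rep_longray x) < fst (Rep_longray y) \<or>
    fst (Rep_longray x) = fst (Rep_longray y) \<and> snd (Rep_longray x) \<le> snd (Rep_longray y)"

definition less_longray :: "longray \<Rightarrow> longray \<Rightarrow> bool" where
  "less_longray x y \<longleftrightarrow> x \<le> y \<and> x \<noteq> y"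

instance
proof
  fix x y z :: longray
  show anti: "x \<le> y \<Longrightarrow> y \<le> x \<Longrightarrow> x = y" for x y :: longray
    by (auto simp: less_eq_longray_def Rep_longray_inject[symmetric] prod_eq_iff)
  show "(x < y) = (x \<le> y \<and> \<not> y \<le> x)"
    using anti by (auto simp: less_longray_def less_eq_longray_def)
  show "x \<le> x"
    by (simp add: less_eq_longray_def)
  show "x \<le> y \<Longrightarrow> y \<le> z \<Longrightarrow> x \<le> z"
    by (auto simp: less_eq_longray_def)
  show "x \<le> y \<or> y \<le> x"
    by (auto simp: less_eq_longray_def)
qed

end

instantiation longray :: linorder_topology
begin

definition open_longray :: "longray set \<Rightarrow> bool" where
  "open_longray = generate_topology (range lessThan \<union> range greaterThan)"

instance
  by standard (rule open_longray_def)

end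

definition ordinal_in_longray :: "omega1 \<Rightarrow> longray" where
  "ordinal_in_longray \<alpha> = Abs_longray (\<alpha>, 0)"

definition strict_initial_segment :: "longray set \<Rightarrow> bool" where
  "strict_initial_segment I \<longleftrightarrow> (\<forall>x\<in>I. \<forall>y\<le>x. y \<in> I) \<and> I \<noteq> UNIV"

definition bounded_in_longray :: "('a \<Rightarrow> longray) \<Rightarrow> 'a set \<Rightarrow> bool" where
  "bounded_in_longray f D \<longleftrightarrow> (\<exists>I. strict_initial_segment I \<and> f ` D \<subseteq> I)"


section \<open>Topological notions\<close>

definition locally_metrizable :: "'a topology \<Rightarrow> bool" where
  "locally_metrizable Y \<longleftrightarrow>
    (\<forall>x\<in>topspace Y. \<exists>U. openin Y U \<and> x \<in> U \<and> metrizable_space (subtopology Y U))"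

definition f_Type_I :: "'a topology \<Rightarrow> bool" where
  "f_Type_I Y \<longleftrightarrow>
    (\<exists>s :: 'a \<Rightarrow> longray. continuous_map Y euclidean s \<and>
      (\<forall>\<alpha>. Lindelof_space (subtopology Y {x \<in> topspace Y. s x \<le> ordinal_in_longray \<alpha>})))"

definition systematic_cover :: "'a topology \<Rightarrow> (omega1 \<Rightarrow> 'a set) \<Rightarrow> bool" where
  "systematic_cover Y U \<longleftrightarrow>
    (\<forall>\<alpha>. openin Y (U \<alpha>)) \<and> (\<Union>\<alpha>. U \<alpha>) = topspace Y \<and>
    (\<forall>\<alpha> \<beta>. \<alpha> < \<beta> \<longrightarrow> Y closure_of U \<alpha> \<subseteq> U \<beta>)"

definition narrow_in :: "'a topology \<Rightarrow> 'a set \<Rightarrow> bool" where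
  "narrow_in Y D \<longleftrightarrow>
    closedin Y D \<and>
    (\<forall>U. systematic_cover Y U \<longrightarrow>
      (\<exists>\<alpha>. D \<subseteq> U \<alpha>) \<or> (\<forall>\<alpha>. Lindelof_space (subtopology Y (Y closure_of U \<alpha> \<inter> D))))"

definition f_narrow_in :: "'a topology \<Rightarrow> 'a set \<Rightarrow> bool" where
  "f_narrow_in Y D \<longleftrightarrow>
    closedin Y D \<and>
    (\<forall>f :: 'a \<Rightarrow> longray. continuous_map Y euclidean f \<longrightarrow>
      bounded_in_longray f D \<or>
      (\<forall>\<alpha>. Lindelof_space
             (subtopology Y ({x \<in> topspace Y. f x \<le> ordinal_in_longray \<alpha>} \<inter> D))))"

definition discrete_subspace :: "'a topology \<Rightarrow> 'a set \<Rightarrow> bool" where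
  "discrete_subspace Y D \<longleftrightarrow> D \<subseteq> topspace Y \<and> subtopology Y D = discrete_topology D"

definition discrete_outside_Lindelof :: "'a topology \<Rightarrow> 'a set \<Rightarrow> bool" where
  "discrete_outside_Lindelof Y D \<longleftrightarrow>
    (\<exists>L \<subseteq> topspace Y. Lindelof_space (subtopology Y L) \<and> discrete_subspace Y (D - L))"

definition collectionwise_Hausdorff :: "'a topology \<Rightarrow> bool" where
  "collectionwise_Hausdorff Y \<longleftrightarrow>
    (\<forall>D. closedin Y D \<and> discrete_subspace Y D \<longrightarrow>
      (\<exists>V :: 'a \<Rightarrow> 'a set. (\<forall>d\<in>D. openin Y (V d) \<and> d \<in> V d) \<and> disjoint_family_on V D))"

definition omega1_compact :: "'a topology \<Rightarrow> bool" where
  "omega1_compact Y \<longleftrightarrow>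
    (\<forall>D. closedin Y D \<and> discrete_subspace Y D \<longrightarrow> countable D)"

definition property_star :: "'a topology \<Rightarrow> bool" where
  "property_star Y \<longleftrightarrow>
    Hausdorff_space Y \<and> f_Type_I Y \<and> locally_metrizable Y \<and>
    (\<exists>D. closedin Y D \<and> \<not> Lindelof_space (subtopology Y D) \<and> narrow_in Y D) \<and>
    (\<forall>D. closedin Y D \<and> f_narrow_in Y D \<longrightarrow> discrete_outside_Lindelof Y D)"

text \<open>
  Each space \<open>Y\<close> with this property has at most continuum many points: it is the union of the
  \<open>\<aleph>\<^sub>1\<close> subspaces \<open>{x. s x \<le> \<alpha>}\<close>, which are Lindelof, Hausdorff and first countable and hence,
  by Arhangelskii's theorem, have at most continuum many points.  So the existence of such a
  space amounts to the existence of one whose set of points is a set of reals.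
\<close>

definition nonLindelof_closed_has_uncountable_closed_discrete :: "'a topology \<Rightarrow> bool" where
  "nonLindelof_closed_has_uncountable_closed_discrete Y \<longleftrightarrow>
    (\<forall>C. closedin Y C \<and> \<not> Lindelof_space (subtopology Y C) \<longrightarrow>
      (\<exists>D \<subseteq> C. uncountable D \<and> closedin Y D \<and> discrete_subspace Y D))"

end

theory Submission
  imports Defs
begin

text \<open>
  For an \<open>\<omega>\<^sub>1\<close>-tree \<open>T\<close> with countable levels and no uncountable branch, add to \<open>T \<times> \<nat>\<close> points
  \<open>d\<^sub>\<alpha>\<close> such that the successor levels \<open>T\<^bsub>\<alpha>+1\<^esub> \<times> {m}\<close> converge to \<open>d\<^sub>\<alpha>\<close> as \<open>m\<close> grows.  If open sets
  \<open>U\<close> and \<open>V\<close> both contain uncountably many \<open>d\<^sub>\<alpha>\<close>, then some copy of \<open>T\<close> has unboundedly many full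
  levels in \<open>U\<close> and in \<open>V\<close>, and each node on a common limit of these levels lies in the closures of
  both; so the set of all \<open>d\<^sub>\<alpha>\<close> is narrow.  An uncountable set of nodes is split by two disjoint
  clopen cones, so an f-narrow closed set contains only countably many nodes.

  For (a), \<open>T\<close> consists of increasing real functions, so that each uncountable set of nodes contains
  an uncountable antichain, which is closed and discrete.  For (b), \<open>\<diamond>\<^sup>*\<close> is used at limit levels to
  make each antichain of such a tree miss a closed unbounded set of levels; a closed discrete set
  meets each chain in a finite set, hence is covered by countably many antichains and the \<open>d\<^sub>\<alpha>\<close>, and
  so it splits into countable pieces lying in disjoint open intervals of levels.  For (c), \<open>T\<close> is a
  Suslin tree.
\<close>

section \<open>Countable ordinals\<close>

text \<open>Three obstacles shape the construction. A branch through all levels would put a closed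
  copy of \<open>omega1\<close> into the space. On it every continuous map to the longray is bounded
  or has countable preimages of initial segments, so it would be f-narrow without being discrete
  outside a Lindelof set; hence the clause \<open>no_branch\<close>. The points \<open>dp a\<close>
  have to see whole levels. With infinitely many copies of the tree, a level can converge to a point
  while each single copy stays clopen. Successor levels are used because their nodes are isolated,
  so that full levels are open. In (b), a strictly increasing map from the tree to the rationals
  would split the tree into countably many antichains. If each of these missed a closed unbounded
  set of levels, these sets would share a level, and that level would be empty. So the values are
  real: uncountable sets of nodes still contain uncountable antichains, while guesses treated at
  limit levels can make every antichain nonstationary.\<close>

lemma countable_atMost_omega1: "countable {..\<alpha> :: omega1}"
proof -
  have "{..\<alpha>} = insert \<alpha> {..<\<alpha>}" by auto
  then show ?thesis using countable_lessThan_omega1[of \<alpha>] by simp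
qed

lemma countable_omega1_bounded:
  assumes "countable (A :: omega1 set)"
  obtains \<beta> where "\<And>\<alpha>. \<alpha> \<in> A \<Longrightarrow> \<alpha> < \<beta>"
proof -
  have "countable (\<Union>\<alpha>\<in>A. {..\<alpha>})"
    using assms countable_atMost_omega1 by auto
  then obtain \<beta> where "\<beta> \<notin> (\<Union>\<alpha>\<in>A. {..\<alpha>})"
    using uncountable_UNIV_omega1 by (metis UNIV_eq_I)
  then have "\<alpha> < \<beta>" if "\<alpha> \<in> A" for \<alpha>
    using that by (metis UN_I atMost_iff not_le)
  then show ?thesis by (rule that)
qed

lemma omega1_bounded_iff_countable: "countable A \<longleftrightarrow> (\<exists>\<beta>. \<forall>\<alpha>\<in>A. \<alpha> < (\<beta> :: omega1))"
proof
  assume "countable A"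
  then show "\<exists>\<beta>. \<forall>\<alpha>\<in>A. \<alpha> < \<beta>" using countable_omega1_bounded by metis
next
  assume "\<exists>\<beta>. \<forall>\<alpha>\<in>A. \<alpha> < \<beta>"
  then obtain \<beta> where "A \<subseteq> {..<\<beta>}" by auto
  then show "countable A" using countable_lessThan_omega1 countable_subset by blast
qed

lemma uncountable_omega1_unbounded:
  assumes "uncountable (A :: omega1 set)"
  obtains \<alpha> where "\<alpha> \<in> A" "\<beta> < \<alpha>"
proof -
  have "\<not> A \<subseteq> {..\<beta>}"
    using assms countable_atMost_omega1 countable_subset by blast
  then show ?thesis using that by force
qed

definition osuc :: "omega1 \<Rightarrow> omega1" where
  "osuc \<alpha> = (LEAST \<beta>. \<alpha> < \<beta>)"

lemma less_osuc [simp]: "\<alpha> < osuc \<alpha>"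
proof -
  obtain \<beta> where "\<alpha> < \<beta>" using countable_omega1_bounded[of "{\<alpha>}"] by auto
  then show ?thesis unfolding osuc_def by (rule LeastI)
qed

lemma osuc_le_iff: "osuc \<alpha> \<le> \<beta> \<longleftrightarrow> \<alpha> < \<beta>"
  by (metis Least_le less_le_trans less_osuc osuc_def)

lemma less_osuc_iff: "\<beta> < osuc \<alpha> \<longleftrightarrow> \<beta> \<le> \<alpha>"
  by (meson leD leI osuc_le_iff)

lemma osuc_inject [simp]: "osuc \<alpha> = osuc \<beta> \<longleftrightarrow> \<alpha> = \<beta>"
  by (metis antisym less_osuc less_osuc_iff)

definition ozero :: omega1 where "ozero = (LEAST \<alpha>. True)"

lemma ozero_le [simp]: "ozero \<le> \<alpha>"
  by (simp add: Least_le ozero_def)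

lemma not_less_ozero [simp]: "\<not> \<alpha> < ozero"
  by (simp add: not_less)

definition olim :: "omega1 \<Rightarrow> bool" where
  "olim \<delta> \<longleftrightarrow> ozero < \<delta> \<and> (\<forall>\<beta><\<delta>. osuc \<beta> < \<delta>)"

lemma olim_osuc: "olim \<delta> \<Longrightarrow> \<beta> < \<delta> \<Longrightarrow> osuc \<beta> < \<delta>"
  by (simp add: olim_def)

lemma not_olim_ozero [simp]: "\<not> olim ozero"
  by (simp add: olim_def)

lemma not_olim_osuc [simp]: "\<not> olim (osuc \<alpha>)"
  using less_osuc less_irrefl unfolding olim_def by blast

lemma omega1_cases:
  obtains (zero) "\<alpha> = ozero" | (suc) \<beta> where "\<alpha> = osuc \<beta>" | (lim) "olim \<alpha>"
proof (cases "\<alpha> = ozero \<or> olim \<alpha>")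
  case True
  then show ?thesis using zero lim by blast
next
  case False
  then obtain \<beta> where "\<beta> < \<alpha>" "\<not> osuc \<beta> < \<alpha>"
    unfolding olim_def by (meson not_le ozero_le order.not_eq_order_implies_strict)
  then have "\<alpha> = osuc \<beta>" by (simp add: antisym osuc_le_iff not_less)
  then show ?thesis by (rule suc)
qed

text \<open>Any enumeration of the countable set \<open>{..<\<delta>}\<close> is cofinal, though
  perhaps not increasing; the strict inequality comes from the index of
  \<open>osuc \<beta>\<close>.\<close>

lemma olim_countable_cofinal:
  assumes "olim \<delta>"
  shows "\<exists>a :: nat \<Rightarrow> omega1. (\<forall>n. a n < \<delta>) \<and> (\<forall>\<beta><\<delta>. \<exists>n. \<beta> < a n)"
proof -
  have ne: "{..<\<delta>} \<noteq> {}" using assms olim_def by auto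
  define a where "a = from_nat_into {..<\<delta>}"
  have r: "range a = {..<\<delta>}"
    unfolding a_def using ne countable_lessThan_omega1 by (rule range_from_nat_into)
  show ?thesis
  proof (intro exI[of _ a] conjI allI impI)
    show "a n < \<delta>" for n using r by auto
    fix \<beta> assume "\<beta> < \<delta>"
    then have "osuc \<beta> \<in> range a" using r assms by (simp add: olim_osuc)
    then show "\<exists>n. \<beta> < a n" by (metis imageE less_osuc)
  qed
qed

text \<open>
  \<open>\<delta>\<close> is the supremum of the orbit of \<open>\<beta>\<close> under an inflationary function dominating \<open>h\<close>.
\<close>

lemma omega1_closure_point:
  fixes h :: "omega1 \<Rightarrow> omega1"
  obtains \<delta> where "olim \<delta>" "\<beta> < \<delta>" "\<And>\<gamma>. \<gamma> < \<delta> \<Longrightarrow> \<exists>\<xi>. \<gamma> \<le> \<xi> \<and> \<xi> < \<delta> \<and> h \<xi> < \<delta>"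
proof -
  define k where "k \<gamma> = max (osuc \<gamma>) (osuc (h \<gamma>))" for \<gamma>
  define a where "a n = (k ^^ n) \<beta>" for n
  have a: "a n < a (Suc n)" "h (a n) < a (Suc n)" for n
    by (auto simp: a_def k_def less_max_iff_disj)
  have "countable (range a)" by simp
  then obtain \<eta> where ex: "\<forall>n. a n < \<eta>" unfolding omega1_bounded_iff_countable by blast
  define \<delta> where "\<delta> = (LEAST \<eta>. \<forall>n. a n < \<eta>)"
  have d: "a n < \<delta>" for n
    using LeastI[of "\<lambda>\<eta>. \<forall>n. a n < \<eta>", OF ex] unfolding \<delta>_def by blast
  have cof: "\<exists>n. \<gamma> \<le> a n" if "\<gamma> < \<delta>" for \<gamma>
    using not_less_Least[of \<gamma> "\<lambda>\<eta>. \<forall>n. a n < \<eta>"] that unfolding \<delta>_def[symmetric]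
    by (auto simp: not_less)
  show ?thesis
  proof
    have "\<beta> = a 0" by (simp add: a_def)
    then show "\<beta> < \<delta>" using d by metis
    show "olim \<delta>"
      unfolding olim_def
    proof (intro conjI allI impI)
      show "ozero < \<delta>" using \<open>\<beta> < \<delta>\<close> ozero_le by (rule le_less_trans[rotated])
      fix \<gamma> assume "\<gamma> < \<delta>"
      then obtain n where "\<gamma> \<le> a n" using cof by blast
      then have "osuc \<gamma> \<le> a (Suc n)" using a(1)[of n] by (auto simp: osuc_le_iff)
      then show "osuc \<gamma> < \<delta>" using d le_less_trans by blast
    qed
    show "\<exists>\<xi>. \<gamma> \<le> \<xi> \<and> \<xi> < \<delta> \<and> h \<xi> < \<delta>" if "\<gamma> < \<delta>" for \<gamma>
      using cof[OF that] a(2) d less_trans by blast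
  qed
qed

section \<open>Closed unbounded sets of countable ordinals\<close>

definition limit_of :: "omega1 set \<Rightarrow> omega1 \<Rightarrow> bool" where
  "limit_of A \<delta> \<longleftrightarrow> olim \<delta> \<and> (\<forall>\<beta><\<delta>. \<exists>\<alpha>\<in>A. \<beta> < \<alpha> \<and> \<alpha> < \<delta>)"

text \<open>For each \<gamma>, countably many next elements, one from each \<open>A i\<close>, have
  a common bound \<open>h \<gamma>\<close>. A closure point of \<open>h\<close> is then a limit of
  all the \<open>A i\<close> at once.\<close>

lemma common_limit:
  fixes A :: "'i \<Rightarrow> omega1 set"
  assumes "countable I" and unb: "\<And>i. i \<in> I \<Longrightarrow> uncountable (A i)"
  obtains \<delta> where "\<beta> < \<delta>" "olim \<delta>" "\<And>i. i \<in> I \<Longrightarrow> limit_of (A i) \<delta>"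
proof -
  define n where "n i \<gamma> = (SOME \<alpha>. \<alpha> \<in> A i \<and> \<gamma> < \<alpha>)" for i \<gamma>
  have n: "n i \<gamma> \<in> A i \<and> \<gamma> < n i \<gamma>" if "i \<in> I" for i \<gamma>
    unfolding n_def using uncountable_omega1_unbounded[OF unb[OF that], of \<gamma>]
    by (metis (mono_tags, lifting) someI_ex)
  have "\<exists>\<eta>. \<forall>i\<in>I. n i \<gamma> < \<eta>" for \<gamma>
    using countable_image[OF assms(1), of "\<lambda>i. n i \<gamma>"] unfolding omega1_bounded_iff_countable by auto
  then obtain h where h: "n i \<gamma> < h \<gamma>" if "i \<in> I" for i \<gamma> by metis
  obtain \<delta> where d: "olim \<delta>" "\<beta> < \<delta>" "\<And>\<gamma>. \<gamma> < \<delta> \<Longrightarrow> \<exists>\<xi>. \<gamma> \<le> \<xi> \<and> \<xi> < \<delta> \<and> h \<xi> < \<delta>"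
    using omega1_closure_point[where h=h and \<beta>=\<beta>] by blast
  have "limit_of (A i) \<delta>" if i: "i \<in> I" for i
    unfolding limit_of_def
  proof (intro conjI allI impI)
    fix \<gamma> assume "\<gamma> < \<delta>"
    then obtain \<xi> where "\<gamma> \<le> \<xi>" "h \<xi> < \<delta>" using d(3) by blast
    then show "\<exists>\<alpha>\<in>A i. \<gamma> < \<alpha> \<and> \<alpha> < \<delta>"
      using n[OF i, of \<xi>] h[OF i, of \<xi>] by (meson le_less_trans less_trans)
  qed (rule d(1))
  then show ?thesis using that d by blast
qed

text \<open>Order-theoretic counterpart of \<open>club\<close>: closure under limits from below
  replaces topological closedness, and uncountability replaces unboundedness.\<close>

definition cub :: "omega1 set \<Rightarrow> bool" where
  "cub C \<longleftrightarrow> uncountable C \<and> (\<forall>\<delta>. limit_of C \<delta> \<longrightarrow> \<delta> \<in> C)"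

lemma limit_of_mono: "limit_of A \<delta> \<Longrightarrow> A \<subseteq> B \<Longrightarrow> limit_of B \<delta>"
  unfolding limit_of_def by blast

text \<open>A common limit of all the \<open>C i\<close> belongs to each of them, and
  \<open>common_limit\<close> provides such limits above every \<beta>.\<close>

lemma cub_Inter:
  assumes "countable I" and "\<And>i. i \<in> I \<Longrightarrow> cub (C i)"
  shows "cub (\<Inter>i\<in>I. C i)"
  unfolding cub_def
proof (intro conjI allI impI)
  show "uncountable (\<Inter>i\<in>I. C i)"
    unfolding omega1_bounded_iff_countable
  proof
    assume "\<exists>\<beta>. \<forall>\<alpha>\<in>\<Inter>i\<in>I. C i. \<alpha> < \<beta>"
    then obtain \<beta> where \<beta>: "\<And>\<alpha>. \<alpha> \<in> (\<Inter>i\<in>I. C i) \<Longrightarrow> \<alpha> < \<beta>" by blast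
    obtain \<delta> where "\<beta> < \<delta>" "\<And>i. i \<in> I \<Longrightarrow> limit_of (C i) \<delta>"
      using common_limit[of I C \<beta>] assms cub_def by metis
    then have "\<delta> \<in> (\<Inter>i\<in>I. C i)" using assms(2) cub_def by auto
    then show False using \<beta> \<open>\<beta> < \<delta>\<close> by (meson less_asym)
  qed
  fix \<delta> assume "limit_of (\<Inter>i\<in>I. C i) \<delta>"
  then have "limit_of (C i) \<delta>" if "i \<in> I" for i
    using limit_of_mono[of _ \<delta> "C i"] that by blast
  then show "\<delta> \<in> (\<Inter>i\<in>I. C i)" using assms(2) cub_def by auto
qed

text \<open>\<open>omega1_closure_point\<close> controls its function only at cofinally many
  arguments, so it is applied to a \<open>k\<close> for which \<open>k \<gamma>\<close> bounds
  \<open>h\<close> on all of \<open>{..\<gamma>}\<close>.\<close>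

lemma cub_closed_under:
  fixes h :: "omega1 \<Rightarrow> omega1"
  shows "cub {\<delta>. olim \<delta> \<and> (\<forall>\<beta><\<delta>. h \<beta> < \<delta>)}" (is "cub ?C")
  unfolding cub_def
proof (intro conjI allI impI)
  have "\<exists>\<eta>. \<forall>\<beta>\<le>\<gamma>. h \<beta> < \<eta>" for \<gamma>
    using countable_image[OF countable_atMost_omega1, of h \<gamma>] unfolding omega1_bounded_iff_countable
    by auto
  then obtain k where k: "h \<beta> < k \<gamma>" if "\<beta> \<le> \<gamma>" for \<beta> \<gamma> by metis
  show "uncountable ?C"
    unfolding omega1_bounded_iff_countable
  proof
    assume "\<exists>\<beta>. \<forall>\<alpha>\<in>?C. \<alpha> < \<beta>"
    then obtain \<beta> where \<beta>: "\<And>\<alpha>. \<alpha> \<in> ?C \<Longrightarrow> \<alpha> < \<beta>" by blast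
    obtain \<delta> where d: "olim \<delta>" "\<beta> < \<delta>" "\<And>\<gamma>. \<gamma> < \<delta> \<Longrightarrow> \<exists>\<xi>. \<gamma> \<le> \<xi> \<and> \<xi> < \<delta> \<and> k \<xi> < \<delta>"
      using omega1_closure_point[where h=k and \<beta>=\<beta>] by blast
    have "h \<gamma> < \<delta>" if "\<gamma> < \<delta>" for \<gamma>
      using d(3)[OF that] k less_trans by blast
    then have "\<delta> \<in> ?C" using d(1) by blast
    then show False using \<beta> d(2) by (meson less_asym)
  qed
  fix \<delta> assume lim: "limit_of ?C \<delta>"
  have "h \<beta> < \<delta>" if "\<beta> < \<delta>" for \<beta>
  proof -
    obtain \<alpha> where "\<alpha> \<in> ?C" "\<beta> < \<alpha>" "\<alpha> < \<delta>" using lim \<open>\<beta> < \<delta>\<close> unfolding limit_of_def by blast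
    then show ?thesis using less_trans by blast
  qed
  then show "\<delta> \<in> ?C" using lim limit_of_def by auto
qed

lemma cub_of_club:
  assumes "club C"
  shows "cub C"
  unfolding cub_def
proof (intro conjI allI impI)
  show "uncountable C"
    using assms unfolding club_def omega1_bounded_iff_countable bdd_above_def
    by (meson less_imp_le)
  fix \<delta> assume lim: "limit_of C \<delta>"
  show "\<delta> \<in> C"
  proof (rule ccontr)
    assume "\<delta> \<notin> C"
    then have "open (- C)" "\<delta> \<in> - C" using assms club_def by auto
    moreover have "ozero < \<delta>" using lim limit_of_def olim_def by auto
    ultimately obtain \<beta> where "\<beta> < \<delta>" "{\<beta><..\<delta>} \<subseteq> - C"
      using open_left by blast
    then show False using lim unfolding limit_of_def
      by (metis ComplD greaterThanAtMost_iff less_imp_le subsetD)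
  qed
qed

text \<open>The least \<delta> with infinitely many elements of \<open>K\<close> below it is neither
  zero nor a successor, and \<open>K\<close> is finite below every smaller ordinal; hence
  \<open>K\<close> is cofinal in \<delta>.\<close>

lemma omega1_infinite_accumulates:
  assumes K: "infinite K" "\<And>\<gamma>. \<gamma> \<in> K \<Longrightarrow> \<gamma> \<le> \<beta>"
  obtains \<delta> where "\<delta> \<le> \<beta>" "limit_of K \<delta>"
proof -
  define \<delta> where "\<delta> = (LEAST \<delta>. infinite (K \<inter> {..<\<delta>}))"
  have "K \<inter> {..<osuc \<beta>} = K" using K(2) by (auto simp: less_osuc_iff)
  then have b: "infinite (K \<inter> {..<osuc \<beta>})" using K(1) by simp
  then have inf: "infinite (K \<inter> {..<\<delta>})"
    unfolding \<delta>_def by (rule LeastI)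
  have fin: "finite (K \<inter> {..<\<gamma>})" if "\<gamma> < \<delta>" for \<gamma>
    using not_less_Least that unfolding \<delta>_def by blast
  have le: "\<delta> \<le> osuc \<beta>" unfolding \<delta>_def using b by (rule Least_le)
  have lim: "olim \<delta>"
  proof (cases \<delta> rule: omega1_cases)
    case zero
    have "{..<ozero} = {}" by auto
    then show ?thesis using inf zero by simp
  next
    case (suc \<epsilon>)
    have "{..<\<delta>} = insert \<epsilon> {..<\<epsilon>}" using suc by (auto simp: less_osuc_iff)
    moreover have "finite (K \<inter> {..<\<epsilon>})" using fin suc by simp
    ultimately show ?thesis using inf
      by (metis Int_insert_right finite_insert)
  qed
  have "limit_of K \<delta>"
    unfolding limit_of_def
  proof (intro conjI allI impI)
    fix \<gamma> assume "\<gamma> < \<delta>"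
    then have "infinite (K \<inter> {..<\<delta>} - K \<inter> {..<osuc \<gamma>})"
      using inf fin[of "osuc \<gamma>"] lim by (simp add: olim_osuc)
    then obtain x where "x \<in> K \<inter> {..<\<delta>} - K \<inter> {..<osuc \<gamma>}"
      by (metis ex_in_conv finite.emptyI)
    then show "\<exists>\<alpha>\<in>K. \<gamma> < \<alpha> \<and> \<alpha> < \<delta>" by (auto simp: less_osuc_iff not_le)
  qed (rule lim)
  moreover have "\<delta> \<le> \<beta>" using le lim by (metis less_osuc_iff not_olim_osuc order_le_less)
  ultimately show ?thesis using that by blast
qed

section \<open>Injective codings\<close>

lemma omega1_embeds_real: "\<exists>e :: omega1 \<Rightarrow> real. inj e"
proof -
  have "|UNIV :: real set| \<le>o natLeq \<Longrightarrow> False"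
    using uncountable_UNIV_real by (simp add: countable_iff_ordLeq_natLeq[symmetric])
  then have "natLeq <o |UNIV :: real set|"
    by (meson card_of_Well_order natLeq_Well_order not_ordLeq_iff_ordLess)
  then have le: "cardSuc natLeq \<le>o |UNIV :: real set|"
    by (rule cardSuc_least[OF natLeq_Card_order card_of_Card_order])
  have "|UNIV :: omega1 set| \<le>o |Field (cardSuc natLeq)|"
    by (rule card_of_ordLeqI[of Rep_omega1]) (auto simp: inj_on_def Rep_omega1_inject Rep_omega1)
  also have "|Field (cardSuc natLeq)| =o cardSuc natLeq"
    by (simp add: card_of_Field_ordIso cardSuc_Card_order natLeq_Card_order)
  also note le
  finally show ?thesis by (auto simp: card_of_ordLeq[symmetric])
qed

text \<open>The spaces must live on sets of reals. In \<open>nd a k m\<close>, \<open>a\<close> will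
  be the level of a node, \<open>k\<close> its number in that level and \<open>m\<close> the copy of
  the tree.\<close>

lemma coding_into_real:
  obtains nd :: "omega1 \<Rightarrow> nat \<Rightarrow> nat \<Rightarrow> real" and dp :: "omega1 \<Rightarrow> real"
  where "\<And>a k m b l n. nd a k m = nd b l n \<longleftrightarrow> a = b \<and> k = l \<and> m = n"
    and "inj dp" and "\<And>a k m b. nd a k m \<noteq> dp b"
proof -
  obtain e :: "omega1 \<Rightarrow> real" where "inj e" using omega1_embeds_real by blast
  then have e: "|UNIV :: omega1 set| \<le>o |UNIV :: real set|"
    by (auto simp: card_of_ordLeq[symmetric])
  have inf: "infinite (UNIV :: real set)" by (simp add: infinite_UNIV_char_0)
  have n: "|UNIV :: nat set| \<le>o |UNIV :: real set|"
    using inf infinite_iff_card_of_nat by blast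
  have "|(UNIV :: omega1 set) \<times> (UNIV :: nat set) \<times> (UNIV :: nat set)| \<le>o |UNIV :: real set|"
    by (intro card_of_Times_ordLeq_infinite_Field) (simp_all add: inf e n card_of_card_order_on Field_card_of)
  note t = this
  have "|((UNIV :: omega1 set) \<times> (UNIV :: nat set) \<times> (UNIV :: nat set)) <+> (UNIV :: omega1 set)|
      \<le>o |UNIV :: real set|"
    by (intro card_of_Plus_ordLeq_infinite_Field) (simp_all add: inf e t card_of_card_order_on Field_card_of del: UNIV_Times_UNIV)
  then obtain f :: "omega1 \<times> nat \<times> nat + omega1 \<Rightarrow> real" where "inj f"
    by (auto simp: card_of_ordLeq[symmetric])
  then show ?thesis
    by (intro that[of "\<lambda>a k m. f (Inl (a, k, m))" "\<lambda>b. f (Inr b)"]) (auto simp: inj_def)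
qed

text \<open>Transfers \<open>diamond_star\<close>, which guesses subsets of \<open>omega1\<close>,
  to sets of nodes coded by level and number.\<close>

lemma omega1_times_nat_coding: "\<exists>c :: omega1 \<times> nat \<Rightarrow> omega1. inj c"
proof -
  have inf: "infinite (UNIV :: omega1 set)" using uncountable_UNIV_omega1 countable_finite by blast
  then have n: "|UNIV :: nat set| \<le>o |UNIV :: omega1 set|"
    using infinite_iff_card_of_nat by blast
  have "|(UNIV :: omega1 set) \<times> (UNIV :: nat set)| \<le>o |UNIV :: omega1 set|"
    by (intro card_of_Times_ordLeq_infinite_Field) (simp_all add: inf n card_of_card_order_on Field_card_of ordLeq_refl)
  then show ?thesis by (auto simp: card_of_ordLeq[symmetric])
qed

section \<open>Topological preliminaries\<close>

lemma countable_imp_Lindelof_subtopology: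
  "countable S \<Longrightarrow> Lindelof_space (subtopology Y S)"
  by (rule countable_imp_Lindelof_space) simp

lemma discrete_subspace_iff:
  "discrete_subspace Y D \<longleftrightarrow> D \<subseteq> topspace Y \<and> (\<forall>x\<in>D. \<exists>U. openin Y U \<and> U \<inter> D = {x})"
proof -
  have "subtopology Y D = discrete_topology D \<longleftrightarrow> (\<forall>x\<in>D. \<exists>U. openin Y U \<and> U \<inter> D = {x})"
    if "D \<subseteq> topspace Y"
  proof -
    have "(\<exists>U. openin Y U \<and> {x} = U \<inter> D) \<longleftrightarrow> (\<exists>U. openin Y U \<and> U \<inter> D = {x})" for x
      by (simp add: eq_commute)
    then show ?thesis
      using that unfolding eq_commute[of _ "discrete_topology D"] discrete_topology_unique
      by (simp add: openin_subtopology Int_absorb1)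
  qed
  then show ?thesis unfolding discrete_subspace_def by (rule conj_cong[OF refl])
qed

lemma continuous_map_euclidean_order:
  fixes f :: "'a \<Rightarrow> 'b :: linorder_topology"
  assumes "\<And>a. openin Y {x \<in> topspace Y. f x < a}"
    and "\<And>a. openin Y {x \<in> topspace Y. a < f x}"
  shows "continuous_map Y euclidean f"
proof -
  have "openin Y {x \<in> topspace Y. f x \<in> U}" if "open U" for U
    using that unfolding open_generated_order
  proof (induction U rule: generate_topology.induct)
    case UNIV
    then show ?case by simp
  next
    case (Int U V)
    have "{x \<in> topspace Y. f x \<in> U \<inter> V}
      = {x \<in> topspace Y. f x \<in> U} \<inter> {x \<in> topspace Y. f x \<in> V}" by auto
    then show ?case using Int by auto
  next
    case (UN K)
    have "{x \<in> topspace Y. f x \<in> \<Union>K} = (\<Union>k\<in>K. {x \<in> topspace Y. f x \<in> k})" by auto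
    then show ?case using UN by auto
  next
    case (Basis U)
    then show ?case using assms by auto
  qed
  then show ?thesis by (simp add: continuous_map_def)
qed

text \<open>Two points get distance 1/(n+1) for the least n such that \<open>W n\<close> contains
  exactly one of them; this is an ultrametric. The ball of radius 1/(n+1) around x consists of the
  points that no \<open>W i\<close> with i \<le> n separates from x. So clopenness makes balls open,
  and the base property makes open sets unions of balls.\<close>

lemma metrizable_countable_clopen_base:
  fixes W :: "nat \<Rightarrow> 'a set"
  assumes clo: "\<And>i. openin Z (W i) \<and> closedin Z (W i)"
    and base: "\<And>U x. openin Z U \<Longrightarrow> x \<in> U \<Longrightarrow> \<exists>i. x \<in> W i \<and> W i \<subseteq> U"
    and sep: "\<And>x y. x \<in> topspace Z \<Longrightarrow> y \<in> topspace Z \<Longrightarrow> x \<noteq> y \<Longrightarrow> \<exists>i. (x \<in> W i) \<noteq> (y \<in> W i)"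
  shows "metrizable_space Z"
proof -
  define D where "D x y i \<longleftrightarrow> (x \<in> W i) \<noteq> (y \<in> W i)" for x y i
  define d :: "'a \<Rightarrow> 'a \<Rightarrow> real" where
    "d x y = (if \<exists>i. D x y i then inverse (real (Suc (LEAST i. D x y i))) else 0)" for x y
  have sym: "D x y = D y x" for x y unfolding D_def by auto
  have small: "d x y < inverse (real (Suc n)) \<longleftrightarrow> (\<forall>i\<le>n. \<not> D x y i)" for x y n
  proof (cases "\<exists>i. D x y i")
    case True
    then have "d x y < inverse (real (Suc n)) \<longleftrightarrow> n < (LEAST i. D x y i)"
      by (auto simp: d_def)
    also have "\<dots> \<longleftrightarrow> (\<forall>i\<le>n. \<not> D x y i)"
      using LeastI_ex[OF True] not_less_Least[of _ "D x y"]
      by (metis le_less_trans not_le)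
    finally show ?thesis .
  qed (auto simp: d_def)
  have pos: "0 \<le> d x y" for x y by (auto simp: d_def)
  have ultra: "d x z \<le> max (d x y) (d y z)" for x y z
  proof (rule ccontr)
    assume c: "\<not> ?thesis"
    then have "d x z \<noteq> 0" using pos[of x y] by auto
    then have "\<exists>i. D x z i" unfolding d_def by presburger
    define n where "n = (LEAST i. D x z i)"
    have "d x z = inverse (real (Suc n))" using \<open>\<exists>i. D x z i\<close> by (simp add: d_def n_def)
    then have "d x y < inverse (real (Suc n))" "d y z < inverse (real (Suc n))" using c by auto
    then have "\<not> D x y n" "\<not> D y z n" unfolding small by auto
    then have "\<not> D x z n" unfolding D_def by auto
    then show False using \<open>\<exists>i. D x z i\<close> unfolding n_def by (meson LeastI)
  qed
  interpret M: Metric_space "topspace Z" d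
  proof
    show "0 \<le> d x y" for x y by (rule pos)
    show "d x y = d y x" for x y by (simp add: d_def sym)
    show "d x y = 0 \<longleftrightarrow> x = y" if "x \<in> topspace Z" "y \<in> topspace Z" for x y
    proof
      assume "d x y = 0"
      then have "\<not> D x y i" for i by (auto simp: d_def split: if_splits)
      then show "x = y" using sep[OF that] unfolding D_def by auto
    qed (auto simp: d_def D_def)
    show "d x z \<le> d x y + d y z" for x y z
      using ultra[of x z y] pos[of x y] pos[of y z] by linarith
  qed
  have ball: "openin Z (M.mball x (inverse (real (Suc n))))" if "x \<in> topspace Z" for x n
  proof -
    have "M.mball x (inverse (real (Suc n)))
      = (\<Inter>i\<in>{..n}. if x \<in> W i then W i else topspace Z - W i) \<inter> topspace Z"
      using that by (auto simp: M.mball_def small D_def simp del: of_nat_Suc split: if_splits)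
    moreover have "openin Z (\<Inter>i\<in>{..n}. if x \<in> W i then W i else topspace Z - W i)"
      by (rule openin_INT2) (use clo in auto)
    ultimately show ?thesis by auto
  qed
  have "openin Z U \<longleftrightarrow> openin M.mtopology U" for U
  proof
    assume U: "openin Z U"
    show "openin M.mtopology U"
      unfolding M.openin_mtopology
    proof (intro conjI allI impI)
      show "U \<subseteq> topspace Z" using U openin_subset by blast
      fix x assume "x \<in> U"
      then obtain i where i: "x \<in> W i" "W i \<subseteq> U" using base[OF U] by blast
      have "M.mball x (inverse (real (Suc i))) \<subseteq> W i"
        using i by (auto simp: M.mball_def small D_def simp del: of_nat_Suc)
      then show "\<exists>r>0. M.mball x r \<subseteq> U" using i
        by (intro exI[of _ "inverse (real (Suc i))"]) auto
    qed
  next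
    assume U: "openin M.mtopology U"
    show "openin Z U"
      unfolding openin_subopen[of Z U]
    proof
      fix x assume x: "x \<in> U"
      then obtain r where r: "r > 0" "M.mball x r \<subseteq> U" "x \<in> topspace Z"
        using U unfolding M.openin_mtopology by blast
      obtain n where "inverse (real (Suc n)) < r" using reals_Archimedean r(1) by blast
      then have "M.mball x (inverse (real (Suc n))) \<subseteq> U"
        using r(2) by (auto simp: M.mball_def)
      moreover have "x \<in> M.mball x (inverse (real (Suc n)))" using r(3) by simp
      ultimately show "\<exists>T. openin Z T \<and> x \<in> T \<and> T \<subseteq> U" using ball r(3) by blast
    qed
  qed
  then have "Z = M.mtopology" by (simp add: topology_eq)
  then show ?thesis using M.metrizable_space_mtopology by simp
qed

text \<open>A countable open set collects the countable clopen bases at its points into one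
  countable clopen base, which separates points by the Hausdorff property.\<close>

lemma locally_metrizable_if_countable_clopen_bases:
  fixes B :: "'a \<Rightarrow> 'a set set"
  assumes haus: "Hausdorff_space Y"
    and cB: "\<And>x. x \<in> topspace Y \<Longrightarrow> countable (B x)"
    and clo: "\<And>x W. x \<in> topspace Y \<Longrightarrow> W \<in> B x \<Longrightarrow> openin Y W \<and> closedin Y W"
    and base: "\<And>U x. openin Y U \<Longrightarrow> x \<in> U \<Longrightarrow> \<exists>W\<in>B x. x \<in> W \<and> W \<subseteq> U"
    and cnt: "\<And>x. x \<in> topspace Y \<Longrightarrow> \<exists>U. openin Y U \<and> x \<in> U \<and> countable U"
  shows "locally_metrizable Y"
  unfolding locally_metrizable_def
proof
  fix x assume "x \<in> topspace Y"
  then obtain U where U: "openin Y U" "x \<in> U" "countable U" using cnt by blast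
  have Usub: "U \<subseteq> topspace Y" using U(1) openin_subset by blast
  define \<W> where "\<W> = (\<Union>y\<in>U. (\<lambda>W. U \<inter> W) ` B y)"
  have cW: "countable \<W>"
    unfolding \<W>_def using U(3) cB Usub by (intro countable_UN countable_image) auto
  have baseW: "\<exists>W\<in>\<W>. y \<in> W \<and> W \<subseteq> V" if "openin (subtopology Y U) V" "y \<in> V" for V y
  proof -
    obtain T where T: "openin Y T" "V = T \<inter> U" using \<open>openin (subtopology Y U) V\<close>
      by (auto simp: openin_subtopology)
    then obtain W where W: "W \<in> B y" "y \<in> W" "W \<subseteq> T" using base \<open>y \<in> V\<close> by blast
    have "U \<inter> W \<in> \<W>" using W(1) T that unfolding \<W>_def by blast
    then show ?thesis using W T that by blast
  qed
  have ne: "\<W> \<noteq> {}" using baseW[of U x] U openin_topspace[of "subtopology Y U"] Usub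
    by (auto simp: Int_absorb1)
  define W where "W = from_nat_into \<W>"
  have rW: "range W = \<W>" unfolding W_def using ne cW by (rule range_from_nat_into)
  have "metrizable_space (subtopology Y U)"
  proof (rule metrizable_countable_clopen_base[of _ W])
    fix i
    have "W i \<in> \<W>" using rW by auto
    then obtain y V where V: "y \<in> U" "V \<in> B y" "W i = U \<inter> V" unfolding \<W>_def by blast
    then have "openin Y V" "closedin Y V" using clo Usub by auto
    then show "openin (subtopology Y U) (W i) \<and> closedin (subtopology Y U) (W i)"
      unfolding V(3) by (simp add: openin_subtopology_Int2 closedin_subtopology_Int_closed)
  next
    fix V y assume "openin (subtopology Y U) V" "y \<in> V"
    then show "\<exists>i. y \<in> W i \<and> W i \<subseteq> V" using baseW rW by (metis imageE)
  next
    fix y z assume yz: "y \<in> topspace (subtopology Y U)" "z \<in> topspace (subtopology Y U)" "y \<noteq> z"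
    have "Hausdorff_space (subtopology Y U)" using haus by (rule Hausdorff_space_subtopology)
    then obtain V where "openin (subtopology Y U) V" "y \<in> V" "z \<notin> V"
      using yz unfolding Hausdorff_space_def disjnt_iff by metis
    then obtain W' where "W' \<in> \<W>" "y \<in> W'" "z \<notin> W'" using baseW by blast
    moreover from this obtain i where "W i = W'" using rW by auto
    ultimately show "\<exists>i. (y \<in> W i) \<noteq> (z \<in> W i)" by blast
  qed
  then show "\<exists>U. openin Y U \<and> x \<in> U \<and> metrizable_space (subtopology Y U)" using U by blast
qed

text \<open>Along an enumeration of \<open>E\<close>, the clopen neighbourhoods of the earlier
  points are removed from that of each point. Only finitely many are removed, so the difference
  stays open, and each \<open>W d\<close> meets \<open>E\<close> in \<open>d\<close> alone, so no
  point of \<open>E\<close> is lost.\<close>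

lemma countable_discrete_clopen_expansion:
  assumes E: "countable E" "closedin Y E" "discrete_subspace Y E"
    and base: "\<And>U x. openin Y U \<Longrightarrow> x \<in> U \<Longrightarrow> \<exists>W. openin Y W \<and> closedin Y W \<and> x \<in> W \<and> W \<subseteq> U"
  obtains V where "\<And>d. d \<in> E \<Longrightarrow> openin Y (V d) \<and> d \<in> V d" "disjoint_family_on V E"
proof -
  have "\<exists>W. openin Y W \<and> closedin Y W \<and> d \<in> W \<and> W \<inter> E = {d}" if "d \<in> E" for d
  proof -
    obtain U where "openin Y U" "U \<inter> E = {d}" using E(3) \<open>d \<in> E\<close> discrete_subspace_iff by metis
    then show ?thesis using base[of U d] that by blast
  qed
  then obtain W where W: "\<And>d. d \<in> E \<Longrightarrow> openin Y (W d) \<and> closedin Y (W d) \<and> d \<in> W d \<and> W d \<inter> E = {d}"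
    by metis
  define f where "f = to_nat_on E"
  have f: "inj_on f E" unfolding f_def using E(1) by (rule inj_on_to_nat_on)
  define V where "V d = W d - (\<Union>e\<in>{e \<in> E. f e < f d}. W e)" for d
  have fin: "finite {e \<in> E. f e < n}" for n
  proof (rule finite_imageD)
    show "finite (f ` {e \<in> E. f e < n})" by (rule finite_subset[of _ "{..<n}"]) auto
    show "inj_on f {e \<in> E. f e < n}" using f by (rule inj_on_subset) auto
  qed
  show ?thesis
  proof
    fix d assume d: "d \<in> E"
    have "closedin Y (\<Union>e\<in>{e \<in> E. f e < f d}. W e)"
      by (rule closedin_Union) (use fin W in auto)
    then have "openin Y (V d)" unfolding V_def using W[OF d] by blast
    moreover have "d \<notin> W e" if "e \<in> E" "f e < f d" for e
      using W[OF that(1)] d that(2) by (metis IntI less_irrefl singletonD)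
    then have "d \<in> V d" unfolding V_def using W[OF d] by blast
    ultimately show "openin Y (V d) \<and> d \<in> V d" ..
  next
    have "V d \<inter> V e = {}" if "d \<in> E" "e \<in> E" "f d < f e" for d e
      using that unfolding V_def by blast
    moreover have "f d < f e \<or> f e < f d" if "d \<in> E" "e \<in> E" "d \<noteq> e" for d e
      using f that by (metis inj_onD nat_neq_iff)
    ultimately show "disjoint_family_on V E"
      unfolding disjoint_family_on_def by (metis Int_commute)
  qed
qed

section \<open>Hausdorff \<open>\<omega>\<^sub>1\<close>-trees\<close>

text \<open>
  \<open>res \<beta> x\<close> is the predecessor of the node \<open>x\<close> on level \<open>\<beta> \<le> lev x\<close>; so \<open>x\<close> lies below \<open>y\<close>
  iff \<open>lev x \<le> lev y\<close> and \<open>res (lev x) y = x\<close>.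
\<close>

locale omega1_tree =
  fixes N :: "'n set" and lev :: "'n \<Rightarrow> omega1" and res :: "omega1 \<Rightarrow> 'n \<Rightarrow> 'n"
  assumes res_in: "\<And>x \<beta>. x \<in> N \<Longrightarrow> \<beta> \<le> lev x \<Longrightarrow> res \<beta> x \<in> N"
    and lev_res: "\<And>x \<beta>. x \<in> N \<Longrightarrow> \<beta> \<le> lev x \<Longrightarrow> lev (res \<beta> x) = \<beta>"
    and res_lev: "\<And>x. x \<in> N \<Longrightarrow> res (lev x) x = x"
    and res_res: "\<And>x \<alpha> \<beta>. x \<in> N \<Longrightarrow> \<alpha> \<le> \<beta> \<Longrightarrow> \<beta> \<le> lev x \<Longrightarrow> res \<alpha> (res \<beta> x) = res \<alpha> x"
    and limit_node_unique: "\<And>x y. x \<in> N \<Longrightarrow> y \<in> N \<Longrightarrow> lev x = lev y \<Longrightarrow> olim (lev x) \<Longrightarrow>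
      (\<And>\<alpha>. \<alpha> < lev x \<Longrightarrow> res \<alpha> x = res \<alpha> y) \<Longrightarrow> x = y"
    and countable_level: "\<And>\<alpha>. countable {x \<in> N. lev x = \<alpha>}"
    and level_nonempty: "\<And>\<alpha>. \<exists>x\<in>N. lev x = \<alpha>"
    and no_branch: "\<And>b. \<not> (\<forall>\<beta>. b \<beta> \<in> N \<and> lev (b \<beta>) = \<beta> \<and> (\<forall>\<alpha>\<le>\<beta>. res \<alpha> (b \<beta>) = b \<alpha>))"
begin

definition antichain :: "'n set \<Rightarrow> bool" where
  "antichain A \<longleftrightarrow> A \<subseteq> N \<and> (\<forall>x\<in>A. \<forall>y\<in>A. lev x < lev y \<longrightarrow> res (lev x) y \<noteq> x)"

lemma countable_below: "countable {x \<in> N. lev x \<le> \<alpha>}"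
proof -
  have "{x \<in> N. lev x \<le> \<alpha>} = (\<Union>\<beta>\<in>{..\<alpha>}. {x \<in> N. lev x = \<beta>})" by auto
  then show ?thesis using countable_level countable_atMost_omega1 by auto
qed

lemma uncountable_above:
  assumes "uncountable A" "A \<subseteq> N"
  shows "uncountable {x \<in> A. \<beta> \<le> lev x}"
proof
  assume "countable {x \<in> A. \<beta> \<le> lev x}"
  then have "countable ({x \<in> A. \<beta> \<le> lev x} \<union> {x \<in> N. lev x \<le> \<beta>})"
    using countable_below by auto
  moreover have "A \<subseteq> {x \<in> A. \<beta> \<le> lev x} \<union> {x \<in> N. lev x \<le> \<beta>}" using assms(2) by auto
  ultimately show False using assms(1) countable_subset by blast
qed

definition cone :: "'n \<Rightarrow> 'n set" where
  "cone x = {z \<in> N. lev x \<le> lev z \<and> res (lev x) z = x}"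

text \<open>If every level had only one node with uncountably many elements of \<open>A\<close>
  above it, these nodes would form a branch. A splitting found on a limit level already shows on an
  earlier successor level; a nonlimit level is wanted because there the cones are clopen.\<close>

lemma uncountable_splits:
  assumes A: "uncountable A" "A \<subseteq> N"
  obtains x y where "x \<in> N" "y \<in> N" "x \<noteq> y" "lev x = lev y" "\<not> olim (lev x)"
    "uncountable (A \<inter> cone x)" "uncountable (A \<inter> cone y)"
proof -
  define B where "B \<beta> = {x \<in> N. lev x = \<beta> \<and> uncountable (A \<inter> cone x)}" for \<beta>
  have ne: "\<exists>x. x \<in> B \<beta>" for \<beta>
  proof (rule ccontr)
    assume "\<nexists>x. x \<in> B \<beta>"
    then have "countable (\<Union>x\<in>{x \<in> N. lev x = \<beta>}. A \<inter> cone x)"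
      using countable_level[of \<beta>] by (intro countable_UN) (auto simp: B_def)
    moreover have "{x \<in> A. \<beta> \<le> lev x} \<subseteq> (\<Union>x\<in>{x \<in> N. lev x = \<beta>}. A \<inter> cone x)"
    proof
      fix z assume "z \<in> {x \<in> A. \<beta> \<le> lev x}"
      then have "res \<beta> z \<in> {x \<in> N. lev x = \<beta>}" "z \<in> A \<inter> cone (res \<beta> z)"
        using A(2) by (auto simp: cone_def res_in lev_res)
      then show "z \<in> (\<Union>x\<in>{x \<in> N. lev x = \<beta>}. A \<inter> cone x)" by blast
    qed
    ultimately show False using uncountable_above[OF A] countable_subset by blast
  qed
  have mono: "res \<alpha> x \<in> B \<alpha>" if "x \<in> B \<beta>" "\<alpha> \<le> \<beta>" for \<alpha> \<beta> x
  proof -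
    have x: "x \<in> N" "lev x = \<beta>" using that B_def by auto
    have "cone x \<subseteq> cone (res \<alpha> x)"
      using x that(2) by (auto simp: cone_def lev_res) (metis order_trans res_res)
    then have "A \<inter> cone x \<subseteq> A \<inter> cone (res \<alpha> x)" by blast
    then have "uncountable (A \<inter> cone (res \<alpha> x))"
      using that(1) countable_subset unfolding B_def by blast
    then show ?thesis using x that(2) by (auto simp: B_def res_in lev_res)
  qed
  obtain \<beta> x y where xy: "x \<in> B \<beta>" "y \<in> B \<beta>" "x \<noteq> y"
  proof (rule ccontr)
    assume c: "\<not> thesis"
    note split = that
    obtain b where b: "\<And>\<beta>. b \<beta> \<in> B \<beta>" using ne by metis
    have "res \<alpha> (b \<beta>) = b \<alpha>" if "\<alpha> \<le> \<beta>" for \<alpha> \<beta>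
      using mono[OF b that] b[of \<alpha>] c split[of "res \<alpha> (b \<beta>)" \<alpha> "b \<alpha>"] by blast
    moreover have "b \<beta> \<in> N" "lev (b \<beta>) = \<beta>" for \<beta> using b[of \<beta>] by (simp_all add: B_def)
    ultimately show False using no_branch[of b] by simp
  qed
  obtain x' y' where "x' \<in> B (lev x')" "y' \<in> B (lev x')" "x' \<noteq> y'" "\<not> olim (lev x')"
  proof (cases "olim \<beta>")
    case False
    then show ?thesis using xy that by (auto simp: B_def)
  next
    case True
    have N: "x \<in> N" "y \<in> N" "lev x = \<beta>" "lev y = \<beta>" using xy B_def by auto
    obtain \<alpha> where a: "\<alpha> < \<beta>" "res \<alpha> x \<noteq> res \<alpha> y"
      using limit_node_unique[of x y] N True xy(3) by auto
    then have s: "osuc \<alpha> < \<beta>" using True by (simp add: olim_osuc)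
    then have "res (osuc \<alpha>) x \<noteq> res (osuc \<alpha>) y"
      using a N by (metis less_imp_le less_osuc res_res)
    moreover have "res (osuc \<alpha>) x \<in> B (osuc \<alpha>)" "res (osuc \<alpha>) y \<in> B (osuc \<alpha>)"
      using mono xy(1,2) s by auto
    moreover have "lev (res (osuc \<alpha>) x) = osuc \<alpha>" using s N lev_res by auto
    ultimately show ?thesis using that by (metis not_olim_osuc)
  qed
  then show ?thesis using that by (auto simp: B_def)
qed

end

section \<open>The space of a tree\<close>

text \<open>
  The points are the nodes \<open>nd x m\<close> of countably many copies of the tree, each clopen with its
  tree topology, and one point \<open>dp a\<close> for each \<open>a\<close>, to which the successor levels \<open>osuc a\<close> of the
  copies converge.
\<close>

locale tree_space = omega1_tree N lev res
  for N :: "'n set" and lev :: "'n \<Rightarrow> omega1" and res :: "omega1 \<Rightarrow> 'n \<Rightarrow> 'n" +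
  fixes nd :: "'n \<Rightarrow> nat \<Rightarrow> 'a" and dp :: "omega1 \<Rightarrow> 'a"
  assumes nd_eq: "\<And>x y m k. x \<in> N \<Longrightarrow> y \<in> N \<Longrightarrow> nd x m = nd y k \<longleftrightarrow> x = y \<and> m = k"
    and inj_dp: "inj dp"
    and nd_neq_dp: "\<And>x m a. x \<in> N \<Longrightarrow> nd x m \<noteq> dp a"
begin

lemma dp_eq [simp]: "dp a = dp b \<longleftrightarrow> a = b"
  using inj_dp by (rule inj_eq)

definition nodes :: "'a set" where "nodes = {nd x m |x m. x \<in> N}"

text \<open>No condition is imposed at nodes on nonlimit levels, so these are isolated.\<close>

definition tree_open :: "'a set \<Rightarrow> bool" where
  "tree_open U \<longleftrightarrow> U \<subseteq> nodes \<union> range dp \<and>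
    (\<forall>x\<in>N. \<forall>m. nd x m \<in> U \<and> olim (lev x) \<longrightarrow>
      (\<exists>\<beta><lev x. \<forall>\<gamma>. \<beta> < \<gamma> \<and> \<gamma> \<le> lev x \<longrightarrow> nd (res \<gamma> x) m \<in> U)) \<and>
    (\<forall>a. dp a \<in> U \<longrightarrow> (\<exists>n. \<forall>m\<ge>n. \<forall>x\<in>N. lev x = osuc a \<longrightarrow> nd x m \<in> U))"

lemma tree_open_subset: "tree_open U \<Longrightarrow> U \<subseteq> nodes \<union> range dp"
  unfolding tree_open_def by (elim conjE)

lemma tree_open_node:
  assumes "tree_open U" "x \<in> N" "nd x m \<in> U" "olim (lev x)"
  shows "\<exists>\<beta><lev x. \<forall>\<gamma>. \<beta> < \<gamma> \<and> \<gamma> \<le> lev x \<longrightarrow> nd (res \<gamma> x) m \<in> U"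
proof -
  have "\<forall>x\<in>N. \<forall>m. nd x m \<in> U \<and> olim (lev x) \<longrightarrow>
      (\<exists>\<beta><lev x. \<forall>\<gamma>. \<beta> < \<gamma> \<and> \<gamma> \<le> lev x \<longrightarrow> nd (res \<gamma> x) m \<in> U)"
    using assms(1) unfolding tree_open_def by (elim conjE)
  from bspec[OF this assms(2), THEN spec, THEN mp] show ?thesis using assms(3,4) by simp
qed

lemma tree_open_dp:
  assumes "tree_open U" "dp a \<in> U"
  shows "\<exists>n. \<forall>m\<ge>n. \<forall>x\<in>N. lev x = osuc a \<longrightarrow> nd x m \<in> U"
proof -
  have "\<forall>a. dp a \<in> U \<longrightarrow> (\<exists>n. \<forall>m\<ge>n. \<forall>x\<in>N. lev x = osuc a \<longrightarrow> nd x m \<in> U)"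
    using assms(1) unfolding tree_open_def by (elim conjE)
  from this[THEN spec, THEN mp, OF assms(2)] show ?thesis .
qed

lemma tree_openI:
  assumes "U \<subseteq> nodes \<union> range dp"
    and "\<And>x m. x \<in> N \<Longrightarrow> nd x m \<in> U \<Longrightarrow> olim (lev x) \<Longrightarrow>
      \<exists>\<beta><lev x. \<forall>\<gamma>. \<beta> < \<gamma> \<and> \<gamma> \<le> lev x \<longrightarrow> nd (res \<gamma> x) m \<in> U"
    and "\<And>a. dp a \<in> U \<Longrightarrow> \<exists>n. \<forall>m\<ge>n. \<forall>x\<in>N. lev x = osuc a \<longrightarrow> nd x m \<in> U"
  shows "tree_open U"
  unfolding tree_open_def using assms by (intro conjI ballI allI impI) auto

lemma istopology_tree_open:
  "istopology tree_open"
  unfolding istopology_def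
proof (intro conjI allI impI)
  fix U V assume U: "tree_open U" and V: "tree_open V"
  show "tree_open (U \<inter> V)"
  proof (rule tree_openI)
    show "U \<inter> V \<subseteq> nodes \<union> range dp" using tree_open_subset[OF U] by blast
    fix x m assume x: "x \<in> N" "nd x m \<in> U \<inter> V" "olim (lev x)"
    obtain \<beta> where b: "\<beta> < lev x" "\<forall>\<gamma>. \<beta> < \<gamma> \<and> \<gamma> \<le> lev x \<longrightarrow> nd (res \<gamma> x) m \<in> U"
      using tree_open_node[OF U x(1) _ x(3)] x(2) by blast
    obtain \<beta>' where b': "\<beta>' < lev x" "\<forall>\<gamma>. \<beta>' < \<gamma> \<and> \<gamma> \<le> lev x \<longrightarrow> nd (res \<gamma> x) m \<in> V"
      using tree_open_node[OF V x(1) _ x(3)] x(2) by blast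
    show "\<exists>\<beta><lev x. \<forall>\<gamma>. \<beta> < \<gamma> \<and> \<gamma> \<le> lev x \<longrightarrow> nd (res \<gamma> x) m \<in> U \<inter> V"
      by (rule exI[of _ "max \<beta> \<beta>'"]) (use b b' in simp)
  next
    fix a assume a: "dp a \<in> U \<inter> V"
    obtain n where n: "\<forall>m\<ge>n. \<forall>x\<in>N. lev x = osuc a \<longrightarrow> nd x m \<in> U"
      using tree_open_dp[OF U] a by blast
    obtain n' where n': "\<forall>m\<ge>n'. \<forall>x\<in>N. lev x = osuc a \<longrightarrow> nd x m \<in> V"
      using tree_open_dp[OF V] a by blast
    show "\<exists>n. \<forall>m\<ge>n. \<forall>x\<in>N. lev x = osuc a \<longrightarrow> nd x m \<in> U \<inter> V"
      by (rule exI[of _ "max n n'"]) (use n n' in simp)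
  qed
next
  fix \<K> assume K: "\<forall>K\<in>\<K>. tree_open K"
  show "tree_open (\<Union>\<K>)"
  proof (rule tree_openI)
    show "\<Union>\<K> \<subseteq> nodes \<union> range dp" using K tree_open_subset by (simp add: Sup_least)
    fix x m assume x: "x \<in> N" "nd x m \<in> \<Union>\<K>" "olim (lev x)"
    then obtain U where U: "U \<in> \<K>" "nd x m \<in> U" by blast
    then have "tree_open U" using K by simp
    then show "\<exists>\<beta><lev x. \<forall>\<gamma>. \<beta> < \<gamma> \<and> \<gamma> \<le> lev x \<longrightarrow> nd (res \<gamma> x) m \<in> \<Union>\<K>"
      using tree_open_node[OF _ x(1) U(2) x(3)] U(1) by (meson UnionI)
  next
    fix a assume "dp a \<in> \<Union>\<K>"
    then obtain U where U: "U \<in> \<K>" "dp a \<in> U" by blast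
    then have "tree_open U" using K by simp
    then show "\<exists>n. \<forall>m\<ge>n. \<forall>x\<in>N. lev x = osuc a \<longrightarrow> nd x m \<in> \<Union>\<K>"
      using tree_open_dp[OF _ U(2)] U(1) by (meson UnionI)
  qed
qed

definition Y :: "'a topology" where "Y = topology tree_open"

lemma openin_Y: "openin Y U \<longleftrightarrow> tree_open U"
  unfolding Y_def using istopology_tree_open by simp

lemma openin_YI:
  assumes "U \<subseteq> nodes \<union> range dp"
    and "\<And>x m. x \<in> N \<Longrightarrow> nd x m \<in> U \<Longrightarrow> olim (lev x) \<Longrightarrow>
      \<exists>\<beta><lev x. \<forall>\<gamma>. \<beta> < \<gamma> \<and> \<gamma> \<le> lev x \<longrightarrow> nd (res \<gamma> x) m \<in> U"
    and "\<And>a. dp a \<in> U \<Longrightarrow> \<exists>n. \<forall>m\<ge>n. \<forall>x\<in>N. lev x = osuc a \<longrightarrow> nd x m \<in> U"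
  shows "openin Y U"
  unfolding openin_Y using assms by (rule tree_openI)

lemma openin_Y_node:
  assumes "openin Y U" "x \<in> N" "nd x m \<in> U" "olim (lev x)"
  obtains \<beta> where "\<beta> < lev x" "\<And>\<gamma>. \<beta> < \<gamma> \<Longrightarrow> \<gamma> \<le> lev x \<Longrightarrow> nd (res \<gamma> x) m \<in> U"
  using tree_open_node[OF assms(1)[unfolded openin_Y] assms(2-4)] by blast

lemma openin_Y_dp:
  assumes "openin Y U" "dp a \<in> U"
  obtains n where "\<And>m x. m \<ge> n \<Longrightarrow> x \<in> N \<Longrightarrow> lev x = osuc a \<Longrightarrow> nd x m \<in> U"
  using tree_open_dp[OF assms(1)[unfolded openin_Y] assms(2)] by blast

lemma nd_in_nodes [simp]: "x \<in> N \<Longrightarrow> nd x m \<in> nodes"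
  unfolding nodes_def by blast

lemma dp_notin_nodes [simp]: "dp a \<notin> nodes"
proof
  assume "dp a \<in> nodes"
  then obtain x m where "x \<in> N" "nd x m = dp a" unfolding nodes_def by auto
  then show False using nd_neq_dp by blast
qed

lemma topspace_Y: "topspace Y = nodes \<union> range dp"
proof
  show "topspace Y \<subseteq> nodes \<union> range dp"
    using openin_topspace[of Y] unfolding openin_Y by (rule tree_open_subset)
  have "openin Y (nodes \<union> range dp)"
  proof (rule openin_YI)
    fix x m assume "x \<in> N" "olim (lev x)"
    then show "\<exists>\<beta><lev x. \<forall>\<gamma>. \<beta> < \<gamma> \<and> \<gamma> \<le> lev x \<longrightarrow> nd (res \<gamma> x) m \<in> nodes \<union> range dp"
      by (intro exI[of _ ozero]) (auto simp: olim_def res_in)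
  qed auto
  then show "nodes \<union> range dp \<subseteq> topspace Y" by (rule openin_subset)
qed

lemma topspace_cases:
  assumes "p \<in> topspace Y"
  obtains (node) x m where "x \<in> N" "p = nd x m" | (limit) a where "p = dp a"
  using assms unfolding topspace_Y nodes_def by blast

lemma openin_nodes: "openin Y nodes"
proof (rule openin_YI)
  fix x m assume "x \<in> N" "olim (lev x)"
  then show "\<exists>\<beta><lev x. \<forall>\<gamma>. \<beta> < \<gamma> \<and> \<gamma> \<le> lev x \<longrightarrow> nd (res \<gamma> x) m \<in> nodes"
    by (intro exI[of _ ozero]) (auto simp: olim_def res_in)
qed auto

subsection \<open>Clopen neighbourhood bases\<close>

definition seg :: "omega1 \<Rightarrow> 'n \<Rightarrow> nat \<Rightarrow> 'a set" where
  "seg \<beta> x m = {nd (res \<gamma> x) m |\<gamma>. \<beta> \<le> \<gamma> \<and> \<gamma> \<le> lev x}"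

lemma nd_in_seg_iff:
  assumes "x \<in> N" "y \<in> N"
  shows "nd y k \<in> seg \<beta> x m \<longleftrightarrow> k = m \<and> \<beta> \<le> lev y \<and> lev y \<le> lev x \<and> res (lev y) x = y"
proof -
  have "nd y k \<in> seg \<beta> x m \<longleftrightarrow> (\<exists>\<gamma>. y = res \<gamma> x \<and> k = m \<and> \<beta> \<le> \<gamma> \<and> \<gamma> \<le> lev x)"
    unfolding seg_def using assms nd_eq res_in by auto
  also have "\<dots> \<longleftrightarrow> k = m \<and> \<beta> \<le> lev y \<and> lev y \<le> lev x \<and> res (lev y) x = y"
    using assms lev_res by metis
  finally show ?thesis .
qed

lemma seg_subset: "x \<in> N \<Longrightarrow> seg \<beta> x m \<subseteq> nodes"
  unfolding seg_def using res_in nd_in_nodes by blast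

lemma dp_notin_seg: "x \<in> N \<Longrightarrow> dp a \<notin> seg \<beta> x m"
  using seg_subset dp_notin_nodes by blast

text \<open>Since \<beta> is no limit, every limit node of the segment lies strictly above its first
  level, and the tail required by \<open>tree_open\<close> fits into the segment.\<close>

lemma openin_seg:
  assumes x: "x \<in> N" and b: "\<not> olim \<beta>"
  shows "openin Y (seg \<beta> x m)"
proof (rule openin_YI)
  show "seg \<beta> x m \<subseteq> nodes \<union> range dp" using seg_subset[OF x] by blast
  fix y k assume y: "y \<in> N" "nd y k \<in> seg \<beta> x m" "olim (lev y)"
  then have *: "k = m" "\<beta> \<le> lev y" "lev y \<le> lev x" "res (lev y) x = y"
    using nd_in_seg_iff x by auto
  have "\<beta> < lev y" using * b y(3) by (metis order_le_less)
  moreover have "nd (res \<gamma> y) k \<in> seg \<beta> x m" if "\<beta> < \<gamma>" "\<gamma> \<le> lev y" for \<gamma>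
  proof -
    have "res \<gamma> y = res \<gamma> x" using *(3,4) that(2) res_res x by metis
    moreover have "\<gamma> \<le> lev x" using that *(3) by simp
    ultimately show ?thesis unfolding seg_def using that *(1) by auto
  qed
  ultimately show "\<exists>\<beta>'<lev y. \<forall>\<gamma>. \<beta>' < \<gamma> \<and> \<gamma> \<le> lev y \<longrightarrow> nd (res \<gamma> y) k \<in> seg \<beta> x m"
    by blast
next
  fix a assume "dp a \<in> seg \<beta> x m"
  then show "\<exists>n. \<forall>m'\<ge>n. \<forall>y\<in>N. lev y = osuc a \<longrightarrow> nd y m' \<in> seg \<beta> x m"
    using dp_notin_seg x by blast
qed

text \<open>Here \<open>limit_node_unique\<close> enters the topology: a limit node off the branch
  of \<open>x\<close> has left that branch at some earlier level, and so has a tail of its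
  predecessors.\<close>

lemma eventually_off_branch:
  assumes x: "x \<in> N" and y: "y \<in> N" "olim (lev y)"
    and off: "\<not> (lev y \<le> lev x \<and> res (lev y) x = y)"
  obtains \<beta> where "\<beta> < lev y"
    "\<And>\<gamma>. \<beta> < \<gamma> \<Longrightarrow> \<gamma> \<le> lev y \<Longrightarrow> \<not> (\<gamma> \<le> lev x \<and> res \<gamma> x = res \<gamma> y)"
proof (cases "lev y \<le> lev x")
  case False
  show ?thesis by (rule that[of "lev x"]) (use False in auto)
next
  case True
  then have z: "res (lev y) x \<in> N" "lev (res (lev y) x) = lev y" "res (lev y) x \<noteq> y"
    using x off res_in lev_res by auto
  then obtain \<alpha> where a: "\<alpha> < lev y" "res \<alpha> (res (lev y) x) \<noteq> res \<alpha> y"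
    using limit_node_unique[of "res (lev y) x" y] y by auto
  then have a': "res \<alpha> x \<noteq> res \<alpha> y" using True x res_res by auto
  have "res \<gamma> x \<noteq> res \<gamma> y" if "\<alpha> < \<gamma>" "\<gamma> \<le> lev y" for \<gamma>
  proof
    have "\<alpha> \<le> \<gamma>" "\<gamma> \<le> lev x" using that True by auto
    then have e: "res \<alpha> (res \<gamma> x) = res \<alpha> x" "res \<alpha> (res \<gamma> y) = res \<alpha> y"
      using res_res x y(1) that(2) by auto
    assume "res \<gamma> x = res \<gamma> y"
    then show False using a' e by simp
  qed
  then show ?thesis using that a(1) by blast
qed

lemma closedin_seg:
  assumes x: "x \<in> N"
  shows "closedin Y (seg \<beta> x m)"
  unfolding closedin_def
proof
  show "seg \<beta> x m \<subseteq> topspace Y" using seg_subset[OF x] topspace_Y by blast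
  show "openin Y (topspace Y - seg \<beta> x m)"
  proof (rule openin_YI)
    show "topspace Y - seg \<beta> x m \<subseteq> nodes \<union> range dp" using topspace_Y by auto
    fix y k assume y: "y \<in> N" "nd y k \<in> topspace Y - seg \<beta> x m" "olim (lev y)"
    then have n: "\<not> (k = m \<and> \<beta> \<le> lev y \<and> lev y \<le> lev x \<and> res (lev y) x = y)"
      using nd_in_seg_iff x by blast
    have mem: "nd (res \<gamma> y) k \<in> topspace Y" if "\<gamma> \<le> lev y" for \<gamma>
      using res_in[OF y(1) that] topspace_Y by auto
    have mem': "nd (res \<gamma> y) k \<in> seg \<beta> x m \<longleftrightarrow> k = m \<and> \<beta> \<le> \<gamma> \<and> \<gamma> \<le> lev x \<and> res \<gamma> x = res \<gamma> y"
      if "\<gamma> \<le> lev y" for \<gamma>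
      using nd_in_seg_iff[OF x res_in[OF y(1) that]] lev_res[OF y(1) that] by simp
    consider "k \<noteq> m \<or> \<not> \<beta> \<le> lev y" | "\<not> (lev y \<le> lev x \<and> res (lev y) x = y)" using n by blast
    then show "\<exists>\<beta>'<lev y. \<forall>\<gamma>. \<beta>' < \<gamma> \<and> \<gamma> \<le> lev y \<longrightarrow> nd (res \<gamma> y) k \<in> topspace Y - seg \<beta> x m"
    proof cases
      case 1
      then have "nd (res \<gamma> y) k \<in> topspace Y - seg \<beta> x m" if "\<gamma> \<le> lev y" for \<gamma>
        using mem[OF that] mem'[OF that] that by auto
      then show ?thesis using y(3) unfolding olim_def by blast
    next
      case 2
      obtain \<beta>' where "\<beta>' < lev y"
        "\<And>\<gamma>. \<beta>' < \<gamma> \<Longrightarrow> \<gamma> \<le> lev y \<Longrightarrow> \<not> (\<gamma> \<le> lev x \<and> res \<gamma> x = res \<gamma> y)"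
        using eventually_off_branch[OF x y(1,3) 2] by blast
      then show ?thesis using mem mem' by blast
    qed
  next
    fix a assume "dp a \<in> topspace Y - seg \<beta> x m"
    \<comment> \<open>The segment lies in copy \<open>m\<close>, so all later copies avoid
      it.\<close>
    have "nd y m' \<in> topspace Y - seg \<beta> x m" if "m' \<ge> Suc m" "y \<in> N" for m' y
      using that nd_in_seg_iff x topspace_Y by auto
    then show "\<exists>n. \<forall>m'\<ge>n. \<forall>y\<in>N. lev y = osuc a \<longrightarrow> nd y m' \<in> topspace Y - seg \<beta> x m" by blast
  qed
qed

lemma nd_in_seg: "x \<in> N \<Longrightarrow> \<beta> \<le> lev x \<Longrightarrow> nd x m \<in> seg \<beta> x m"
  by (simp add: nd_in_seg_iff res_lev)

lemma seg_base:
  assumes U: "openin Y U" and x: "x \<in> N" "nd x m \<in> U"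
  obtains \<beta> where "\<not> olim \<beta>" "\<beta> \<le> lev x" "seg \<beta> x m \<subseteq> U"
proof (cases "olim (lev x)")
  case True
  obtain \<beta> where b: "\<beta> < lev x" "\<And>\<gamma>. \<beta> < \<gamma> \<Longrightarrow> \<gamma> \<le> lev x \<Longrightarrow> nd (res \<gamma> x) m \<in> U"
    using openin_Y_node[OF U x True] by blast
  show ?thesis
    by (rule that[of "osuc \<beta>"]) (use b in \<open>auto simp: seg_def osuc_le_iff\<close>)
next
  case False
  have "seg (lev x) x m \<subseteq> U" using x by (auto simp: seg_def res_lev)
  then show ?thesis using that False by blast
qed

definition dnb :: "omega1 \<Rightarrow> nat \<Rightarrow> 'a set" where
  "dnb a n = insert (dp a) {nd x m |x m. x \<in> N \<and> lev x = osuc a \<and> n \<le> m}"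

lemma nd_in_dnb_iff: "x \<in> N \<Longrightarrow> nd x m \<in> dnb a n \<longleftrightarrow> lev x = osuc a \<and> n \<le> m"
  unfolding dnb_def using nd_eq nd_neq_dp by auto

lemma dp_in_dnb_iff: "dp b \<in> dnb a n \<longleftrightarrow> b = a"
  unfolding dnb_def using nd_neq_dp by auto metis+

lemma dnb_subset: "dnb a n \<subseteq> topspace Y"
  unfolding dnb_def topspace_Y by auto

lemma openin_dnb: "openin Y (dnb a n)"
proof (rule openin_YI)
  show "dnb a n \<subseteq> nodes \<union> range dp" using dnb_subset topspace_Y by simp
  fix x m assume "x \<in> N" "nd x m \<in> dnb a n" "olim (lev x)"
  then show "\<exists>\<beta><lev x. \<forall>\<gamma>. \<beta> < \<gamma> \<and> \<gamma> \<le> lev x \<longrightarrow> nd (res \<gamma> x) m \<in> dnb a n"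
    using nd_in_dnb_iff by auto
next
  fix b assume "dp b \<in> dnb a n"
  then have "b = a" using dp_in_dnb_iff by blast
  then show "\<exists>n'. \<forall>m\<ge>n'. \<forall>x\<in>N. lev x = osuc b \<longrightarrow> nd x m \<in> dnb a n"
    by (intro exI[of _ n]) (auto simp: nd_in_dnb_iff)
qed

lemma closedin_dnb: "closedin Y (dnb a n)"
  unfolding closedin_def
proof
  show "dnb a n \<subseteq> topspace Y" by (rule dnb_subset)
  show "openin Y (topspace Y - dnb a n)"
  proof (rule openin_YI)
    show "topspace Y - dnb a n \<subseteq> nodes \<union> range dp" using topspace_Y by auto
    fix x m assume x: "x \<in> N" "nd x m \<in> topspace Y - dnb a n" "olim (lev x)"
    \<comment> \<open>A single successor level does not accumulate at a limit node: the tail starts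
      above \<open>osuc a\<close>, or anywhere if the branch ends before that level.\<close>
    obtain \<beta> where b: "\<beta> < lev x" "\<And>\<gamma>. \<beta> < \<gamma> \<Longrightarrow> \<gamma> \<le> lev x \<Longrightarrow> \<gamma> \<noteq> osuc a"
    proof (cases "osuc a < lev x")
      case True
      then show ?thesis using that[of "osuc a"] by auto
    next
      case False
      moreover have "osuc a \<noteq> lev x" using x(3) by (metis not_olim_osuc)
      ultimately show ?thesis using that[of ozero] x(3) unfolding olim_def by force
    qed
    have "nd (res \<gamma> x) m \<in> topspace Y - dnb a n" if "\<beta> < \<gamma>" "\<gamma> \<le> lev x" for \<gamma>
      using b(2)[OF that] that(2) x(1) by (simp add: topspace_Y res_in nd_in_dnb_iff lev_res)
    then show "\<exists>\<beta><lev x. \<forall>\<gamma>. \<beta> < \<gamma> \<and> \<gamma> \<le> lev x \<longrightarrow> nd (res \<gamma> x) m \<in> topspace Y - dnb a n"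
      using b(1) by blast
  next
    fix b assume "dp b \<in> topspace Y - dnb a n"
    then have "b \<noteq> a" using dp_in_dnb_iff by blast
    then show "\<exists>n'. \<forall>m\<ge>n'. \<forall>x\<in>N. lev x = osuc b \<longrightarrow> nd x m \<in> topspace Y - dnb a n"
      by (auto simp: topspace_Y nd_in_dnb_iff)
  qed
qed

lemma dnb_base:
  assumes "openin Y U" "dp a \<in> U"
  obtains n where "dnb a n \<subseteq> U"
proof -
  obtain n where "\<And>m x. m \<ge> n \<Longrightarrow> x \<in> N \<Longrightarrow> lev x = osuc a \<Longrightarrow> nd x m \<in> U"
    using openin_Y_dp[OF assms] by blast
  then have "dnb a n \<subseteq> U" unfolding dnb_def using assms(2) by auto
  then show ?thesis by (rule that)
qed

definition nbase :: "'a \<Rightarrow> 'a set set" where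
  "nbase p = {seg \<beta> x m |\<beta> x m. x \<in> N \<and> p = nd x m \<and> \<beta> \<le> lev x \<and> \<not> olim \<beta>}
    \<union> {dnb a n |a n. p = dp a}"

lemma nbase_nd: "x \<in> N \<Longrightarrow> nbase (nd x m) = (\<lambda>\<beta>. seg \<beta> x m) ` {\<beta>. \<beta> \<le> lev x \<and> \<not> olim \<beta>}"
proof -
  assume x: "x \<in> N"
  have "{dnb a n |a n. nd x m = dp a} = {}" using nd_neq_dp[OF x] by auto
  moreover have "{seg \<beta> y k |\<beta> y k. y \<in> N \<and> nd x m = nd y k \<and> \<beta> \<le> lev y \<and> \<not> olim \<beta>}
    = {seg \<beta> x m |\<beta>. \<beta> \<le> lev x \<and> \<not> olim \<beta>}"
    using nd_eq[OF x] x by auto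
  ultimately show ?thesis unfolding nbase_def by auto
qed

lemma nbase_dp: "nbase (dp a) = range (dnb a)"
proof -
  have "{seg \<beta> x m |\<beta> x m. x \<in> N \<and> dp a = nd x m \<and> \<beta> \<le> lev x \<and> \<not> olim \<beta>} = {}"
    using nd_neq_dp by (auto simp: eq_commute[of "dp a"])
  then show ?thesis unfolding nbase_def by auto
qed

lemma countable_nbase:
  assumes "p \<in> topspace Y"
  shows "countable (nbase p)"
  using assms
proof (cases rule: topspace_cases)
  case (node x m)
  have "countable {\<beta>. \<beta> \<le> lev x \<and> \<not> olim \<beta>}"
    using countable_atMost_omega1[of "lev x"] by (rule countable_subset[rotated]) auto
  then show ?thesis using node nbase_nd by simp
next
  case (limit a)
  then show ?thesis by (simp add: nbase_dp)
qed

lemma nbase_clopen: "W \<in> nbase p \<Longrightarrow> openin Y W \<and> closedin Y W"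
  unfolding nbase_def using openin_seg closedin_seg openin_dnb closedin_dnb by auto

lemma nbase_base:
  assumes U: "openin Y U" "p \<in> U"
  shows "\<exists>W\<in>nbase p. p \<in> W \<and> W \<subseteq> U"
proof -
  have "p \<in> topspace Y" using U openin_subset by blast
  then show ?thesis
  proof (cases rule: topspace_cases)
    case (node x m)
    then obtain \<beta> where "\<not> olim \<beta>" "\<beta> \<le> lev x" "seg \<beta> x m \<subseteq> U"
      using seg_base U by metis
    then show ?thesis
      using node nd_in_seg[of x \<beta> m] by (auto simp: nbase_nd)
  next
    case (limit a)
    then obtain n where "dnb a n \<subseteq> U" using dnb_base U by metis
    then show ?thesis using limit dp_in_dnb_iff by (auto simp: nbase_dp)
  qed
qed

lemma clopen_base:
  assumes "openin Y U" "p \<in> U"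
  shows "\<exists>W. openin Y W \<and> closedin Y W \<and> p \<in> W \<and> W \<subseteq> U"
  using nbase_base[OF assms] nbase_clopen by blast

lemma Hausdorff_Y: "Hausdorff_space Y"
proof -
  have sep: "\<exists>W. openin Y W \<and> closedin Y W \<and> (p \<in> W) \<noteq> (q \<in> W)"
    if pq: "p \<in> topspace Y" "q \<in> topspace Y" "p \<noteq> q" for p q
    using pq(1)
  proof (cases rule: topspace_cases)
    case p: (limit a)
    have "p \<in> dnb a 0" "openin Y (dnb a 0)" using p dp_in_dnb_iff openin_dnb by auto
    show ?thesis
      using pq(2)
    proof (cases rule: topspace_cases)
      case (node y k)
      then show ?thesis using p dp_in_dnb_iff openin_dnb closedin_dnb nd_in_dnb_iff[of y k a "Suc k"]
        by (metis not_less_eq_eq order_refl)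
    next
      case (limit b)
      then show ?thesis using p pq(3) dp_in_dnb_iff openin_dnb closedin_dnb by metis
    qed
  next
    case p: (node x m)
    show ?thesis
      using pq(2)
    proof (cases rule: topspace_cases)
      case (limit b)
      then show ?thesis using p dp_in_dnb_iff openin_dnb closedin_dnb nd_in_dnb_iff[of x m b "Suc m"]
        by (metis not_less_eq_eq order_refl)
    next
      case q: (node y k)
      have *: "openin Y (seg ozero z i)" "closedin Y (seg ozero z i)" "nd z i \<in> seg ozero z i"
        if "z \<in> N" for z i
        using that openin_seg closedin_seg nd_in_seg by auto
      \<comment> \<open>If each node lay on the branch below the other, they would be in the same
        copy and on the same level, hence equal.\<close>
      have "nd y k \<notin> seg ozero x m \<or> nd x m \<notin> seg ozero y k"
        unfolding nd_in_seg_iff[OF p(1) q(1)] nd_in_seg_iff[OF q(1) p(1)]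
        using p q pq(3) res_lev[OF q(1)] by (metis order_antisym)
      then show ?thesis using p q * by metis
    qed
  qed
  show ?thesis
    unfolding Hausdorff_space_def
  proof (intro allI impI, elim conjE)
    fix p q assume pq: "p \<in> topspace Y" "q \<in> topspace Y" "p \<noteq> q"
    then obtain W where W: "openin Y W" "closedin Y W" "(p \<in> W) \<noteq> (q \<in> W)" using sep by blast
    then have "openin Y (topspace Y - W)" by blast
    then show "\<exists>U V. openin Y U \<and> openin Y V \<and> p \<in> U \<and> q \<in> V \<and> disjnt U V"
    proof (cases "p \<in> W")
      case True
      then show ?thesis using W pq \<open>openin Y (topspace Y - W)\<close>
        by (intro exI[of _ W] exI[of _ "topspace Y - W"]) (auto simp: disjnt_def)
    next
      case False
      then show ?thesis using W pq \<open>openin Y (topspace Y - W)\<close>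
        by (intro exI[of _ "topspace Y - W"] exI[of _ W]) (auto simp: disjnt_def)
    qed
  qed
qed

subsection \<open>The rank function\<close>

text \<open>A point \<open>dp a\<close> gets the rank of the level converging to it, so that
  \<open>rank\<close> is constant on \<open>dnb a n\<close>. In particular its rank is never a
  limit.\<close>

definition rank :: "'a \<Rightarrow> omega1" where
  "rank p = (if p \<in> nodes then lev (THE x. x \<in> N \<and> (\<exists>m. p = nd x m)) else osuc (THE a. p = dp a))"

lemma rank_nd [simp]: "x \<in> N \<Longrightarrow> rank (nd x m) = lev x"
proof -
  assume x: "x \<in> N"
  have "(THE y. y \<in> N \<and> (\<exists>k. nd x m = nd y k)) = x"
    by (rule the_equality) (use x nd_eq[OF x] in blast)+
  then show ?thesis unfolding rank_def using x by simp
qed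

lemma rank_dp [simp]: "rank (dp a) = osuc a"
  unfolding rank_def by simp

text \<open>The hypothesis is openness of \<open>A\<close> at its limit ordinals, the only places
  where the continuity of \<open>rank\<close> is in question.\<close>

lemma openin_rank:
  assumes "\<And>\<delta>. olim \<delta> \<Longrightarrow> \<delta> \<in> A \<Longrightarrow> \<exists>\<beta><\<delta>. \<forall>\<gamma>. \<beta> < \<gamma> \<and> \<gamma> \<le> \<delta> \<longrightarrow> \<gamma> \<in> A"
  shows "openin Y {p \<in> topspace Y. rank p \<in> A}"
proof (rule openin_YI)
  show "{p \<in> topspace Y. rank p \<in> A} \<subseteq> nodes \<union> range dp" using topspace_Y by auto
  fix x m assume x: "x \<in> N" "nd x m \<in> {p \<in> topspace Y. rank p \<in> A}" "olim (lev x)"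
  then obtain \<beta> where b: "\<beta> < lev x" "\<And>\<gamma>. \<beta> < \<gamma> \<and> \<gamma> \<le> lev x \<Longrightarrow> \<gamma> \<in> A"
    using assms[of "lev x"] by auto
  have "nd (res \<gamma> x) m \<in> {p \<in> topspace Y. rank p \<in> A}" if "\<beta> < \<gamma>" "\<gamma> \<le> lev x" for \<gamma>
    using b(2) that x(1) by (simp add: res_in lev_res topspace_Y)
  then show "\<exists>\<beta><lev x. \<forall>\<gamma>. \<beta> < \<gamma> \<and> \<gamma> \<le> lev x \<longrightarrow> nd (res \<gamma> x) m \<in> {p \<in> topspace Y. rank p \<in> A}"
    using b(1) by blast
next
  fix a assume "dp a \<in> {p \<in> topspace Y. rank p \<in> A}"
  then show "\<exists>n. \<forall>m\<ge>n. \<forall>x\<in>N. lev x = osuc a \<longrightarrow> nd x m \<in> {p \<in> topspace Y. rank p \<in> A}"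
    by (auto simp: topspace_Y)
qed

lemma openin_rank_le: "openin Y {p \<in> topspace Y. rank p \<le> \<alpha>}"
  using openin_rank[of "{..\<alpha>}"] unfolding olim_def by fastforce

lemma openin_rank_less: "openin Y {p \<in> topspace Y. rank p < \<alpha>}"
  using openin_rank[of "{..<\<alpha>}"] unfolding olim_def by fastforce

lemma openin_rank_greater: "openin Y {p \<in> topspace Y. \<alpha> < rank p}"
  using openin_rank[of "{\<alpha><..}"] by auto

lemma countable_rank_le: "countable {p \<in> topspace Y. rank p \<le> \<alpha>}"
proof -
  have "{p \<in> topspace Y. rank p \<le> \<alpha>}
    \<subseteq> (\<lambda>(x, m). nd x m) ` ({x \<in> N. lev x \<le> \<alpha>} \<times> UNIV) \<union> dp ` {..\<alpha>}"
  proof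
    fix p assume p: "p \<in> {p \<in> topspace Y. rank p \<le> \<alpha>}"
    then have "p \<in> topspace Y" by blast
    then show "p \<in> (\<lambda>(x, m). nd x m) ` ({x \<in> N. lev x \<le> \<alpha>} \<times> UNIV) \<union> dp ` {..\<alpha>}"
    proof (cases rule: topspace_cases)
      case (node x m)
      then show ?thesis using p by (auto intro!: rev_image_eqI[of "(x, m)"])
    next
      case (limit a)
      then show ?thesis using p less_osuc[of a] by (auto simp del: less_osuc intro: less_imp_le)
    qed
  qed
  moreover have "countable ((\<lambda>(x, m). nd x m) ` ({x \<in> N. lev x \<le> \<alpha>} \<times> (UNIV :: nat set)) \<union> dp ` {..\<alpha>})"
    using countable_below countable_atMost_omega1 by auto
  ultimately show ?thesis by (rule countable_subset)
qed

lemma uncountable_rank_unbounded: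
  assumes "uncountable A" "A \<subseteq> topspace Y"
  obtains p where "p \<in> A" "\<alpha> < rank p"
proof -
  have "\<not> A \<subseteq> {p \<in> topspace Y. rank p \<le> \<alpha>}"
    using assms(1) countable_rank_le countable_subset by blast
  then obtain p where "p \<in> A" "p \<notin> {p \<in> topspace Y. rank p \<le> \<alpha>}" by blast
  moreover from this have "\<alpha> < rank p" using assms(2) by auto
  ultimately show ?thesis using that by simp
qed

text \<open>The sets of points of rank at most \<alpha> are countable and form an open cover. So
  every Lindelof condition on the space becomes a statement about countability.\<close>

lemma Lindelof_imp_countable:
  assumes L: "Lindelof_space (subtopology Y S)" and S: "S \<subseteq> topspace Y"
  shows "countable S"
proof -
  let ?R = "\<lambda>\<alpha>. {p \<in> topspace Y. rank p \<le> \<alpha>}"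
  have "\<exists>\<V>. countable \<V> \<and> \<V> \<subseteq> range ?R \<and> S \<subseteq> \<Union>\<V>"
    using L S openin_rank_le unfolding Lindelof_space_subtopology_subset[OF S]
    by (elim allE[of _ "range ?R"]) auto
  then obtain \<V> where V: "countable \<V>" "\<V> \<subseteq> range ?R" "S \<subseteq> \<Union>\<V>" by blast
  have "countable X" if "X \<in> \<V>" for X using V(2) that countable_rank_le by auto
  then have "countable (\<Union>X\<in>\<V>. X)" using V(1) by (intro countable_UN)
  then show ?thesis using V(3) countable_subset by simp
qed

lemma Lindelof_iff_countable:
  "S \<subseteq> topspace Y \<Longrightarrow> Lindelof_space (subtopology Y S) \<longleftrightarrow> countable S"
  using Lindelof_imp_countable countable_imp_Lindelof_subtopology by blast

lemma locally_metrizable_Y: "locally_metrizable Y"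
proof (rule locally_metrizable_if_countable_clopen_bases[where B = nbase])
  show "\<exists>U. openin Y U \<and> p \<in> U \<and> countable U" if "p \<in> topspace Y" for p
    using openin_rank_le countable_rank_le that by blast
qed (use Hausdorff_Y countable_nbase nbase_clopen nbase_base in auto)

end

context tree_space begin

subsection \<open>Property \<open>(\<ast>)\<close>\<close>

lemma ordinal_in_longray_less:
  "ordinal_in_longray \<alpha> < a \<longleftrightarrow>
    \<alpha> < fst (Rep_longray a) \<or> \<alpha> = fst (Rep_longray a) \<and> 0 < snd (Rep_longray a)"
  "a < ordinal_in_longray \<alpha> \<longleftrightarrow> fst (Rep_longray a) < \<alpha>"
proof -
  have r: "Rep_longray (ordinal_in_longray \<alpha>) = (\<alpha>, 0)"
    unfolding ordinal_in_longray_def by (rule Abs_longray_inverse) simp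
  have "0 \<le> snd (Rep_longray a)" using Rep_longray[of a] by (auto simp: mem_Times_iff)
  then show "ordinal_in_longray \<alpha> < a \<longleftrightarrow>
      \<alpha> < fst (Rep_longray a) \<or> \<alpha> = fst (Rep_longray a) \<and> 0 < snd (Rep_longray a)"
    "a < ordinal_in_longray \<alpha> \<longleftrightarrow> fst (Rep_longray a) < \<alpha>"
    unfolding not_le[symmetric] less_eq_longray_def r by auto
qed

lemma ordinal_in_longray_le_iff: "ordinal_in_longray \<alpha> \<le> ordinal_in_longray \<beta> \<longleftrightarrow> \<alpha> \<le> \<beta>"
proof -
  have "Rep_longray (ordinal_in_longray \<alpha>) = (\<alpha>, 0)" for \<alpha>
    unfolding ordinal_in_longray_def by (rule Abs_longray_inverse) simp
  then show ?thesis unfolding less_eq_longray_def by auto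
qed

text \<open>The test functions for f-narrowness: on a clopen \<open>G\<close> the rank, which is
  unbounded on uncountable sets, and the least point of the longray elsewhere.\<close>

definition longrank :: "'a set \<Rightarrow> 'a \<Rightarrow> longray" where
  "longrank G p = ordinal_in_longray (if p \<in> G then rank p else ozero)"

lemma continuous_longrank:
  assumes G: "openin Y G" "closedin Y G"
  shows "continuous_map Y euclidean (longrank G)"
proof (rule continuous_map_euclidean_order)
  have Gs: "G \<subseteq> topspace Y" using G(1) openin_subset by blast
  have co: "openin Y (topspace Y - G)" using G(2) by blast
  let ?r = "\<lambda>p. if p \<in> G then rank p else ozero"
  have *: "{p \<in> topspace Y. Q (?r p)} =
      (G \<inter> {p \<in> topspace Y. Q (rank p)}) \<union> (if Q ozero then topspace Y - G else {})" for Q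
    using Gs by auto
  have op: "openin Y {p \<in> topspace Y. Q (rank p)} \<Longrightarrow> openin Y {p \<in> topspace Y. Q (?r p)}" for Q
    unfolding * using G(1) co by auto
  fix a
  show "openin Y {p \<in> topspace Y. a < longrank G p}"
    unfolding longrank_def ordinal_in_longray_less
    using op[OF openin_rank_greater] .
  show "openin Y {p \<in> topspace Y. longrank G p < a}"
  \<comment> \<open>The ordinals below \<open>a\<close> include its ordinal part exactly when
    \<open>a\<close> has a positive real part; so the preimage is given by a weak or by a strict
    inequality of ranks.\<close>
  proof (cases "0 < snd (Rep_longray a)")
    case True
    then have "{p \<in> topspace Y. longrank G p < a} = {p \<in> topspace Y. ?r p \<le> fst (Rep_longray a)}"
      unfolding longrank_def ordinal_in_longray_less by (auto simp: le_less)
    then show ?thesis using op[OF openin_rank_le] by simp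
  next
    case False
    then have "{p \<in> topspace Y. longrank G p < a} = {p \<in> topspace Y. ?r p < fst (Rep_longray a)}"
      unfolding longrank_def ordinal_in_longray_less by auto
    then show ?thesis using op[OF openin_rank_less] by simp
  qed
qed

lemma bounded_longrank_imp_countable:
  assumes "bounded_in_longray (longrank G) C" "C \<subseteq> topspace Y"
  shows "countable (C \<inter> G)"
proof (rule ccontr)
  assume unc: "uncountable (C \<inter> G)"
  obtain I a where I: "\<forall>x\<in>I. \<forall>y\<le>x. y \<in> I" "a \<notin> I" "longrank G ` C \<subseteq> I"
    using assms(1) unfolding bounded_in_longray_def strict_initial_segment_def by blast
  have "C \<inter> G \<subseteq> topspace Y" using assms(2) by blast
  then obtain p where p: "p \<in> C" "p \<in> G" "fst (Rep_longray a) < rank p"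
    using uncountable_rank_unbounded[OF unc, of "fst (Rep_longray a)"] by blast
  then have "a < longrank G p" unfolding longrank_def ordinal_in_longray_less by simp
  then show False using I p by (meson image_subset_iff less_imp_le)
qed

lemma f_Type_I_Y: "f_Type_I Y"
  unfolding f_Type_I_def
proof (intro exI conjI allI)
  show "continuous_map Y euclidean (longrank (topspace Y))"
    by (rule continuous_longrank) auto
  fix \<alpha>
  have "{x \<in> topspace Y. longrank (topspace Y) x \<le> ordinal_in_longray \<alpha>} = {x \<in> topspace Y. rank x \<le> \<alpha>}"
    by (auto simp: longrank_def ordinal_in_longray_le_iff)
  then show "Lindelof_space (subtopology Y {x \<in> topspace Y. longrank (topspace Y) x \<le> ordinal_in_longray \<alpha>})"
    using countable_imp_Lindelof_subtopology[OF countable_rank_le] by simp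
qed

section \<open>Clopen cones and f-narrow sets\<close>

definition ncone :: "'n \<Rightarrow> nat \<Rightarrow> 'a set" where
  "ncone x m = {nd z m |z. z \<in> cone x}"

lemma nd_in_ncone_iff: "z \<in> N \<Longrightarrow> nd z k \<in> ncone x m \<longleftrightarrow> k = m \<and> z \<in> cone x"
  unfolding ncone_def cone_def using nd_eq by auto

lemma dp_notin_ncone: "dp a \<notin> ncone x m"
  unfolding ncone_def cone_def using nd_neq_dp by (auto simp: eq_commute[of "dp a"])

lemma ncone_subset: "ncone x m \<subseteq> nodes"
  unfolding ncone_def cone_def by auto

text \<open>For a limit node beyond level \<open>lev x\<close>, membership in the cone is settled at
  level \<open>lev x\<close>, hence shared by a tail of its predecessors. Only at level
  \<open>lev x\<close> itself could this fail, and that level is no limit.\<close>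

lemma clopen_ncone:
  assumes x: "x \<in> N" and lim: "\<not> olim (lev x)"
  shows "openin Y (ncone x m)" "closedin Y (ncone x m)"
proof -
  have *: "res \<gamma> y \<in> cone x \<longleftrightarrow> y \<in> cone x" if "y \<in> N" "lev x \<le> \<gamma>" "\<gamma> \<le> lev y" for y \<gamma>
    using that by (auto simp: cone_def res_in lev_res res_res)
  have **: "\<exists>\<beta><lev y. \<forall>\<gamma>. \<beta> < \<gamma> \<and> \<gamma> \<le> lev y \<longrightarrow> (res \<gamma> y \<in> cone x \<longleftrightarrow> y \<in> cone x)"
    if y: "y \<in> N" "olim (lev y)" for y
  proof (cases "lev x \<le> lev y")
    case True
    then have "lev x < lev y" using y lim by (metis order_le_less)
    then show ?thesis using * y by (intro exI[of _ "lev x"]) auto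
  next
    case False
    then have "res \<gamma> y \<notin> cone x" if "\<gamma> \<le> lev y" for \<gamma>
      using y lev_res[OF y(1) that] that by (auto simp: cone_def)
    moreover have "y \<notin> cone x" using False by (auto simp: cone_def)
    ultimately show ?thesis using y(2) by (intro exI[of _ ozero]) (auto simp: olim_def)
  qed
  show "openin Y (ncone x m)"
  proof (rule openin_YI)
    show "ncone x m \<subseteq> nodes \<union> range dp" using ncone_subset by blast
    fix y k assume y: "y \<in> N" "nd y k \<in> ncone x m" "olim (lev y)"
    then have "k = m" "y \<in> cone x" using nd_in_ncone_iff by auto
    then show "\<exists>\<beta><lev y. \<forall>\<gamma>. \<beta> < \<gamma> \<and> \<gamma> \<le> lev y \<longrightarrow> nd (res \<gamma> y) k \<in> ncone x m"
      using **[OF y(1,3)] y(1) by (simp add: nd_in_ncone_iff res_in)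
  qed (use dp_notin_ncone in blast)
  show "closedin Y (ncone x m)"
    unfolding closedin_def
  proof
    show "ncone x m \<subseteq> topspace Y" using ncone_subset topspace_Y by blast
    show "openin Y (topspace Y - ncone x m)"
    proof (rule openin_YI)
      show "topspace Y - ncone x m \<subseteq> nodes \<union> range dp" using topspace_Y by blast
      fix y k assume y: "y \<in> N" "nd y k \<in> topspace Y - ncone x m" "olim (lev y)"
      then have "\<not> (k = m \<and> y \<in> cone x)" using nd_in_ncone_iff by auto
      then show "\<exists>\<beta><lev y. \<forall>\<gamma>. \<beta> < \<gamma> \<and> \<gamma> \<le> lev y \<longrightarrow> nd (res \<gamma> y) k \<in> topspace Y - ncone x m"
        using **[OF y(1,3)] y(1) by (auto simp: nd_in_ncone_iff res_in topspace_Y)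
    next
      fix a assume "dp a \<in> topspace Y - ncone x m"
      show "\<exists>n. \<forall>m'\<ge>n. \<forall>z\<in>N. lev z = osuc a \<longrightarrow> nd z m' \<in> topspace Y - ncone x m"
        by (intro exI[of _ "Suc m"]) (auto simp: nd_in_ncone_iff topspace_Y)
    qed
  qed
qed

definition trace :: "'a set \<Rightarrow> nat \<Rightarrow> 'n set" where
  "trace C m = {x \<in> N. nd x m \<in> C}"

lemma countable_nodes_iff: "countable (C \<inter> nodes) \<longleftrightarrow> (\<forall>m. countable (trace C m))"
proof
  assume c: "countable (C \<inter> nodes)"
  show "\<forall>m. countable (trace C m)"
  proof
    fix m
    have "(\<lambda>x. nd x m) ` trace C m \<subseteq> C \<inter> nodes" by (auto simp: trace_def)
    then have "countable ((\<lambda>x. nd x m) ` trace C m)" using c countable_subset by blast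
    moreover have "inj_on (\<lambda>x. nd x m) (trace C m)" by (auto simp: inj_on_def trace_def nd_eq)
    ultimately show "countable (trace C m)" by (rule countable_image_inj_on)
  qed
next
  assume c: "\<forall>m. countable (trace C m)"
  have "C \<inter> nodes \<subseteq> (\<Union>m. (\<lambda>x. nd x m) ` trace C m)" by (auto simp: trace_def nodes_def)
  moreover have "countable (\<Union>m. (\<lambda>x. nd x m) ` trace C m)" using c by auto
  ultimately show "countable (C \<inter> nodes)" by (rule countable_subset)
qed

text \<open>The test function is \<open>longrank\<close> of one of two disjoint clopen cones that
  each contain uncountably many nodes of \<open>C\<close>. It is unbounded on the first part of
  \<open>C\<close> and constantly least on the second, so both alternatives of f-narrowness
  fail.\<close>

lemma f_narrow_countable_nodes:
  assumes C: "closedin Y C" "f_narrow_in Y C"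
  shows "countable (C \<inter> nodes)"
  unfolding countable_nodes_iff
proof (rule ccontr)
  assume "\<not> (\<forall>m. countable (trace C m))"
  then obtain m where m: "uncountable (trace C m)" by blast
  have Cs: "C \<subseteq> topspace Y" using C(1) closedin_subset by blast
  obtain x y where xy: "x \<in> N" "y \<in> N" "x \<noteq> y" "lev x = lev y" "\<not> olim (lev x)"
    "uncountable (trace C m \<inter> cone x)" "uncountable (trace C m \<inter> cone y)"
    using uncountable_splits[OF m] unfolding trace_def by blast
  have inj: "inj_on (\<lambda>z. nd z m) (trace C m \<inter> A)" for A by (auto simp: inj_on_def trace_def nd_eq)
  have sub: "(\<lambda>z. nd z m) ` (trace C m \<inter> cone z) \<subseteq> C \<inter> ncone z m" for z
    by (auto simp: trace_def ncone_def)
  have unc: "uncountable (C \<inter> ncone z m)" if "uncountable (trace C m \<inter> cone z)" for z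
    using that sub countable_image_inj_on[OF _ inj] countable_subset by meson
  let ?f = "longrank (ncone x m)"
  have "continuous_map Y euclidean ?f" using clopen_ncone[OF xy(1,5)] by (rule continuous_longrank)
  moreover have "\<not> bounded_in_longray ?f C"
    using bounded_longrank_imp_countable[OF _ Cs] unc[OF xy(6)] by blast
  ultimately have "Lindelof_space (subtopology Y ({p \<in> topspace Y. ?f p \<le> ordinal_in_longray ozero} \<inter> C))"
    (is "Lindelof_space (subtopology Y ?S)")
    using C(2) unfolding f_narrow_in_def by blast
  then have "countable ?S" by (rule Lindelof_imp_countable) auto
  moreover have "C \<inter> ncone y m \<subseteq> ?S"
  proof
    fix p assume p: "p \<in> C \<inter> ncone y m"
    then obtain z where z: "p = nd z m" "z \<in> cone y" unfolding ncone_def by blast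
    then have "z \<in> N" "z \<notin> cone x" using xy by (auto simp: cone_def)
    then have "p \<notin> ncone x m" using z nd_in_ncone_iff by blast
    then show "p \<in> ?S" using p Cs by (auto simp: longrank_def)
  qed
  ultimately show False using unc[OF xy(7)] countable_subset by blast
qed

section \<open>The points \<open>dp a\<close>: discreteness and narrowness\<close>

lemma closed_range_dp: "closedin Y (range dp)"
proof -
  have "topspace Y - range dp = nodes" using topspace_Y dp_notin_nodes by auto
  then show ?thesis unfolding closedin_def using openin_nodes topspace_Y by auto
qed

lemma discrete_dp: "A \<subseteq> range dp \<Longrightarrow> discrete_subspace Y A"
  unfolding discrete_subspace_iff
proof (intro conjI ballI)
  assume A: "A \<subseteq> range dp"
  then show "A \<subseteq> topspace Y" using topspace_Y by blast
  fix p assume p: "p \<in> A"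
  then obtain a where a: "p = dp a" using A by blast
  have "dnb a 0 \<inter> A = {p}" using p a A by (auto simp: dp_in_dnb_iff)
  then show "\<exists>U. openin Y U \<and> U \<inter> A = {p}" using openin_dnb by blast
qed

lemma f_narrow_discrete_outside_Lindelof:
  assumes "closedin Y C" "f_narrow_in Y C"
  shows "discrete_outside_Lindelof Y C"
  unfolding discrete_outside_Lindelof_def
proof (intro exI conjI)
  show "C \<inter> nodes \<subseteq> topspace Y" using topspace_Y by auto
  show "Lindelof_space (subtopology Y (C \<inter> nodes))"
    using f_narrow_countable_nodes[OF assms] by (rule countable_imp_Lindelof_subtopology)
  have "C - C \<inter> nodes \<subseteq> range dp" using assms(1) closedin_subset topspace_Y by blast
  then show "discrete_subspace Y (C - C \<inter> nodes)" by (rule discrete_dp)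
qed

lemma uncountable_range_dp: "uncountable (dp ` A) \<longleftrightarrow> uncountable A"
  using inj_dp by (metis countable_image countable_image_inj_on inj_on_subset subset_UNIV)

text \<open>The number of the copy from which \<open>U\<close> contains level \<open>osuc a\<close>
  depends on \<open>a\<close>; as there are only countably many such numbers, one of them serves
  uncountably many \<open>a\<close>.\<close>

lemma dp_neighbourhood_levels:
  assumes U: "openin Y U" and A: "uncountable {a. dp a \<in> U}"
  obtains n where "uncountable {a. \<forall>x\<in>N. lev x = osuc a \<longrightarrow> (\<forall>m\<ge>n. nd x m \<in> U)}"
proof (rule ccontr)
  assume c: "\<not> thesis"
  let ?A = "\<lambda>n. {a. \<forall>x\<in>N. lev x = osuc a \<longrightarrow> (\<forall>m\<ge>n. nd x m \<in> U)}"
  have "countable (?A n)" for n using c that[of n] by blast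
  then have cnt: "countable (\<Union>n. ?A n)" by simp
  have "{a. dp a \<in> U} \<subseteq> (\<Union>n. ?A n)"
  proof
    fix a assume "a \<in> {a. dp a \<in> U}"
    then obtain n where "\<And>m x. m \<ge> n \<Longrightarrow> x \<in> N \<Longrightarrow> lev x = osuc a \<Longrightarrow> nd x m \<in> U"
      using openin_Y_dp[OF U] by blast
    then show "a \<in> (\<Union>n. ?A n)" by blast
  qed
  from countable_subset[OF this cnt] show False using A by simp
qed

text \<open>
  Both open sets contain unboundedly many full levels of one copy of the tree; so each node on a
  common limit of these levels lies in both closures.
\<close>

lemma uncountable_dp_closures_meet:
  assumes U: "openin Y U" "uncountable {a. dp a \<in> U}"
    and V: "openin Y V" "uncountable {a. dp a \<in> V}"
  shows "Y closure_of U \<inter> Y closure_of V \<noteq> {}"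
proof -
  obtain n where n: "uncountable {a. \<forall>x\<in>N. lev x = osuc a \<longrightarrow> (\<forall>m\<ge>n. nd x m \<in> U)}"
    using dp_neighbourhood_levels[OF U] by blast
  obtain k where k: "uncountable {a. \<forall>x\<in>N. lev x = osuc a \<longrightarrow> (\<forall>m\<ge>k. nd x m \<in> V)}"
    using dp_neighbourhood_levels[OF V] by blast
  define m where "m = max n k"
  define A where "A W = {a. \<forall>x\<in>N. lev x = osuc a \<longrightarrow> nd x m \<in> W}" for W
  have "uncountable (A U)"
    using n by (rule contrapos_nn) (erule countable_subset[rotated], auto simp: A_def m_def)
  moreover have "uncountable (A V)"
    using k by (rule contrapos_nn) (erule countable_subset[rotated], auto simp: A_def m_def)
  ultimately have unc: "\<And>W. W \<in> {U, V} \<Longrightarrow> uncountable (A W)" by blast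
  have "countable {U, V}" by simp
  have "\<exists>\<delta>. olim \<delta> \<and> (\<forall>W\<in>{U, V}. limit_of (A W) \<delta>)"
    by (rule common_limit[OF \<open>countable {U, V}\<close> unc, where \<beta> = ozero]) auto
  then obtain \<delta> where d: "olim \<delta>" "\<And>W. W \<in> {U, V} \<Longrightarrow> limit_of (A W) \<delta>" by auto
  obtain x where x: "x \<in> N" "lev x = \<delta>" using level_nonempty by blast
  have "nd x m \<in> Y closure_of W" if W: "W \<in> {U, V}" for W
    unfolding in_closure_of
  proof (intro conjI allI impI)
    show "nd x m \<in> topspace Y" using x topspace_Y by simp
    fix T assume T: "nd x m \<in> T \<and> openin Y T"
    obtain \<beta> where b: "\<beta> < lev x" "\<And>\<gamma>. \<beta> < \<gamma> \<Longrightarrow> \<gamma> \<le> lev x \<Longrightarrow> nd (res \<gamma> x) m \<in> T"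
      using openin_Y_node[of T x m] T x d(1) by blast
    obtain a where a: "a \<in> A W" "\<beta> < a" "a < \<delta>"
      using d(2)[OF W] b(1) x(2) unfolding limit_of_def by blast
    \<comment> \<open>The elements of \<open>A W\<close> are indices of levels; since \<delta> is a
      limit, the level \<open>osuc a\<close> itself still lies below it.\<close>
    have s: "\<beta> < osuc a" "osuc a \<le> lev x"
      using a d(1) x(2) by (auto simp: less_osuc_iff olim_osuc less_imp_le)
    then have "nd (res (osuc a) x) m \<in> T" using b(2) by blast
    moreover have "nd (res (osuc a) x) m \<in> W"
      using a(1) s x(1) by (auto simp: A_def res_in lev_res)
    ultimately show "\<exists>y. y \<in> W \<and> y \<in> T" by blast
  qed
  then show ?thesis by blast
qed

text \<open>If some \<open>U \<alpha>\<close> contains uncountably many \<open>dp a\<close>, then an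
  open set whose closure is disjoint from that of \<open>U \<alpha>\<close> contains only countably
  many. So all but countably many lie in one closure \<open>Y closure_of U (osuc \<alpha>)\<close>,
  and a larger index captures the exceptions.\<close>

lemma narrow_range_dp: "narrow_in Y (range dp)"
  unfolding narrow_in_def
proof (intro conjI allI impI)
  show "closedin Y (range dp)" by (rule closed_range_dp)
  fix U assume U: "systematic_cover Y U"
  then have op: "openin Y (U \<alpha>)" and cl: "\<alpha> < \<beta> \<Longrightarrow> Y closure_of U \<alpha> \<subseteq> U \<beta>"
    and cov: "(\<Union>\<alpha>. U \<alpha>) = topspace Y" for \<alpha> \<beta>
    unfolding systematic_cover_def by auto
  have sub: "U \<alpha> \<subseteq> Y closure_of U \<alpha>" for \<alpha>
    using closure_of_subset[OF openin_subset[OF op]] .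
  show "(\<exists>\<alpha>. range dp \<subseteq> U \<alpha>) \<or> (\<forall>\<alpha>. Lindelof_space (subtopology Y (Y closure_of U \<alpha> \<inter> range dp)))"
  proof (cases "\<exists>\<alpha>. uncountable {a. dp a \<in> U \<alpha>}")
    case False
    have "countable (Y closure_of U \<alpha> \<inter> range dp)" for \<alpha>
    proof -
      have "Y closure_of U \<alpha> \<inter> range dp \<subseteq> dp ` {a. dp a \<in> U (osuc \<alpha>)}"
        using cl[OF less_osuc] by blast
      moreover have "countable (dp ` {a. dp a \<in> U (osuc \<alpha>)})" using False by blast
      ultimately show ?thesis by (rule countable_subset)
    qed
    then show ?thesis using countable_imp_Lindelof_subtopology by blast
  next
    case True
    then obtain \<alpha> where a: "uncountable {a. dp a \<in> U \<alpha>}" by blast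
    \<comment> \<open>The step from \<alpha> to \<open>osuc \<alpha>\<close> leaves the gap that
      makes the closures of \<open>U \<alpha>\<close> and \<open>V\<close> disjoint.\<close>
    define V where "V = topspace Y - Y closure_of U (osuc \<alpha>)"
    have oV: "openin Y V" unfolding V_def by (simp add: openin_diff)
    have "U (osuc \<alpha>) \<inter> V = {}" unfolding V_def using sub by blast
    then have "U (osuc \<alpha>) \<inter> Y closure_of V = {}"
      using op openin_Int_closure_of_eq_empty by metis
    then have "Y closure_of U \<alpha> \<inter> Y closure_of V = {}" using cl[OF less_osuc] by blast
    then have "countable {a. dp a \<in> V}"
      using uncountable_dp_closures_meet[OF op a oV] by blast
    moreover have "\<exists>\<beta>. dp a \<in> U \<beta>" for a using cov topspace_Y by blast
    then obtain g where g: "\<And>a. dp a \<in> U (g a)" by metis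
    ultimately have "countable (insert (osuc (osuc \<alpha>)) (g ` {a. dp a \<in> V}))" by simp
    then obtain \<beta> where b: "\<And>\<gamma>. \<gamma> \<in> insert (osuc (osuc \<alpha>)) (g ` {a. dp a \<in> V}) \<Longrightarrow> \<gamma> < \<beta>"
      using countable_omega1_bounded by blast
    have "dp a \<in> U \<beta>" for a
    proof (cases "dp a \<in> V")
      case True
      then have "g a < \<beta>" using b by blast
      then show ?thesis using g sub cl by blast
    next
      case False
      then have "dp a \<in> Y closure_of U (osuc \<alpha>)" unfolding V_def topspace_Y by blast
      moreover have "osuc \<alpha> < \<beta>" using b[of "osuc (osuc \<alpha>)"] less_osuc less_trans by blast
      ultimately show ?thesis using cl by blast
    qed
    then show ?thesis by blast
  qed
qed

lemma property_star_Y: "property_star Y"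
  unfolding property_star_def
proof (intro conjI exI allI impI)
  show "closedin Y (range dp)" "narrow_in Y (range dp)"
    by (rule closed_range_dp narrow_range_dp)+
  show "\<not> Lindelof_space (subtopology Y (range dp))"
    using Lindelof_iff_countable[of "range dp"] uncountable_range_dp uncountable_UNIV_omega1 topspace_Y
    by simp
qed (use Hausdorff_Y f_Type_I_Y locally_metrizable_Y f_narrow_discrete_outside_Lindelof in auto)

subsection \<open>Closed discrete sets\<close>

text \<open>The branch of a limit node passes through at most one element of the antichain, so a
  tail of it avoids the antichain below that node. The segment from the root to an element contains
  no other element.\<close>

lemma antichain_closed_discrete:
  assumes A: "antichain A"
  shows "closedin Y ((\<lambda>x. nd x m) ` A)" "discrete_subspace Y ((\<lambda>x. nd x m) ` A)"
proof -
  have AN: "A \<subseteq> N" and inc: "\<And>x y. x \<in> A \<Longrightarrow> y \<in> A \<Longrightarrow> lev x < lev y \<Longrightarrow> res (lev x) y \<noteq> x"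
    using A antichain_def by auto
  let ?A = "(\<lambda>x. nd x m) ` A"
  have sub: "?A \<subseteq> topspace Y" using AN topspace_Y by auto
  have mem: "nd y k \<in> ?A \<longleftrightarrow> k = m \<and> y \<in> A" if "y \<in> N" for y k
    using AN nd_eq[OF that] by auto
  show "closedin Y ?A"
    unfolding closedin_def
  proof
    show "openin Y (topspace Y - ?A)"
    proof (rule openin_YI)
      show "topspace Y - ?A \<subseteq> nodes \<union> range dp" using topspace_Y by blast
      fix y k assume y: "y \<in> N" "nd y k \<in> topspace Y - ?A" "olim (lev y)"
      show "\<exists>\<beta><lev y. \<forall>\<gamma>. \<beta> < \<gamma> \<and> \<gamma> \<le> lev y \<longrightarrow> nd (res \<gamma> y) k \<in> topspace Y - ?A"
      proof (cases "\<exists>\<beta><lev y. res \<beta> y \<in> A")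
        case True
        then obtain \<beta> where b: "\<beta> < lev y" "res \<beta> y \<in> A" by blast
        have "res \<gamma> y \<notin> A" if g: "\<beta> < \<gamma>" "\<gamma> \<le> lev y" for \<gamma>
        proof
          have l: "lev (res \<beta> y) = \<beta>" "lev (res \<gamma> y) = \<gamma>" using lev_res y(1) b(1) g(2) by auto
          assume "res \<gamma> y \<in> A"
          from inc[OF b(2) this] have "res \<beta> (res \<gamma> y) \<noteq> res \<beta> y" using l g(1) by simp
          moreover have "res \<beta> (res \<gamma> y) = res \<beta> y" using res_res[OF y(1)] g by (simp add: less_imp_le)
          ultimately show False by simp
        qed
        then show ?thesis using b(1) y(1) mem topspace_Y by (intro exI[of _ \<beta>]) (auto simp: res_in)
      next
        case False
        have "nd (res \<gamma> y) k \<in> topspace Y - ?A" if "\<gamma> \<le> lev y" for \<gamma>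
        proof (cases "\<gamma> = lev y")
          case True
          then show ?thesis using y res_lev by simp
        next
          case F: False
          then have "res \<gamma> y \<notin> A" using False that by auto
          then show ?thesis using mem[OF res_in[OF y(1) that]] topspace_Y res_in[OF y(1) that] by auto
        qed
        then show ?thesis using y(3) unfolding olim_def by blast
      qed
    next
      fix a assume "dp a \<in> topspace Y - ?A"
      show "\<exists>n. \<forall>m'\<ge>n. \<forall>y\<in>N. lev y = osuc a \<longrightarrow> nd y m' \<in> topspace Y - ?A"
        by (intro exI[of _ "Suc m"]) (auto simp: mem topspace_Y)
    qed
  qed (rule sub)
  show "discrete_subspace Y ?A"
    unfolding discrete_subspace_iff
  proof (intro conjI ballI)
    fix p assume "p \<in> ?A"
    then obtain x where x: "x \<in> A" "p = nd x m" by blast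
    then have xN: "x \<in> N" using AN by blast
    have "seg ozero x m \<inter> ?A = {p}"
    proof
      show "{p} \<subseteq> seg ozero x m \<inter> ?A" using x xN nd_in_seg by auto
      have "y = x" if "y \<in> A" "nd y m \<in> seg ozero x m" for y
      proof -
        have "y \<in> N" using that AN by blast
        then have "lev y \<le> lev x" "res (lev y) x = y" using that nd_in_seg_iff xN by auto
        then show ?thesis using inc[OF that(1) x(1)] res_lev[OF xN] by (metis order_le_less)
      qed
      then show "seg ozero x m \<inter> ?A \<subseteq> {p}" using x by auto
    qed
    then show "\<exists>U. openin Y U \<and> U \<inter> ?A = {p}" using openin_seg[OF xN, of ozero] by auto
  qed (rule sub)
qed

lemma nonLindelof_closed_has_uncountable_closed_discrete_Y:
  assumes anti: "\<And>A. A \<subseteq> N \<Longrightarrow> uncountable A \<Longrightarrow> \<exists>B\<subseteq>A. uncountable B \<and> antichain B"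
  shows "nonLindelof_closed_has_uncountable_closed_discrete Y"
  unfolding nonLindelof_closed_has_uncountable_closed_discrete_def
proof (intro allI impI, elim conjE)
  fix C assume C: "closedin Y C" "\<not> Lindelof_space (subtopology Y C)"
  then have Cs: "C \<subseteq> topspace Y" using closedin_subset by blast
  have unc: "uncountable C" using C countable_imp_Lindelof_subtopology by blast
  show "\<exists>D\<subseteq>C. uncountable D \<and> closedin Y D \<and> discrete_subspace Y D"
  proof (cases "countable (C \<inter> nodes)")
    case True
    have "C = C \<inter> nodes \<union> C \<inter> range dp" using Cs topspace_Y by blast
    then have "uncountable (C \<inter> range dp)" using unc True by (metis countable_Un)
    moreover have "closedin Y (C \<inter> range dp)" using C(1) closed_range_dp by (rule closedin_Int)
    moreover have "discrete_subspace Y (C \<inter> range dp)" by (rule discrete_dp) simp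
    ultimately show ?thesis by (intro exI[of _ "C \<inter> range dp"]) simp
  next
    case False
    then obtain m where "uncountable (trace C m)" unfolding countable_nodes_iff by blast
    moreover have "trace C m \<subseteq> N" unfolding trace_def by blast
    ultimately obtain B where B: "B \<subseteq> trace C m" "uncountable B" "antichain B" using anti by metis
    have "B \<subseteq> N" using B(1) by (auto simp: trace_def)
    then have "inj_on (\<lambda>x. nd x m) B" unfolding inj_on_def using nd_eq by blast
    then have "uncountable ((\<lambda>x. nd x m) ` B)" using B(2) countable_image_inj_on by blast
    moreover have "(\<lambda>x. nd x m) ` B \<subseteq> C" using B(1) by (auto simp: trace_def)
    ultimately show ?thesis using antichain_closed_discrete[OF B(3)] by blast
  qed
qed

text \<open>Infinitely many levels below \<open>lev x\<close> accumulate at a limit level, and the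
  node of the branch there would be an accumulation point of \<open>E\<close>. Hypothesis
  \<open>cd\<close> mentions nodes only, so it covers closed discrete sets both of \<open>Y\<close>
  and of the subspace \<open>nodes\<close>.\<close>

lemma closed_discrete_chain_finite:
  assumes E: "E \<subseteq> nodes"
    and cd: "\<And>p. p \<in> nodes \<Longrightarrow> \<exists>U. openin Y U \<and> p \<in> U \<and> U \<inter> E \<subseteq> {p}"
    and x: "x \<in> N"
  shows "finite {\<gamma>. \<gamma> \<le> lev x \<and> res \<gamma> x \<in> trace E m}"
proof (rule ccontr)
  let ?K = "{\<gamma>. \<gamma> \<le> lev x \<and> res \<gamma> x \<in> trace E m}"
  assume "infinite ?K"
  then obtain \<delta> where d: "\<delta> \<le> lev x" "limit_of ?K \<delta>"
    using omega1_infinite_accumulates[of ?K "lev x"] by blast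
  let ?y = "res \<delta> x"
  have y: "?y \<in> N" "lev ?y = \<delta>" using x d(1) res_in lev_res by auto
  obtain U where U: "openin Y U" "nd ?y m \<in> U" "U \<inter> E \<subseteq> {nd ?y m}" using cd[of "nd ?y m"] y(1) by auto
  obtain \<beta> where b: "\<beta> < lev ?y" "\<And>\<gamma>. \<beta> < \<gamma> \<Longrightarrow> \<gamma> \<le> lev ?y \<Longrightarrow> nd (res \<gamma> ?y) m \<in> U"
    using openin_Y_node[OF U(1) y(1) U(2)] d(2) y(2) unfolding limit_of_def by auto
  obtain \<gamma> where g: "\<gamma> \<in> ?K" "\<beta> < \<gamma>" "\<gamma> < \<delta>" using d(2) b(1) y(2) unfolding limit_of_def by auto
  have r: "res \<gamma> ?y = res \<gamma> x" using g(3) d(1) x by (simp add: res_res)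
  have gx: "\<gamma> \<le> lev x" using g(1) by simp
  have "nd (res \<gamma> x) m \<in> U \<inter> E" using b(2)[of \<gamma>] g y(2) r by (simp add: trace_def)
  then have "res \<gamma> x = ?y" using U(3) nd_eq[OF res_in[OF x gx] y(1)] by auto
  then have "\<gamma> = \<delta>" using lev_res[OF x gx] y(2) by metis
  then show False using g(3) by simp
qed

definition depth_layer :: "'a set \<Rightarrow> nat \<Rightarrow> nat \<Rightarrow> 'n set" where
  "depth_layer E m n = {x \<in> trace E m. card {\<gamma>. \<gamma> \<le> lev x \<and> res \<gamma> x \<in> trace E m} = n}"

text \<open>The layer number of \<open>x\<close> counts the elements of \<open>E\<close> on the
  branch up to and including \<open>x\<close>. It grows strictly along comparable elements, because
  these counts are cardinalities of finite sets.\<close>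

lemma antichain_depth_layer:
  assumes E: "E \<subseteq> nodes"
    and cd: "\<And>p. p \<in> nodes \<Longrightarrow> \<exists>U. openin Y U \<and> p \<in> U \<and> U \<inter> E \<subseteq> {p}"
  shows "antichain (depth_layer E m n)"
  unfolding antichain_def
proof (intro conjI ballI impI)
  show "depth_layer E m n \<subseteq> N" unfolding depth_layer_def trace_def by blast
  fix x y assume xy: "x \<in> depth_layer E m n" "y \<in> depth_layer E m n" "lev x < lev y"
  then have N: "x \<in> N" "y \<in> N" unfolding depth_layer_def trace_def by auto
  let ?K = "\<lambda>x. {\<gamma>. \<gamma> \<le> lev x \<and> res \<gamma> x \<in> trace E m}"
  show "res (lev x) y \<noteq> x"
  proof
    assume r: "res (lev x) y = x"
    have "res \<gamma> x = res \<gamma> y" if "\<gamma> \<le> lev x" for \<gamma>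
      using res_res[OF N(2) that] r xy(3) by (simp add: less_imp_le)
    then have "?K x \<subseteq> ?K y" using xy(3) by auto
    moreover have "lev y \<in> ?K y" "lev y \<notin> ?K x"
      using xy N by (auto simp: depth_layer_def res_lev)
    ultimately have "?K x \<subset> ?K y" by blast
    then have "card (?K x) < card (?K y)"
      using closed_discrete_chain_finite[OF E cd N(2)] by (intro psubset_card_mono) auto
    then show False using xy unfolding depth_layer_def by simp
  qed
qed

lemma nodes_in_depth_layer:
  assumes "E \<subseteq> nodes" "p \<in> E"
  obtains x m n where "x \<in> depth_layer E m n" "p = nd x m"
  using assms unfolding depth_layer_def trace_def nodes_def by blast

lemma closed_discrete_nbhd:
  assumes "closedin Y E" "discrete_subspace Y E" "p \<in> topspace Y"
  shows "\<exists>U. openin Y U \<and> p \<in> U \<and> U \<inter> E \<subseteq> {p}"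
proof (cases "p \<in> E")
  case True
  then obtain U where "openin Y U" "U \<inter> E = {p}"
    using assms(2) unfolding discrete_subspace_iff by meson
  then show ?thesis by (intro exI[of _ U]) blast
next
  case False
  then have "p \<in> topspace Y - E" "openin Y (topspace Y - E)" using assms by auto
  then show ?thesis by blast
qed

subsection \<open>Collectionwise Hausdorff\<close>

text \<open>A limit ordinal outside \<open>C\<close> is no limit of \<open>C\<close>, so a tail
  below it misses \<open>C\<close> and has the same next element of \<open>C\<close>.\<close>

lemma openin_rank_interval:
  assumes C: "cub C"
  shows "openin Y {p \<in> topspace Y. rank p \<notin> C \<and> (LEAST c. c \<in> C \<and> rank p < c) = d}"
proof (rule openin_rank[of "{\<xi>. \<xi> \<notin> C \<and> (LEAST c. c \<in> C \<and> \<xi> < c) = d}", simplified])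
  fix \<delta> assume d: "olim \<delta>" "\<delta> \<notin> C \<and> (LEAST c. c \<in> C \<and> \<delta> < c) = d"
  then obtain \<beta> where b: "\<beta> < \<delta>" "\<And>\<alpha>. \<alpha> \<in> C \<Longrightarrow> \<beta> < \<alpha> \<Longrightarrow> \<not> \<alpha> < \<delta>"
    using C unfolding cub_def limit_of_def by blast
  have "\<gamma> \<notin> C \<and> (LEAST c. c \<in> C \<and> \<gamma> < c) = d" if "\<beta> < \<gamma>" "\<gamma> \<le> \<delta>" for \<gamma>
  proof -
    have "c \<in> C \<and> \<gamma> < c \<longleftrightarrow> c \<in> C \<and> \<delta> < c" for c
      using b(2)[of c] d(2) that by (metis le_less_trans less_trans linorder_neqE)
    then have "(LEAST c. c \<in> C \<and> \<gamma> < c) = (LEAST c. c \<in> C \<and> \<delta> < c)" by simp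
    moreover have "\<gamma> \<notin> C" using b(2)[of \<gamma>] d(2) that by (metis order_le_less)
    ultimately show ?thesis using d(2) by simp
  qed
  then show "\<exists>\<beta><\<delta>. \<forall>\<gamma>. \<beta> < \<gamma> \<and> \<gamma> \<le> \<delta> \<longrightarrow> \<gamma> \<notin> C \<and> (LEAST c. c \<in> C \<and> \<gamma> < c) = d"
    using b(1) by blast
qed

lemma separated_off_cub:
  assumes C: "cub C" and E: "closedin Y E" "discrete_subspace Y E"
    and off: "\<And>p. p \<in> E \<Longrightarrow> rank p \<notin> C"
  obtains V where "\<And>p. p \<in> E \<Longrightarrow> openin Y (V p) \<and> p \<in> V p" "disjoint_family_on V E"
proof -
  define nx where "nx p = (LEAST c. c \<in> C \<and> rank p < c)" for p
  define W where "W d = {p \<in> topspace Y. rank p \<notin> C \<and> nx p = d}" for d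
  have Es: "E \<subseteq> topspace Y" using E(1) closedin_subset by blast
  have oW: "openin Y (W d)" for d unfolding W_def nx_def using openin_rank_interval[OF C] .
  have nx: "rank p < nx p" for p
  proof -
    obtain c where "c \<in> C" "rank p < c"
      using uncountable_omega1_unbounded[of C "rank p"] C cub_def by blast
    then show ?thesis unfolding nx_def by (metis (mono_tags, lifting) LeastI)
  qed
  have cd: "\<exists>V. (\<forall>p\<in>E \<inter> W d. openin Y (V p) \<and> p \<in> V p) \<and> disjoint_family_on V (E \<inter> W d)" for d
  proof -
    have sub: "E \<inter> W d \<subseteq> E" by blast
    have "E \<inter> W d \<subseteq> {p \<in> topspace Y. rank p \<le> d}"
      unfolding W_def using nx less_imp_le by blast
    then have "countable (E \<inter> W d)" using countable_rank_le countable_subset by blast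
    moreover have "discrete_subspace Y (E \<inter> W d)"
      unfolding discrete_subspace_iff
    proof (intro conjI ballI)
      show "E \<inter> W d \<subseteq> topspace Y" using Es by blast
      fix p assume p: "p \<in> E \<inter> W d"
      then obtain U where "openin Y U" "p \<in> U" "U \<inter> E \<subseteq> {p}"
        using closed_discrete_nbhd[OF E] Es by blast
      then show "\<exists>U. openin Y U \<and> U \<inter> (E \<inter> W d) = {p}" using p by (intro exI[of _ U]) blast
    qed
    \<comment> \<open>\<open>W d\<close> itself may fail to be closed; but every subset of a closed
      discrete set is closed.\<close>
    moreover have "closedin Y (E \<inter> W d)"
      unfolding closedin_def openin_subopen[of Y "topspace Y - E \<inter> W d"]
    proof (intro conjI ballI)
      show "E \<inter> W d \<subseteq> topspace Y" using Es by blast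
      fix p assume p: "p \<in> topspace Y - E \<inter> W d"
      then obtain U where "openin Y U" "p \<in> U" "U \<inter> E \<subseteq> {p}" using closed_discrete_nbhd[OF E] by blast
      moreover have "U \<subseteq> topspace Y" using \<open>openin Y U\<close> by (rule openin_subset)
      ultimately show "\<exists>T. openin Y T \<and> p \<in> T \<and> T \<subseteq> topspace Y - E \<inter> W d"
        using p by (intro exI[of _ U]) blast
    qed
    ultimately obtain V where "\<And>p. p \<in> E \<inter> W d \<Longrightarrow> openin Y (V p) \<and> p \<in> V p"
      "disjoint_family_on V (E \<inter> W d)"
      using countable_discrete_clopen_expansion[of "E \<inter> W d" Y] clopen_base by metis
    then show ?thesis by blast
  qed
  then obtain V where V: "\<And>d p. p \<in> E \<inter> W d \<Longrightarrow> openin Y (V d p) \<and> p \<in> V d p"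
    "\<And>d. disjoint_family_on (V d) (E \<inter> W d)" by metis
  have inW: "p \<in> W (nx p)" if "p \<in> E" for p using that off Es by (auto simp: W_def)
  show ?thesis
  proof
    fix p assume "p \<in> E"
    then show "openin Y (V (nx p) p \<inter> W (nx p)) \<and> p \<in> V (nx p) p \<inter> W (nx p)"
      using V(1)[of p "nx p"] inW oW by auto
  next
    show "disjoint_family_on (\<lambda>p. V (nx p) p \<inter> W (nx p)) E"
      unfolding disjoint_family_on_def
    proof (intro ballI impI)
      fix p q assume pq: "p \<in> E" "q \<in> E" "p \<noteq> q"
      show "(V (nx p) p \<inter> W (nx p)) \<inter> (V (nx q) q \<inter> W (nx q)) = {}"
      proof (cases "nx p = nx q")
        case True
        then have "V (nx p) p \<inter> V (nx p) q = {}"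
          using V(2)[of "nx p"] pq inW[of p] inW[of q] unfolding disjoint_family_on_def by auto
        then show ?thesis using True by auto
      next
        case False
        then show ?thesis unfolding W_def by auto
      qed
    qed
  qed
qed

lemma collectionwise_Hausdorff_Y:
  assumes ns: "\<And>A. antichain A \<Longrightarrow> \<exists>C. cub C \<and> (\<forall>x\<in>A. lev x \<notin> C)"
  shows "collectionwise_Hausdorff Y"
  unfolding collectionwise_Hausdorff_def
proof (intro allI impI, elim conjE)
  fix E assume E: "closedin Y E" "discrete_subspace Y E"
  define F where "F = E \<inter> nodes"
  have F: "F \<subseteq> nodes" unfolding F_def by blast
  have nb: "\<exists>U. openin Y U \<and> p \<in> U \<and> U \<inter> F \<subseteq> {p}" if p: "p \<in> nodes" for p
  proof -
    have "p \<in> topspace Y" using p topspace_Y by blast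
    then obtain U where "openin Y U" "p \<in> U" "U \<inter> E \<subseteq> {p}"
      using closed_discrete_nbhd[OF E] by blast
    then show ?thesis unfolding F_def by (intro exI[of _ U]) blast
  qed
  have "\<exists>C. cub C \<and> (\<forall>x\<in>depth_layer F (fst i) (snd i). lev x \<notin> C)" for i
    using ns antichain_depth_layer[OF F nb] by blast
  then obtain C where C: "\<And>i. cub (C i)"
    "\<And>i x. x \<in> depth_layer F (fst i) (snd i) \<Longrightarrow> lev x \<notin> C i" by metis
  \<comment> \<open>The set of limit ordinals, in the form of \<open>cub_closed_under\<close>. It
    takes care of the points \<open>dp a\<close>, whose ranks are successors; the indices
    \<open>Some i\<close> take care of the layers of nodes.\<close>
  define L where "L = {\<delta>. olim \<delta> \<and> (\<forall>\<beta><\<delta>. osuc \<beta> < \<delta>)}"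
  define C' where "C' j = (case j of None \<Rightarrow> L | Some i \<Rightarrow> C i)" for j
  have cC': "cub (\<Inter>j\<in>UNIV. C' j)"
    by (rule cub_Inter) (auto simp: C'_def L_def cub_closed_under C split: option.split)
  have "rank p \<notin> (\<Inter>j\<in>UNIV. C' j)" if p: "p \<in> E" for p
  proof -
    have "p \<in> topspace Y" using p E(1) closedin_subset by blast
    then show ?thesis
    proof (cases rule: topspace_cases)
      case (limit a)
      then have "rank p \<notin> C' None" by (simp add: C'_def L_def)
      then show ?thesis by blast
    next
      case (node x m)
      then have "p \<in> F" unfolding F_def using p by simp
      then obtain y k n where y: "y \<in> depth_layer F k n" "p = nd y k" using nodes_in_depth_layer[OF F] by blast
      then have "y \<in> N" by (simp add: depth_layer_def trace_def)
      then have "rank p \<notin> C' (Some (k, n))" using C(2)[of y "(k, n)"] y by (simp add: C'_def)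
      then show ?thesis by blast
    qed
  qed
  then obtain V where "\<And>p. p \<in> E \<Longrightarrow> openin Y (V p) \<and> p \<in> V p" "disjoint_family_on V E"
    using separated_off_cub[OF cC' E] by blast
  then show "\<exists>V. (\<forall>d\<in>E. openin Y (V d) \<and> d \<in> V d) \<and> disjoint_family_on V E" by blast
qed

subsection \<open>The open dense subspace of nodes\<close>

lemma closure_of_nodes: "Y closure_of nodes = topspace Y"
proof
  show "Y closure_of nodes \<subseteq> topspace Y" by (rule closure_of_subset_topspace)
  show "topspace Y \<subseteq> Y closure_of nodes"
  proof
    fix p assume p: "p \<in> topspace Y"
    then show "p \<in> Y closure_of nodes"
    proof (cases rule: topspace_cases)
      case (node x m)
      then show ?thesis using p closure_of_subset[of nodes Y] topspace_Y by auto
    next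
      case (limit a)
      show ?thesis
        unfolding in_closure_of
      proof (intro conjI allI impI)
        fix T assume T: "p \<in> T \<and> openin Y T"
        obtain n where n: "\<And>m x. m \<ge> n \<Longrightarrow> x \<in> N \<Longrightarrow> lev x = osuc a \<Longrightarrow> nd x m \<in> T"
          using openin_Y_dp[of T a] T limit by blast
        obtain x where "x \<in> N" "lev x = osuc a" using level_nonempty by blast
        then have "nd x n \<in> nodes" "nd x n \<in> T" using n by auto
        then show "\<exists>y. y \<in> nodes \<and> y \<in> T" by blast
      qed (rule p)
    qed
  qed
qed

text \<open>Induction along the branch of \<open>x\<close>: the member of a cover that contains the
  top node contains a final segment, and what remains is the segment up to an earlier node.\<close>

lemma compactin_seg:
  assumes x: "x \<in> N" and "\<alpha> \<le> lev x"
  shows "compactin Y (seg ozero (res \<alpha> x) m)"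
  using assms(2)
proof (induction \<alpha> rule: less_induct)
  case (less \<alpha>)
  let ?y = "res \<alpha> x"
  have y: "?y \<in> N" "lev ?y = \<alpha>" using less.prems x res_in lev_res by auto
  have r: "res \<gamma> ?y = res \<gamma> x" if "\<gamma> \<le> \<alpha>" for \<gamma> using res_res[OF x that less.prems] .
  show ?case
    unfolding compactin_def
  proof (intro conjI allI impI, goal_cases)
    case 1
    show ?case using seg_subset[OF y(1)] topspace_Y by blast
  next
    case (2 \<U>)
    then have op: "\<And>U. U \<in> \<U> \<Longrightarrow> openin Y U" and cov: "seg ozero ?y m \<subseteq> \<Union>\<U>" by auto
    have "nd ?y m \<in> seg ozero ?y m" using nd_in_seg[OF y(1)] by simp
    then obtain U where U: "U \<in> \<U>" "nd ?y m \<in> U" using cov by blast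
    obtain \<beta> where b: "\<beta> \<le> \<alpha>" "\<not> olim \<beta>" "seg \<beta> ?y m \<subseteq> U"
      using seg_base[OF op[OF U(1)] y(1) U(2)] y(2) by metis
    show ?case
    proof (cases \<beta> rule: omega1_cases)
      case zero
      then show ?thesis using b(3) U(1) by (intro exI[of _ "{U}"]) auto
    next
      case lim
      then show ?thesis using b(2) by blast
    next
      case (suc \<gamma>)
      then have g: "\<gamma> < \<alpha>" using b(1) osuc_le_iff by blast
      then have gx: "\<gamma> \<le> lev x" using less.prems by simp
      have "seg ozero (res \<gamma> x) m \<subseteq> seg ozero ?y m"
      proof -
        have "lev (res \<gamma> x) = \<gamma>" "\<And>\<xi>. \<xi> \<le> \<gamma> \<Longrightarrow> res \<xi> (res \<gamma> x) = res \<xi> ?y"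
          using lev_res[OF x gx] res_res[OF x _ gx] r g by auto
        then show ?thesis unfolding seg_def using g y(2) by fastforce
      qed
      then have "seg ozero (res \<gamma> x) m \<subseteq> \<Union>\<U>" using cov by blast
      then obtain \<F> where F: "finite \<F>" "\<F> \<subseteq> \<U>" "seg ozero (res \<gamma> x) m \<subseteq> \<Union>\<F>"
        using less.IH[OF g gx] op unfolding compactin_def by blast
      have "seg ozero ?y m \<subseteq> seg ozero (res \<gamma> x) m \<union> seg \<beta> ?y m"
      proof
        fix p assume "p \<in> seg ozero ?y m"
        then obtain \<xi> where xi: "p = nd (res \<xi> ?y) m" "\<xi> \<le> \<alpha>" unfolding seg_def y(2) by blast
        show "p \<in> seg ozero (res \<gamma> x) m \<union> seg \<beta> ?y m"
        proof (cases "\<xi> \<le> \<gamma>")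
          case True
          then have "p = nd (res \<xi> (res \<gamma> x)) m" using xi r res_res[OF x True gx] by simp
          then show ?thesis using True lev_res[OF x gx] unfolding seg_def by auto
        next
          case False
          then have "\<beta> \<le> \<xi>" using suc by (simp add: osuc_le_iff)
          then show ?thesis using xi y(2) unfolding seg_def by auto
        qed
      qed
      then show ?thesis using F b(3) U(1) by (intro exI[of _ "insert U \<F>"]) auto
    qed
  qed
qed

lemma locally_compact_nodes: "locally_compact_space (subtopology Y nodes)"
  unfolding locally_compact_space_def
proof
  fix p assume "p \<in> topspace (subtopology Y nodes)"
  then obtain x m where x: "x \<in> N" "p = nd x m" unfolding nodes_def by auto
  have "openin (subtopology Y nodes) (seg ozero x m)"
    using openin_seg[OF x(1), of ozero m] seg_subset[OF x(1)] openin_nodes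
    by (simp add: openin_open_subtopology)
  moreover have "compactin (subtopology Y nodes) (seg ozero x m)"
    using compactin_seg[OF x(1), of "lev x" m] seg_subset[OF x(1)] x(1)
    by (simp add: compactin_subtopology res_lev)
  moreover have "p \<in> seg ozero x m" using x nd_in_seg by auto
  ultimately show "\<exists>U K. openin (subtopology Y nodes) U \<and> compactin (subtopology Y nodes) K \<and> p \<in> U \<and> U \<subseteq> K"
    by blast
qed

text \<open>A closed discrete set of nodes is the union of its layers over all copies and all
  depths, that is, of countably many antichains.\<close>

lemma omega1_compact_nodes:
  assumes anti: "\<And>A. antichain A \<Longrightarrow> countable A"
  shows "omega1_compact (subtopology Y nodes)"
  unfolding omega1_compact_def
proof (intro allI impI, elim conjE)
  fix E assume E: "closedin (subtopology Y nodes) E" "discrete_subspace (subtopology Y nodes) E"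
  then have F: "E \<subseteq> nodes" using closedin_subset by fastforce
  have nodesY: "nodes \<subseteq> topspace Y" using topspace_Y by blast
  have nb: "\<exists>U. openin Y U \<and> p \<in> U \<and> U \<inter> E \<subseteq> {p}" if p: "p \<in> nodes" for p
  proof (cases "p \<in> E")
    case True
    then obtain U where "openin (subtopology Y nodes) U" "U \<inter> E = {p}"
      using E(2) unfolding discrete_subspace_iff by meson
    moreover from this have "openin Y U" using openin_open_subtopology[OF openin_nodes] by simp
    ultimately show ?thesis by (intro exI[of _ U]) blast
  next
    case False
    have "openin (subtopology Y nodes) (nodes - E)"
      using E(1) nodesY unfolding closedin_def by (simp add: Int_absorb1)
    then have "openin Y (nodes - E)" using openin_open_subtopology[OF openin_nodes] by simp
    then show ?thesis using p False by (intro exI[of _ "nodes - E"]) blast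
  qed
  have "E \<subseteq> (\<Union>m. \<Union>n. (\<lambda>x. nd x m) ` depth_layer E m n)"
  proof
    fix p assume "p \<in> E"
    from nodes_in_depth_layer[OF F this]
    obtain x m n where "x \<in> depth_layer E m n" "p = nd x m" .
    then show "p \<in> (\<Union>m. \<Union>n. (\<lambda>x. nd x m) ` depth_layer E m n)" by auto
  qed
  moreover have "countable (\<Union>m. \<Union>n. (\<lambda>x. nd x m) ` depth_layer E m n)"
    using anti antichain_depth_layer[OF F nb] by (intro countable_UN countable_image) auto
  ultimately show "countable E" by (rule countable_subset)
qed

end

section \<open>Real codes for nodes; antichains obtained from increasing real functions\<close>

context omega1_tree begin

lemma tree_space_exists: "\<exists>(nd :: 'n \<Rightarrow> nat \<Rightarrow> real) dp. tree_space N lev res nd dp"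
proof (rule coding_into_real)
  fix nd :: "omega1 \<Rightarrow> nat \<Rightarrow> nat \<Rightarrow> real" and dp :: "omega1 \<Rightarrow> real"
  assume nd: "\<And>a k m b l n. nd a k m = nd b l n \<longleftrightarrow> a = b \<and> k = l \<and> m = n"
    and dp: "inj dp" "\<And>a k m b. nd a k m \<noteq> dp b"
  \<comment> \<open>The number of \<open>x\<close> in its countable level; together with
    \<open>lev x\<close> it determines \<open>x\<close>.\<close>
  define c where "c x = to_nat_on {y \<in> N. lev y = lev x} x" for x
  have c: "x = y" if "x \<in> N" "y \<in> N" "lev x = lev y" "c x = c y" for x y
  proof -
    have "to_nat_on {z \<in> N. lev z = lev x} x = to_nat_on {z \<in> N. lev z = lev x} y"
      using that(3,4) unfolding c_def by simp
    then show ?thesis using that to_nat_on_inj[OF countable_level, of x "lev x" y] by simp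
  qed
  have "tree_space N lev res (\<lambda>x m. nd (lev x) (c x) m) dp"
    by unfold_locales (use c nd dp in auto)
  then show ?thesis by blast
qed

definition below :: "'n \<Rightarrow> 'n \<Rightarrow> bool" where
  "below x y \<longleftrightarrow> lev x < lev y \<and> res (lev x) y = x"

lemma antichain_below: "antichain A \<longleftrightarrow> A \<subseteq> N \<and> (\<forall>x\<in>A. \<forall>y\<in>A. \<not> below x y)"
  unfolding antichain_def below_def by auto

lemma below_common:
  assumes "z \<in> N" "below x z" "below y z" "lev x < lev y"
  shows "below x y"
  using assms res_res[of z "lev x" "lev y"] unfolding below_def by auto

text \<open>
  Those elements of \<open>A\<close> with an immediate predecessor in \<open>A\<close> are sorted into countably many
  antichains by a rational number between the values of \<open>g\<close> at the two nodes.
\<close>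

lemma uncountable_antichain_if_increasing:
  fixes g :: "'n \<Rightarrow> real"
  assumes g: "\<And>x y. x \<in> N \<Longrightarrow> y \<in> N \<Longrightarrow> below x y \<Longrightarrow> g x < g y"
    and A: "A \<subseteq> N" "uncountable A"
  shows "\<exists>B\<subseteq>A. uncountable B \<and> antichain B"
proof (rule ccontr)
  assume "\<not> ?thesis"
  then have cnt: "countable B" if "B \<subseteq> A" "antichain B" for B using that by blast
  define ip where "ip x y \<longleftrightarrow> x \<in> A \<and> below x y \<and> (\<forall>z\<in>A. below x z \<longrightarrow> \<not> below z y)" for x y
  define S where "S = {y \<in> A. \<exists>x. ip x y}"
  have "\<exists>x. ip x y" if "y \<in> S" for y using that S_def by simp
  then obtain p where p: "\<And>y. y \<in> S \<Longrightarrow> ip (p y) y" by metis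
  have SN: "y \<in> N" "y \<in> A" if "y \<in> S" for y using that A(1) S_def by auto
  have pN: "p y \<in> N" "p y \<in> A" "below (p y) y" if "y \<in> S" for y
    using p[OF that] A(1) ip_def by auto
  have "\<exists>q :: rat. g (p y) < of_rat q \<and> of_rat q < g y" if "y \<in> S" for y
    using of_rat_dense g[of "p y" y] pN[OF that] SN[OF that] by blast
  then obtain r :: "'n \<Rightarrow> rat" where r: "\<And>y. y \<in> S \<Longrightarrow> g (p y) < of_rat (r y) \<and> of_rat (r y) < g y"
    by metis
  have "antichain {y \<in> S. r y = q}" for q
    unfolding antichain_below
  proof (intro conjI ballI notI)
    show "{y \<in> S. r y = q} \<subseteq> N" using SN by auto
    fix y1 y2 assume y: "y1 \<in> {y \<in> S. r y = q}" "y2 \<in> {y \<in> S. r y = q}" "below y1 y2"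
    then have y': "y1 \<in> S" "y2 \<in> S" "r y1 = r y2" by auto
    \<comment> \<open>Both \<open>y1\<close> and \<open>p y2\<close> lie on the branch of
      \<open>y2\<close>, and no element of \<open>A\<close> lies strictly between
      \<open>p y2\<close> and \<open>y2\<close>. So \<open>y1\<close> is at or below
      \<open>p y2\<close>, and \<open>g y1 \<le> g (p y2) < q < g y1\<close>.\<close>
    have "\<not> below (p y2) y1" using p[OF y'(2)] y(3) SN[OF y'(1)] unfolding ip_def by auto
    then have "\<not> lev (p y2) < lev y1"
      using below_common[OF SN(1)[OF y'(2)] pN(3)[OF y'(2)] y(3)] by (rule contrapos_nn)
    moreover have "y1 = p y2" if "lev (p y2) = lev y1"
      using pN(3)[OF y'(2)] y(3) that unfolding below_def by metis
    moreover have "below y1 (p y2)" if "lev y1 < lev (p y2)"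
      using below_common[OF SN(1)[OF y'(2)] y(3) pN(3)[OF y'(2)] that] .
    ultimately have "g y1 \<le> g (p y2)"
      using g[of y1 "p y2"] SN(1)[OF y'(1)] pN(1)[OF y'(2)] by (metis less_imp_le linorder_neqE order_refl)
    then show False using r[OF y'(1)] r[OF y'(2)] y'(3) by auto
  qed
  then have "countable {y \<in> S. r y = q}" for q
    by (intro cnt) (use SN in auto)
  then have "countable (\<Union>q. {y \<in> S. r y = q})" by simp
  moreover have "S = (\<Union>q. {y \<in> S. r y = q})" by auto
  ultimately have "countable (lev ` S)" by simp
  then obtain \<beta> where b: "\<And>y. y \<in> S \<Longrightarrow> lev y < \<beta>" unfolding omega1_bounded_iff_countable by auto
  \<comment> \<open>From level \<beta> on, no element of \<open>A\<close> has an immediate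
    predecessor in \<open>A\<close>. The minimal elements \<open>M\<close> of \<open>A'\<close> form
    an antichain, so some \<open>u\<close> in \<open>A'\<close> lies above a \<open>z\<close> in
    \<open>A'\<close>; the first element of \<open>A\<close> after \<open>z\<close> on the branch of
    \<open>u\<close> gives the contradiction.\<close>
  define A' where "A' = {x \<in> A. \<beta> \<le> lev x}"
  define M where "M = {x \<in> A'. \<not> (\<exists>z\<in>A'. below z x)}"
  have "countable M"
    by (rule cnt) (use A in \<open>auto simp: M_def A'_def antichain_below\<close>)
  moreover have "uncountable A'" unfolding A'_def using uncountable_above A by simp
  ultimately obtain u where u: "u \<in> A'" "u \<notin> M" by (metis countable_subset subsetI)
  then obtain z where z: "z \<in> A'" "below z u" unfolding M_def by blast
  have N: "u \<in> N" "z \<in> N" "u \<in> A" "z \<in> A" using u z A(1) A'_def by auto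
  define Q where "Q \<gamma> \<longleftrightarrow> lev z < \<gamma> \<and> \<gamma> \<le> lev u \<and> res \<gamma> u \<in> A" for \<gamma>
  have "Q (lev u)" using z N by (simp add: Q_def below_def res_lev)
  define \<delta> where "\<delta> = (LEAST \<gamma>. Q \<gamma>)"
  have d: "Q \<delta>" unfolding \<delta>_def using \<open>Q (lev u)\<close> by (rule LeastI)
  define w where "w = res \<delta> u"
  have w: "w \<in> A" "lev w = \<delta>" "w \<in> N"
    using d N unfolding Q_def w_def by (simp_all add: lev_res res_in)
  have zw: "below z w"
    using z(2) d N(1) res_res[of u "lev z" \<delta>] w(2) unfolding Q_def below_def w_def by auto
  have "\<not> below v w" if v: "v \<in> A" "below z v" for v
  proof
    assume vw: "below v w"
    then have "lev v < \<delta>" "res (lev v) w = v" using w(2) unfolding below_def by auto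
    moreover from this have "res (lev v) w = res (lev v) u"
      unfolding w_def using N(1) d by (intro res_res) (auto simp: Q_def)
    ultimately have "Q (lev v)" using v d unfolding Q_def below_def by auto
    then show False using \<open>lev v < \<delta>\<close> not_less_Least unfolding \<delta>_def by blast
  qed
  then have "ip z w" using zw N unfolding ip_def by blast
  then have "w \<in> S" using w(1) S_def by blast
  then have "lev w < \<beta>" by (rule b)
  moreover have "\<beta> \<le> lev z" using z(1) A'_def by simp
  moreover have "lev z < lev w" using zw below_def by simp
  ultimately show False by simp
qed

end

text \<open>Rationals between consecutive values would be pairwise distinct.\<close>

lemma no_increasing_omega1_real: "\<not> (\<forall>\<alpha> \<beta>. \<alpha> < \<beta> \<longrightarrow> f \<alpha> < (f \<beta> :: real))" for f :: "omega1 \<Rightarrow> real"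
proof
  assume f: "\<forall>\<alpha> \<beta>. \<alpha> < \<beta> \<longrightarrow> f \<alpha> < f \<beta>"
  then have "\<exists>q :: rat. f \<alpha> < of_rat q \<and> of_rat q < f (osuc \<alpha>)" for \<alpha> using of_rat_dense by auto
  then obtain r :: "omega1 \<Rightarrow> rat" where r: "\<And>\<alpha>. f \<alpha> < of_rat (r \<alpha>) \<and> of_rat (r \<alpha>) < f (osuc \<alpha>)" by metis
  have "r \<alpha> < r \<beta>" if "\<alpha> < \<beta>" for \<alpha> \<beta>
  proof -
    have "osuc \<alpha> \<le> \<beta>" using that osuc_le_iff by blast
    then have "f (osuc \<alpha>) \<le> f \<beta>" using f by (metis order_le_less)
    then have "(of_rat (r \<alpha>) :: real) < of_rat (r \<beta>)" using r[of \<alpha>] r[of \<beta>] by linarith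
    then show ?thesis by (simp add: of_rat_less)
  qed
  then have "inj r" by (metis injI linorder_neqE less_irrefl)
  then have "countable (UNIV :: omega1 set)" by (metis countableI_type countable_image_inj_on)
  then show False using uncountable_UNIV_omega1 by blast
qed

section \<open>Trees of increasing real functions\<close>

text \<open>
  The nodes on level \<open>\<alpha>\<close> are certain strictly increasing functions on \<open>{..\<alpha>}\<close>, extended by 0.
  The value at \<open>\<alpha>\<close> bounds the function, and smaller values leave more room for extensions.
\<close>

definition cut :: "omega1 \<Rightarrow> (omega1 \<Rightarrow> real) \<Rightarrow> omega1 \<Rightarrow> real" where
  "cut \<beta> t \<gamma> = (if \<gamma> \<le> \<beta> then t \<gamma> else 0)"

lemma cut_cut: "\<alpha> \<le> \<beta> \<Longrightarrow> cut \<alpha> (cut \<beta> t) = cut \<alpha> t"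
  by (auto simp: cut_def fun_eq_iff)

lemma cut_apply: "\<gamma> \<le> \<beta> \<Longrightarrow> cut \<beta> t \<gamma> = t \<gamma>"
  by (simp add: cut_def)

text \<open>
  \<open>E\<close> is a guess at an antichain, nodes being coded by their level and their number in that level.
  A node \<open>t\<close> on level \<open>\<alpha>\<close> decides \<open>E\<close> if it lies above an element of \<open>E\<close>, or if it is kept from
  belonging to the guessed antichain because, beyond some \<open>\<beta> < \<alpha>\<close>, it stays below a bound \<open>q\<close>
  that no element of \<open>E\<close> above it undercuts.
\<close>

definition decides ::
  "(omega1 \<Rightarrow> (omega1 \<Rightarrow> real) set) \<Rightarrow> omega1 \<Rightarrow> (omega1 \<Rightarrow> real) \<Rightarrow> (omega1 \<times> nat) set \<Rightarrow> bool" where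
  "decides L \<alpha> t E \<longleftrightarrow>
    (\<exists>\<beta><\<alpha>. (\<beta>, to_nat_on (L \<beta>) (cut \<beta> t)) \<in> E) \<or>
    (\<exists>\<beta><\<alpha>. \<exists>q>t \<alpha>. \<forall>\<gamma><\<alpha>. \<forall>u\<in>L \<gamma>.
      \<beta> \<le> \<gamma> \<and> cut \<beta> u = cut \<beta> t \<and> (\<gamma>, to_nat_on (L \<gamma>) u) \<in> E \<longrightarrow> q \<le> u \<gamma>)"

text \<open>The supremum clause makes a node on a limit level determined by its predecessors, as
  \<open>limit_node_unique\<close> demands.\<close>

definition good_node ::
  "(omega1 \<Rightarrow> (omega1 \<times> nat) set set) \<Rightarrow> (omega1 \<Rightarrow> (omega1 \<Rightarrow> real) set) \<Rightarrow> omega1 \<Rightarrow>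
    (omega1 \<Rightarrow> real) \<Rightarrow> bool" where
  "good_node G L \<alpha> t \<longleftrightarrow>
    (\<forall>\<gamma>>\<alpha>. t \<gamma> = 0) \<and> (\<forall>\<beta> \<gamma>. \<beta> < \<gamma> \<and> \<gamma> \<le> \<alpha> \<longrightarrow> t \<beta> < t \<gamma>) \<and> (\<forall>\<beta><\<alpha>. cut \<beta> t \<in> L \<beta>) \<and>
    (olim \<alpha> \<longrightarrow> t \<alpha> = (SUP \<gamma>\<in>{..<\<alpha>}. t \<gamma>) \<and> (\<forall>E\<in>G \<alpha>. decides L \<alpha> t E))"

text \<open>The last clause is the inductive hypothesis of Aronszajn's construction: every node
  extends to every later level at an arbitrarily small cost in value, which keeps values bounded on
  the way to limit levels. The candidate \<open>R\<close> is separate from \<open>L\<close> so that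
  it can be judged before \<open>L \<alpha>\<close> is chosen.\<close>

definition good_level ::
  "(omega1 \<Rightarrow> (omega1 \<times> nat) set set) \<Rightarrow> (omega1 \<Rightarrow> (omega1 \<Rightarrow> real) set) \<Rightarrow> omega1 \<Rightarrow>
    (omega1 \<Rightarrow> real) set \<Rightarrow> bool" where
  "good_level G L \<alpha> R \<longleftrightarrow> countable R \<and> R \<noteq> {} \<and> (\<forall>t\<in>R. good_node G L \<alpha> t) \<and>
    (\<forall>\<beta><\<alpha>. \<forall>u\<in>L \<beta>. \<forall>e>0. \<exists>t\<in>R. cut \<beta> t = u \<and> t \<alpha> < u \<beta> + e)"

text \<open>Dependence on earlier levels only is what the wellordered recursion requires.\<close>

lemma good_level_cong:
  assumes "\<And>\<beta>. \<beta> < \<alpha> \<Longrightarrow> L \<beta> = L' \<beta>"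
  shows "good_level G L \<alpha> R = good_level G L' \<alpha> R"
proof -
  have "decides L \<alpha> t E = decides L' \<alpha> t E" for t E
    unfolding decides_def using assms by (auto cong: conj_cong)
  then have "good_node G L \<alpha> t = good_node G L' \<alpha> t" for t
    unfolding good_node_def using assms by auto
  then show ?thesis unfolding good_level_def using assms by auto
qed

lemma good_nodeD:
  assumes "good_node G L \<alpha> t"
  shows "\<And>\<gamma>. \<alpha> < \<gamma> \<Longrightarrow> t \<gamma> = 0" "\<And>\<beta> \<gamma>. \<beta> < \<gamma> \<Longrightarrow> \<gamma> \<le> \<alpha> \<Longrightarrow> t \<beta> < t \<gamma>"
    "\<And>\<beta>. \<beta> < \<alpha> \<Longrightarrow> cut \<beta> t \<in> L \<beta>" "olim \<alpha> \<Longrightarrow> t \<alpha> = (SUP \<gamma>\<in>{..<\<alpha>}. t \<gamma>)"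
    "\<And>E. olim \<alpha> \<Longrightarrow> E \<in> G \<alpha> \<Longrightarrow> decides L \<alpha> t E" "cut \<alpha> t = t"
  using assms unfolding good_node_def by (auto simp: cut_def fun_eq_iff not_le)

lemma good_levelD:
  assumes "good_level G L \<alpha> R"
  shows "countable R" "R \<noteq> {}" "\<And>t. t \<in> R \<Longrightarrow> good_node G L \<alpha> t"
    "\<And>\<beta> u e. \<beta> < \<alpha> \<Longrightarrow> u \<in> L \<beta> \<Longrightarrow> e > 0 \<Longrightarrow> \<exists>t\<in>R. cut \<beta> t = u \<and> t \<alpha> < u \<beta> + e"
  using assms unfolding good_level_def by auto

section \<open>Recursive construction of the levels\<close>

lemma good_level_zero: "good_level G L ozero {\<lambda>_. 0}"
proof -
  have "\<not> (\<beta> < \<gamma> \<and> \<gamma> \<le> ozero)" for \<beta> \<gamma>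
    using less_le_trans[of \<beta> \<gamma> ozero] by auto
  then show ?thesis unfolding good_level_def good_node_def by simp
qed

lemma good_level_osuc:
  assumes L: "\<And>\<beta>. \<beta> \<le> \<delta> \<Longrightarrow> good_level G L \<beta> (L \<beta>)"
  shows "\<exists>R. good_level G L (osuc \<delta>) R"
proof
  \<comment> \<open>The increments 1/(k+1) are countably many and arbitrarily small, as the two
    demands on the new level require.\<close>
  define x where "x t k = t(osuc \<delta> := t \<delta> + inverse (real (Suc k)))" for t :: "omega1 \<Rightarrow> real" and k
  let ?R = "(\<lambda>(t, k). x t k) ` (L \<delta> \<times> UNIV)"
  note d = good_levelD[OF L[OF order_refl]]
  have val: "x t k (osuc \<delta>) = t \<delta> + inverse (real (Suc k))" "\<gamma> \<le> \<delta> \<Longrightarrow> x t k \<gamma> = t \<gamma>"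
    "osuc \<delta> < \<gamma> \<Longrightarrow> x t k \<gamma> = t \<gamma>" for t k \<gamma>
    unfolding x_def using less_osuc[of \<delta>] by (auto simp del: less_osuc)
  have cutx: "cut \<beta> (x t k) = cut \<beta> t" if "\<beta> \<le> \<delta>" for \<beta> t k
    using that val(2) by (auto simp: cut_def fun_eq_iff)
  have good: "good_node G L (osuc \<delta>) (x t k)" if t: "t \<in> L \<delta>" for t k
    unfolding good_node_def
  proof (intro conjI allI impI)
    note td = good_nodeD[OF d(3)[OF t]]
    show "x t k \<gamma> = 0" if "osuc \<delta> < \<gamma>" for \<gamma>
      using val(3)[OF that] td(1) less_osuc that less_trans by metis
    show "x t k \<beta> < x t k \<gamma>" if bg: "\<beta> < \<gamma> \<and> \<gamma> \<le> osuc \<delta>" for \<beta> \<gamma>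
    proof (cases "\<gamma> = osuc \<delta>")
      case True
      then have "\<beta> \<le> \<delta>" using bg less_osuc_iff by simp
      then have "t \<beta> \<le> t \<delta>" using td(2) by (metis order_le_less order_refl)
      moreover have "0 < inverse (real (Suc k))" by simp
      ultimately show ?thesis using val(1,2) True \<open>\<beta> \<le> \<delta>\<close> by (metis add_le_less_mono add.right_neutral)
    next
      case False
      then have "\<gamma> \<le> \<delta>" using bg by (metis less_osuc_iff order_le_less)
      then show ?thesis using val(2) td(2) bg by auto
    qed
    show "cut \<beta> (x t k) \<in> L \<beta>" if "\<beta> < osuc \<delta>" for \<beta>
    proof -
      have "\<beta> \<le> \<delta>" using that less_osuc_iff by blast
      then show ?thesis using cutx td(3,6) t by (metis order_le_less)
    qed
  qed (use not_olim_osuc in auto)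
  show "good_level G L (osuc \<delta>) ?R"
    unfolding good_level_def
  proof (intro conjI ballI allI impI)
    show "countable ?R" using d(1) by simp
    show "?R \<noteq> {}" using d(2) by auto
    show "good_node G L (osuc \<delta>) t" if "t \<in> ?R" for t using that good by auto
    fix \<beta> u and e :: real assume b: "\<beta> < osuc \<delta>" "u \<in> L \<beta>" "0 < e"
    have "\<exists>t\<in>L \<delta>. cut \<beta> t = u \<and> t \<delta> < u \<beta> + e"
    proof (cases "\<beta> = \<delta>")
      case True
      then show ?thesis using b good_nodeD(6)[OF d(3)] by (intro bexI[of _ u]) auto
    next
      case False
      then show ?thesis using d(4)[of \<beta> u e] b by (metis less_osuc_iff order_le_less)
    qed
    then obtain t where t: "t \<in> L \<delta>" "cut \<beta> t = u" "t \<delta> < u \<beta> + e" by blast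
    obtain k where "inverse (real (Suc k)) < u \<beta> + e - t \<delta>"
      using reals_Archimedean[of "u \<beta> + e - t \<delta>"] t(3) by auto
    then have "x t k (osuc \<delta>) < u \<beta> + e" using val(1) by simp
    moreover have "cut \<beta> (x t k) = u" using cutx t(2) b(1) less_osuc_iff by metis
    ultimately show "\<exists>t\<in>?R. cut \<beta> t = u \<and> t (osuc \<delta>) < u \<beta> + e" using t(1) by force
  qed
qed

text \<open>A fusion along a cofinal sequence. A state is a node \<open>t\<close> on level \<beta>
  with a strict bound \<open>q\<close> on the values of its later extensions. Step \<open>n\<close>
  treats the n-th guess: if it contains an extension of \<open>t\<close> with value below
  \<open>q\<close>, the next node passes through such an extension; otherwise \<open>q\<close> is
  the bound that \<open>decides\<close> asks for.\<close>

lemma limit_node_exists: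
  assumes lim: "olim \<alpha>" and G: "countable (G \<alpha>)"
    and L: "\<And>\<beta>. \<beta> < \<alpha> \<Longrightarrow> good_level G L \<beta> (L \<beta>)"
    and u: "\<beta>0 < \<alpha>" "u \<in> L \<beta>0" "0 < e"
  shows "\<exists>t. good_node G L \<alpha> t \<and> cut \<beta>0 t = u \<and> t \<alpha> < u \<beta>0 + e"
proof -
  obtain a :: "nat \<Rightarrow> omega1" where a': "(\<forall>n. a n < \<alpha>) \<and> (\<forall>\<beta><\<alpha>. \<exists>n. \<beta> < a n)"
    using olim_countable_cofinal[OF lim] ..
  then have a: "a n < \<alpha>" "\<beta> < \<alpha> \<Longrightarrow> \<exists>n. \<beta> < a n" for n \<beta> by auto
  \<comment> \<open>The additional empty guess makes an enumeration possible when
    \<open>G \<alpha>\<close> is empty; it is avoided trivially.\<close>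
  define g where "g = from_nat_into (insert {} (G \<alpha>))"
  have g: "range g = insert {} (G \<alpha>)"
    unfolding g_def using G by (intro range_from_nat_into) auto
  define inv where "inv s \<longleftrightarrow> (case s of (\<beta>, t, q) \<Rightarrow> \<beta> < \<alpha> \<and> t \<in> L \<beta> \<and> t \<beta> < q)" for s :: "omega1 \<times> (omega1 \<Rightarrow> real) \<times> real"
  define avoid where "avoid n \<beta> t q \<longleftrightarrow> (\<forall>\<gamma><\<alpha>. \<forall>u\<in>L \<gamma>.
    \<beta> \<le> \<gamma> \<and> cut \<beta> u = t \<and> (\<gamma>, to_nat_on (L \<gamma>) u) \<in> g n \<longrightarrow> q \<le> u \<gamma>)" for n \<beta> t and q :: real
  define rel where "rel n s s' \<longleftrightarrow> (case s of (\<beta>, t, q) \<Rightarrow> case s' of (\<beta>', t', q') \<Rightarrow>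
    \<beta> \<le> \<beta>' \<and> a n < \<beta>' \<and> cut \<beta> t' = t \<and> q' < q \<and>
    ((\<exists>\<gamma>\<le>\<beta>'. (\<gamma>, to_nat_on (L \<gamma>) (cut \<gamma> t')) \<in> g n) \<or> avoid n \<beta> t q))" for n :: nat and s s'
  have "\<exists>f. \<forall>n :: nat. (inv (f n) \<and> (n = 0 \<longrightarrow> f n = (\<beta>0, u, u \<beta>0 + e))) \<and> rel n (f n) (f (Suc n))"
  proof (rule dependent_nat_choice)
    show "\<exists>x. inv x \<and> (0 = (0::nat) \<longrightarrow> x = (\<beta>0, u, u \<beta>0 + e))" using u by (auto simp: inv_def)
  next
    fix s :: "omega1 \<times> (omega1 \<Rightarrow> real) \<times> real" and n :: nat
    assume "inv s \<and> (n = 0 \<longrightarrow> s = (\<beta>0, u, u \<beta>0 + e))"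
    moreover obtain \<beta> t q where s: "s = (\<beta>, t, q)" by (cases s)
    ultimately have i: "\<beta> < \<alpha>" "t \<in> L \<beta>" "t \<beta> < q" by (auto simp: inv_def)
    have cutt: "cut \<beta> t = t" using good_nodeD(6)[OF good_levelD(3)[OF L[OF i(1)] i(2)]] .
    obtain \<gamma> v where v: "\<beta> \<le> \<gamma>" "\<gamma> < \<alpha>" "v \<in> L \<gamma>" "v \<gamma> < q" "cut \<beta> v = t"
      "(\<gamma>, to_nat_on (L \<gamma>) v) \<in> g n \<or> avoid n \<beta> t q"
    proof (cases "avoid n \<beta> t q")
      case True
      then show ?thesis using that[of \<beta> t] i cutt by simp
    next
      case False
      then show ?thesis unfolding avoid_def using that by (meson not_le)
    qed
    define \<beta>' where "\<beta>' = osuc (max \<gamma> (a n))"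
    have "max \<gamma> (a n) < \<alpha>" using v(2) a(1) by simp
    then have b': "\<beta>' < \<alpha>" unfolding \<beta>'_def using lim olim_osuc by blast
    have b'': "\<gamma> < \<beta>'" "a n < \<beta>'" unfolding \<beta>'_def by (auto simp: less_osuc_iff)
    \<comment> \<open>The midpoint leaves room for an extension of \<open>v\<close> and makes the
      bounds strictly decreasing.\<close>
    define q' where "q' = (v \<gamma> + q) / 2"
    have q': "v \<gamma> < q'" "q' < q" using v(4) by (auto simp: q'_def)
    then have "0 < q' - v \<gamma>" by simp
    from good_levelD(4)[OF L[OF b'] b''(1) v(3) this]
    obtain t' where t': "t' \<in> L \<beta>'" "cut \<gamma> t' = v" "t' \<beta>' < q'" by auto
    have "inv (\<beta>', t', q')" using b' t' by (simp add: inv_def)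
    moreover have "rel n s (\<beta>', t', q')"
    proof -
      have "cut \<beta> t' = t" using cut_cut[OF v(1), of t'] t'(2) v(5) by simp
      moreover have "(\<exists>\<gamma>\<le>\<beta>'. (\<gamma>, to_nat_on (L \<gamma>) (cut \<gamma> t')) \<in> g n) \<or> avoid n \<beta> t q"
        using v(6) t'(2) b''(1) less_imp_le by blast
      ultimately show ?thesis using s v(1) b'' q' by (auto simp: rel_def)
    qed
    ultimately show "\<exists>s'. (inv s' \<and> (Suc n = 0 \<longrightarrow> s' = (\<beta>0, u, u \<beta>0 + e))) \<and> rel n s s'" by blast
  qed
  then obtain f where f: "\<And>n. inv (f n)" "f 0 = (\<beta>0, u, u \<beta>0 + e)" "\<And>n. rel n (f n) (f (Suc n))"
    by blast
  define b where "b n = fst (f n)" for n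
  define T where "T n = fst (snd (f n))" for n
  define q where "q n = snd (snd (f n))" for n
  have fn: "f n = (b n, T n, q n)" for n by (simp add: b_def T_def q_def)
  have zero: "b 0 = \<beta>0" "T 0 = u" "q 0 = u \<beta>0 + e" using f(2) by (simp_all add: b_def T_def q_def)
  have i: "b n < \<alpha>" "T n \<in> L (b n)" "T n (b n) < q n" for n
    using f(1)[of n] unfolding fn inv_def by auto
  have r: "b n \<le> b (Suc n)" "a n < b (Suc n)" "cut (b n) (T (Suc n)) = T n" "q (Suc n) < q n"
    "(\<exists>\<gamma>\<le>b (Suc n). (\<gamma>, to_nat_on (L \<gamma>) (cut \<gamma> (T (Suc n)))) \<in> g n) \<or> avoid n (b n) (T n) (q n)" for n
    using f(3)[of n] unfolding fn rel_def by auto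
  note good = good_nodeD[OF good_levelD(3)[OF L[OF i(1)] i(2)]]
  have mono: "b m \<le> b n \<and> cut (b m) (T n) = T m \<and> q n \<le> q m" if "m \<le> n" for m n
    using that
  proof (induction n rule: dec_induct)
    case base
    show ?case using good(6) by simp
  next
    case (step n)
    then have bm: "b m \<le> b n" by simp
    have "cut (b m) (T (Suc n)) = cut (b m) (cut (b n) (T (Suc n)))" using cut_cut[OF bm] by simp
    also have "\<dots> = T m" using r(3) step by simp
    finally show ?case using step r(1,4)[of n] by auto
  qed
  have cof: "\<exists>n. \<gamma> < b n" if g: "\<gamma> < \<alpha>" for \<gamma>
    using a(2)[OF g] r(2) less_trans by blast
  \<comment> \<open>The union of the coherent nodes \<open>T n\<close>, read at the first stage that
    reaches \<gamma>.\<close>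
  define t0 where "t0 \<gamma> = T (LEAST n. \<gamma> \<le> b n) \<gamma>" for \<gamma>
  have t0: "t0 \<gamma> = T n \<gamma>" if "\<gamma> \<le> b n" for \<gamma> n
  proof -
    let ?k = "LEAST n. \<gamma> \<le> b n"
    have k: "\<gamma> \<le> b ?k" "?k \<le> n" using that by (auto intro: LeastI Least_le)
    then have "T ?k = cut (b ?k) (T n)" using mono by metis
    then show ?thesis unfolding t0_def using cut_apply[OF k(1)] by simp
  qed
  define t where "t \<gamma> = (if \<gamma> < \<alpha> then t0 \<gamma> else if \<gamma> = \<alpha> then (SUP \<gamma>\<in>{..<\<alpha>}. t0 \<gamma>) else 0)" for \<gamma>
  have tT: "t \<gamma> = T n \<gamma>" if "\<gamma> \<le> b n" for \<gamma> n
    unfolding t_def using t0[OF that] le_less_trans[OF that i(1)] by simp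
  have cutT: "cut \<beta> t = cut \<beta> (T n)" if "\<beta> \<le> b n" for \<beta> n
    using tT that by (auto simp: cut_def fun_eq_iff)
  have less_q: "t \<gamma> < q n" if g: "\<gamma> < \<alpha>" for \<gamma> n
  proof -
    obtain k where "\<gamma> < b k" using cof g by blast
    then have k: "\<gamma> \<le> b (max k n)" using mono[of k "max k n"] by auto
    let ?m = "max k n"
    have "t \<gamma> \<le> T ?m (b ?m)"
      using tT[OF k] good(2)[of \<gamma> "b ?m" ?m] k by (metis order_le_less order_refl)
    also have "\<dots> < q ?m" by (rule i(3))
    also have "\<dots> \<le> q n" using mono[of n ?m] by simp
    finally show ?thesis .
  qed
  have sup: "t \<alpha> = (SUP \<gamma>\<in>{..<\<alpha>}. t \<gamma>)" by (simp add: t_def)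
  have ne: "{..<\<alpha>} \<noteq> {}" using u(1) by auto
  have bdd: "bdd_above (t ` {..<\<alpha>})" using less_q[of _ 0] by (auto intro!: bdd_aboveI2[where M = "q 0"] less_imp_le)
  have "t \<alpha> \<le> q n" for n unfolding sup using ne less_q less_imp_le by (intro cSUP_least) auto
  then have ta: "t \<alpha> < q n" for n using r(4) le_less_trans by blast
  have incr: "t \<beta> < t \<gamma>" if bg: "\<beta> < \<gamma>" "\<gamma> < \<alpha>" for \<beta> \<gamma>
  proof -
    obtain n where n: "\<gamma> < b n" using cof bg(2) by blast
    then have "T n \<beta> < T n \<gamma>" using good(2)[of \<beta> \<gamma> n] bg by simp
    moreover have "\<beta> \<le> b n" "\<gamma> \<le> b n" using n bg by auto
    ultimately show ?thesis using tT by simp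
  qed
  have "good_node G L \<alpha> t"
    unfolding good_node_def
  proof (intro conjI allI impI ballI)
    show "t \<gamma> = 0" if "\<alpha> < \<gamma>" for \<gamma> using that by (auto simp: t_def)
    show "t \<beta> < t \<gamma>" if bg: "\<beta> < \<gamma> \<and> \<gamma> \<le> \<alpha>" for \<beta> \<gamma>
    proof (cases "\<gamma> = \<alpha>")
      case False
      then show ?thesis using incr bg by auto
    next
      case True
      then have o: "osuc \<beta> < \<alpha>" using bg lim olim_osuc by blast
      have "t \<beta> < t (osuc \<beta>)" using incr o by simp
      also have "\<dots> \<le> t \<alpha>" unfolding sup using o bdd by (intro cSUP_upper) auto
      finally show ?thesis using True by simp
    qed
    show "cut \<beta> t \<in> L \<beta>" if \<beta>: "\<beta> < \<alpha>" for \<beta>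
    proof -
      obtain n where "\<beta> < b n" using cof[OF \<beta>] ..
      then show ?thesis using cutT[of \<beta> n] good(3)[of \<beta> n] by simp
    qed
    show "t \<alpha> = (SUP \<gamma>\<in>{..<\<alpha>}. t \<gamma>)" by (rule sup)
    fix E assume "E \<in> G \<alpha>"
    then have "E \<in> range g" using g by simp
    then obtain n where n: "E = g n" ..
    show "decides L \<alpha> t E"
      using r(5)[of n]
    proof
      assume "\<exists>\<gamma>\<le>b (Suc n). (\<gamma>, to_nat_on (L \<gamma>) (cut \<gamma> (T (Suc n)))) \<in> g n"
      then obtain \<gamma> where "\<gamma> \<le> b (Suc n)" "(\<gamma>, to_nat_on (L \<gamma>) (cut \<gamma> (T (Suc n)))) \<in> g n" by blast
      then have "\<gamma> < \<alpha>" "(\<gamma>, to_nat_on (L \<gamma>) (cut \<gamma> t)) \<in> E"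
        using i(1)[of "Suc n"] cutT n by auto
      then show ?thesis unfolding decides_def by (intro disjI1) blast
    next
      assume av: "avoid n (b n) (T n) (q n)"
      have "cut (b n) t = T n" using cutT[of "b n" n] good(6) by simp
      then have "\<forall>\<gamma><\<alpha>. \<forall>u\<in>L \<gamma>. b n \<le> \<gamma> \<and> cut (b n) u = cut (b n) t \<and>
          (\<gamma>, to_nat_on (L \<gamma>) u) \<in> E \<longrightarrow> q n \<le> u \<gamma>"
        using av n unfolding avoid_def by simp
      then show ?thesis unfolding decides_def using i(1)[of n] ta[of n] by (intro disjI2) blast
    qed
  qed
  moreover have "cut \<beta>0 t = u" using cutT[of \<beta>0 0] zero good(6)[of 0] by simp
  moreover have "t \<alpha> < u \<beta>0 + e" using ta[of 0] zero by simp
  ultimately show ?thesis by blast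
qed

text \<open>One extension for each earlier node and each cost 1/(k+1) meets the extension clause and
  keeps the level countable.\<close>

lemma good_level_limit:
  assumes lim: "olim \<alpha>" and G: "countable (G \<alpha>)"
    and L: "\<And>\<beta>. \<beta> < \<alpha> \<Longrightarrow> good_level G L \<beta> (L \<beta>)"
  shows "\<exists>R. good_level G L \<alpha> R"
proof -
  define ok where "ok \<beta> u k t \<longleftrightarrow>
    good_node G L \<alpha> t \<and> cut \<beta> t = u \<and> t \<alpha> < u \<beta> + inverse (real (Suc k))" for \<beta> u k t
  have "\<exists>t. ok \<beta> u k t" if "\<beta> < \<alpha>" "u \<in> L \<beta>" for \<beta> u k
    unfolding ok_def by (rule limit_node_exists[OF lim G L that]) auto
  then obtain t where t: "\<And>\<beta> u k. \<beta> < \<alpha> \<Longrightarrow> u \<in> L \<beta> \<Longrightarrow> ok \<beta> u k (t \<beta> u k)" by metis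
  let ?R = "\<Union>\<beta>\<in>{..<\<alpha>}. \<Union>u\<in>L \<beta>. range (t \<beta> u)"
  have "good_level G L \<alpha> ?R"
    unfolding good_level_def
  proof (intro conjI ballI allI impI)
    show "countable ?R"
      using countable_lessThan_omega1 good_levelD(1)[OF L] by (intro countable_UN) auto
    have "ozero < \<alpha>" using lim olim_def by blast
    moreover from this obtain u where "u \<in> L ozero" using good_levelD(2)[OF L] by blast
    ultimately have "t ozero u 0 \<in> ?R" by (intro UN_I[of ozero] UN_I[of u]) simp_all
    then show "?R \<noteq> {}" by (metis empty_iff)
    fix x assume "x \<in> ?R"
    then obtain \<beta> u k where "\<beta> < \<alpha>" "u \<in> L \<beta>" "x = t \<beta> u k" by auto
    then show "good_node G L \<alpha> x" using t ok_def by simp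
  next
    fix \<beta> u and e :: real assume b: "\<beta> < \<alpha>" "u \<in> L \<beta>" "0 < e"
    obtain k where k: "inverse (real (Suc k)) < e" using reals_Archimedean b(3) by blast
    have "cut \<beta> (t \<beta> u k) = u \<and> t \<beta> u k \<alpha> < u \<beta> + e"
      using t[OF b(1,2), of k] k unfolding ok_def by auto
    moreover have "t \<beta> u k \<in> ?R" using b by auto
    ultimately show "\<exists>t\<in>?R. cut \<beta> t = u \<and> t \<alpha> < u \<beta> + e" by blast
  qed
  then show ?thesis by blast
qed

lemma good_levels_exist:
  assumes "\<And>\<alpha>. countable (G \<alpha>)"
  shows "\<exists>L. \<forall>\<alpha>. good_level G L \<alpha> (L \<alpha>)"
proof (rule dependent_wellorder_choice)
  show "good_level G f x r = good_level G g x r" if "\<And>y. y < x \<Longrightarrow> f y = g y" for r f g x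
    using good_level_cong that by blast
  show "\<exists>r. good_level G L \<alpha> r" if L: "\<And>\<beta>. \<beta> < \<alpha> \<Longrightarrow> good_level G L \<beta> (L \<beta>)" for \<alpha> L
  proof (cases \<alpha> rule: omega1_cases)
    case zero
    then show ?thesis using good_level_zero by blast
  next
    case (suc \<delta>)
    then show ?thesis using good_level_osuc[of \<delta> G L] L less_osuc_iff by blast
  next
    case lim
    then show ?thesis using good_level_limit[OF _ assms L] by blast
  qed
qed

section \<open>The tree formed by the constructed levels\<close>

locale real_tree =
  fixes G :: "omega1 \<Rightarrow> (omega1 \<times> nat) set set" and L :: "omega1 \<Rightarrow> (omega1 \<Rightarrow> real) set"
  assumes good: "\<And>\<alpha>. good_level G L \<alpha> (L \<alpha>)"
begin

text \<open>The level is stored with the function, since a function extended by 0 need not reveal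
  its domain.\<close>

definition rnodes :: "(omega1 \<times> (omega1 \<Rightarrow> real)) set" where
  "rnodes = {(\<alpha>, t). t \<in> L \<alpha>}"

definition rres :: "omega1 \<Rightarrow> omega1 \<times> (omega1 \<Rightarrow> real) \<Rightarrow> omega1 \<times> (omega1 \<Rightarrow> real)" where
  "rres \<beta> x = (\<beta>, cut \<beta> (snd x))"

lemma gnode: "t \<in> L \<alpha> \<Longrightarrow> good_node G L \<alpha> t"
  using good_levelD(3)[OF good] .

lemma cut_in: "t \<in> L \<alpha> \<Longrightarrow> \<beta> \<le> \<alpha> \<Longrightarrow> cut \<beta> t \<in> L \<beta>"
  using good_nodeD(3,6)[OF gnode] by (metis order_le_less)

lemma increasing: "t \<in> L \<alpha> \<Longrightarrow> \<beta> < \<gamma> \<Longrightarrow> \<gamma> \<le> \<alpha> \<Longrightarrow> t \<beta> < t \<gamma>"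
  using good_nodeD(2)[OF gnode] .

lemma omega1_tree_rnodes: "omega1_tree rnodes fst rres"
proof
  fix x y \<alpha> \<beta>
  show "rres \<beta> x \<in> rnodes" if "x \<in> rnodes" "\<beta> \<le> fst x"
    using that cut_in by (auto simp: rnodes_def rres_def)
  show "fst (rres \<beta> x) = \<beta>" by (simp add: rres_def)
  show "rres (fst x) x = x" if "x \<in> rnodes"
    using that good_nodeD(6)[OF gnode] by (auto simp: rnodes_def rres_def)
  show "rres \<alpha> (rres \<beta> x) = rres \<alpha> x" if "\<alpha> \<le> \<beta>"
    using cut_cut[OF that] by (simp add: rres_def)
  show "x = y" if x: "x \<in> rnodes" and y: "y \<in> rnodes" and l: "fst x = fst y" "olim (fst x)"
    and eq: "\<And>\<alpha>. \<alpha> < fst x \<Longrightarrow> rres \<alpha> x = rres \<alpha> y"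
  proof -
    obtain \<delta> t t' where xy: "x = (\<delta>, t)" "y = (\<delta>, t')" "t \<in> L \<delta>" "t' \<in> L \<delta>"
      using x y l(1) by (auto simp: rnodes_def)
    have e: "t \<gamma> = t' \<gamma>" if "\<gamma> < \<delta>" for \<gamma>
    proof -
      have "cut \<gamma> t \<gamma> = cut \<gamma> t' \<gamma>" using eq[of \<gamma>] that xy by (simp add: rres_def)
      then show ?thesis by (simp add: cut_def)
    qed
    have "t \<delta> = t' \<delta>"
      using good_nodeD(4)[OF gnode[OF xy(3)]] good_nodeD(4)[OF gnode[OF xy(4)]] l(2) xy(1) e
      by simp
    moreover have "t \<gamma> = t' \<gamma>" if "\<delta> < \<gamma>" for \<gamma>
      using good_nodeD(1)[OF gnode[OF xy(3)] that] good_nodeD(1)[OF gnode[OF xy(4)] that] by simp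
    ultimately have "t = t'" using e by (metis ext linorder_neqE)
    then show ?thesis using xy by simp
  qed
  have "{x \<in> rnodes. fst x = \<alpha>} = Pair \<alpha> ` L \<alpha>" by (auto simp: rnodes_def)
  then show "countable {x \<in> rnodes. fst x = \<alpha>}" using good_levelD(1)[OF good] by simp
  show "\<exists>x\<in>rnodes. fst x = \<alpha>" using good_levelD(2)[OF good, of \<alpha>] by (auto simp: rnodes_def)
next
  fix b
  show "\<not> (\<forall>\<beta>. b \<beta> \<in> rnodes \<and> fst (b \<beta>) = \<beta> \<and> (\<forall>\<alpha>\<le>\<beta>. rres \<alpha> (b \<beta>) = b \<alpha>))"
  proof
    assume b: "\<forall>\<beta>. b \<beta> \<in> rnodes \<and> fst (b \<beta>) = \<beta> \<and> (\<forall>\<alpha>\<le>\<beta>. rres \<alpha> (b \<beta>) = b \<alpha>)"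
    have "snd (b \<alpha>) \<alpha> < snd (b \<beta>) \<beta>" if "\<alpha> < \<beta>" for \<alpha> \<beta>
    proof -
      have "rres \<alpha> (b \<beta>) = b \<alpha>" using b that by auto
      then have "snd (b \<alpha>) = cut \<alpha> (snd (b \<beta>))" by (metis rres_def snd_conv)
      then have "snd (b \<alpha>) \<alpha> = snd (b \<beta>) \<alpha>" by (simp add: cut_def)
      moreover have "snd (b \<beta>) \<in> L \<beta>" using b[rule_format, of \<beta>] by (auto simp: rnodes_def)
      ultimately show ?thesis using increasing[OF _ that order_refl] by simp
    qed
    then show False using no_increasing_omega1_real[of "\<lambda>\<beta>. snd (b \<beta>) \<beta>"] by blast
  qed
qed

sublocale omega1_tree rnodes fst rres by (rule omega1_tree_rnodes)

lemma uncountable_antichain: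
  assumes "A \<subseteq> rnodes" "uncountable A"
  shows "\<exists>B\<subseteq>A. uncountable B \<and> antichain B"
proof (rule uncountable_antichain_if_increasing[OF _ assms])
  fix x y assume xy: "x \<in> rnodes" "y \<in> rnodes" "below x y"
  then have l: "fst x < fst y" "rres (fst x) y = x" by (auto simp: below_def)
  then have "snd x (fst x) = snd y (fst x)" by (metis cut_apply order_refl rres_def snd_conv)
  moreover have "snd y \<in> L (fst y)" using xy(2) by (auto simp: rnodes_def)
  ultimately show "snd x (fst x) < snd y (fst y)" using increasing[OF _ l(1) order_refl] by simp
qed

end

text \<open>
  At a level \<open>\<alpha>\<close> where the guess is right and which reflects the existence of elements of \<open>A\<close>
  below rational bounds, a node deciding the guess cannot belong to \<open>A\<close>.
\<close>

lemma (in real_tree) antichain_misses_cub: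
  fixes c :: "omega1 \<times> nat \<Rightarrow> omega1"
  assumes c: "inj c" and guess: "\<And>E. \<exists>C. cub C \<and> (\<forall>\<alpha>\<in>C. c -` (E \<inter> {..<\<alpha>}) \<in> G \<alpha>)"
    and A: "antichain A"
  shows "\<exists>C. cub C \<and> (\<forall>x\<in>A. fst x \<notin> C)"
proof -
  have AN: "A \<subseteq> rnodes" using A antichain_def by blast
  define code where "code x = (fst x, to_nat_on (L (fst x)) (snd x))" for x :: "omega1 \<times> (omega1 \<Rightarrow> real)"
  have code_eq: "x = y" if "x \<in> rnodes" "y \<in> rnodes" "code x = code y" for x y
  proof -
    have "fst x = fst y" "snd x \<in> L (fst x)" "snd y \<in> L (fst x)"
      "to_nat_on (L (fst x)) (snd x) = to_nat_on (L (fst x)) (snd y)"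
      using that by (auto simp: code_def rnodes_def)
    then show ?thesis
      using to_nat_on_inj[OF good_levelD(1)[OF good], of "snd x" "fst x" "snd y"] by (simp add: prod_eq_iff)
  qed
  obtain C1 where C1: "cub C1" "\<And>\<alpha>. \<alpha> \<in> C1 \<Longrightarrow> c -` ((c ` code ` A) \<inter> {..<\<alpha>}) \<in> G \<alpha>"
    using guess[of "c ` code ` A"] by blast
  \<comment> \<open>If \<alpha> is closed under \<open>h2\<close>, all nodes below level \<alpha>
    have codes below \<alpha>, so a correct guess at \<alpha> recovers \<open>A\<close> on all
    earlier levels.\<close>
  have "\<exists>\<eta>. \<forall>k. c (\<beta>, k) < \<eta>" for \<beta>
  proof -
    have "countable (range (\<lambda>k. c (\<beta>, k)))" by simp
    then show ?thesis unfolding omega1_bounded_iff_countable by auto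
  qed
  then obtain h2 where h2: "\<And>\<beta> k. c (\<beta>, k) < h2 \<beta>" by metis
  \<comment> \<open>An element of \<open>A\<close> on level \<gamma> above \<open>t\<close> has
    value below \<open>r\<close>. With \<open>r\<close> rational, each level \<beta> raises only
    countably many such questions, and \<open>h3 \<beta>\<close> bounds witnesses for all that have
    one.\<close>
  define W where "W \<beta> t r \<gamma> \<longleftrightarrow> (\<exists>x\<in>A. fst x = \<gamma> \<and> \<beta> \<le> \<gamma> \<and> cut \<beta> (snd x) = t \<and> snd x \<gamma> < of_rat r)"
    for \<beta> t and r :: rat and \<gamma>
  have "\<exists>\<eta>. \<forall>t\<in>L \<beta>. \<forall>r. (\<exists>\<gamma>. W \<beta> t r \<gamma>) \<longrightarrow> (\<exists>\<gamma><\<eta>. W \<beta> t r \<gamma>)" for \<beta>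
  proof -
    let ?S = "(\<lambda>(t, r). SOME \<gamma>. W \<beta> t r \<gamma>) ` (L \<beta> \<times> UNIV)"
    have "countable ?S" using good_levelD(1)[OF good] by simp
    then have "\<exists>\<eta>. \<forall>\<gamma>\<in>?S. \<gamma> < \<eta>" unfolding omega1_bounded_iff_countable .
    then obtain \<eta> where \<eta>: "\<forall>\<gamma>\<in>?S. \<gamma> < \<eta>" ..
    have "\<exists>\<gamma><\<eta>. W \<beta> t r \<gamma>" if "t \<in> L \<beta>" "W \<beta> t r \<gamma>" for t r \<gamma>
    proof -
      have "(SOME \<gamma>. W \<beta> t r \<gamma>) \<in> ?S" using that(1) by force
      then show ?thesis using \<eta> someI[of "W \<beta> t r", OF that(2)] by blast
    qed
    then show ?thesis by blast
  qed
  then obtain h3 where h3: "\<And>\<beta> t r \<gamma>. t \<in> L \<beta> \<Longrightarrow> W \<beta> t r \<gamma> \<Longrightarrow> \<exists>\<gamma><h3 \<beta>. W \<beta> t r \<gamma>" by metis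
  define Cs where "Cs i = (if i = (0::nat) then C1 else if i = 1 then {\<delta>. olim \<delta> \<and> (\<forall>\<beta><\<delta>. h2 \<beta> < \<delta>)}
    else {\<delta>. olim \<delta> \<and> (\<forall>\<beta><\<delta>. h3 \<beta> < \<delta>)})" for i
  define C where "C = (\<Inter>i\<in>UNIV. Cs i)"
  have "cub C"
    unfolding C_def by (rule cub_Inter) (auto simp: Cs_def C1 cub_closed_under)
  moreover have "\<alpha> \<notin> C" if xA: "(\<alpha>, t) \<in> A" for \<alpha> t
  proof
    assume "\<alpha> \<in> C"
    then have "\<alpha> \<in> Cs 0" "\<alpha> \<in> Cs 1" "\<alpha> \<in> Cs 2" unfolding C_def by blast+
    then have a: "\<alpha> \<in> C1" "olim \<alpha>" "\<And>\<beta>. \<beta> < \<alpha> \<Longrightarrow> h2 \<beta> < \<alpha>" "\<And>\<beta>. \<beta> < \<alpha> \<Longrightarrow> h3 \<beta> < \<alpha>"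
      by (auto simp: Cs_def)
    have t: "t \<in> L \<alpha>" using xA AN by (auto simp: rnodes_def)
    define E where "E = c -` ((c ` code ` A) \<inter> {..<\<alpha>})"
    have E: "code y \<in> E \<longleftrightarrow> y \<in> A" if "y \<in> rnodes" "fst y < \<alpha>" for y
    proof -
      have "c (code y) < \<alpha>" using h2[of "fst y"] a(3)[OF that(2)] less_trans unfolding code_def by blast
      moreover have "c (code y) \<in> c ` code ` A \<longleftrightarrow> y \<in> A"
        using inj_eq[OF c] code_eq[OF that(1)] AN by blast
      ultimately show ?thesis unfolding E_def by auto
    qed
    have "E \<in> G \<alpha>" unfolding E_def using C1(2) a(1) by blast
    then have "decides L \<alpha> t E" using good_nodeD(5)[OF gnode[OF t] a(2)] by blast
    then show False
      unfolding decides_def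
    proof (elim disjE exE conjE)
      fix \<beta> assume above: "\<beta> < \<alpha>" "(\<beta>, to_nat_on (L \<beta>) (cut \<beta> t)) \<in> E"
      have "(\<beta>, cut \<beta> t) \<in> rnodes" using cut_in[OF t] above(1) by (simp add: rnodes_def)
      then have "(\<beta>, cut \<beta> t) \<in> A" using E[of "(\<beta>, cut \<beta> t)"] above by (simp add: code_def)
      then have "\<not> below (\<beta>, cut \<beta> t) (\<alpha>, t)" using A xA unfolding antichain_below by blast
      then have "rres \<beta> (\<alpha>, t) \<noteq> (\<beta>, cut \<beta> t)" using above(1) by (simp add: below_def)
      then show False by (simp add: rres_def)
    next
      fix \<beta> q assume bound: "\<beta> < \<alpha>" "t \<alpha> < q" "\<forall>\<gamma><\<alpha>. \<forall>u\<in>L \<gamma>.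
          \<beta> \<le> \<gamma> \<and> cut \<beta> u = cut \<beta> t \<and> (\<gamma>, to_nat_on (L \<gamma>) u) \<in> E \<longrightarrow> q \<le> u \<gamma>"
      \<comment> \<open>The node itself is an element of \<open>A\<close> above
        \<open>cut \<beta> t\<close> with value below \<open>r\<close>. By closure under
        \<open>h3\<close> there is one on a level below \<alpha>; its value is less than
        \<open>q\<close>, against \<open>bound\<close>.\<close>
      obtain r :: rat where r: "t \<alpha> < of_rat r" "of_rat r < q" using of_rat_dense bound(2) by blast
      have "W \<beta> (cut \<beta> t) r \<alpha>" unfolding W_def using xA bound(1) r(1) by (intro bexI[of _ "(\<alpha>, t)"]) auto
      moreover have "cut \<beta> t \<in> L \<beta>" using cut_in[OF t] bound(1) by simp
      ultimately obtain \<gamma> where g: "\<gamma> < h3 \<beta>" "W \<beta> (cut \<beta> t) r \<gamma>" using h3 by blast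
      then have ga: "\<gamma> < \<alpha>" using a(4)[OF bound(1)] less_trans by blast
      obtain y where y: "y \<in> A" "fst y = \<gamma>" "\<beta> \<le> \<gamma>" "cut \<beta> (snd y) = cut \<beta> t" "snd y \<gamma> < of_rat r"
        using g(2) unfolding W_def by blast
      have yN: "y \<in> rnodes" using y(1) AN by blast
      have "code y \<in> E" using E[OF yN] y(1,2) ga by simp
      then have "q \<le> snd y \<gamma>"
        using bound(3)[rule_format, OF ga, of "snd y"] y yN by (auto simp: code_def rnodes_def)
      then show False using y(5) r(2) by linarith
    qed
  qed
  ultimately show ?thesis by (intro exI[of _ C]) auto
qed

section \<open>Suslin trees\<close>

abbreviation omega1_segment :: "omega1 \<Rightarrow> omega1 rel" where
  "omega1_segment \<alpha> \<equiv> {(\<beta>, \<gamma>). \<beta> \<le> \<gamma> \<and> \<gamma> < \<alpha>}"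

lemma Field_omega1_segment: "Field (omega1_segment \<alpha>) = {..<\<alpha>}"
  unfolding Field_def by auto

lemma Well_order_omega1_segment: "Well_order (omega1_segment \<alpha>)"
proof -
  have "wf (omega1_segment \<alpha> - Id)"
    by (rule wf_subset[OF wf]) auto
  then show ?thesis
    unfolding well_order_on_def linear_order_on_def partial_order_on_def preorder_on_def
      Field_omega1_segment
    by (auto simp: refl_on_def trans_def antisym_def total_on_def)
qed

lemma ordIso_omega1_segment_iff:
  assumes "Well_order r"
  shows "r =o omega1_segment \<alpha> \<longleftrightarrow>
    (\<exists>f. bij_betw f (Field r) {..<\<alpha>} \<and> (\<forall>x\<in>Field r. \<forall>y\<in>Field r. (x, y) \<in> r \<longleftrightarrow> f x \<le> f y))"
proof -
  have "iso r (omega1_segment \<alpha>) f \<longleftrightarrow>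
    bij_betw f (Field r) {..<\<alpha>} \<and> (\<forall>x\<in>Field r. \<forall>y\<in>Field r. (x, y) \<in> r \<longleftrightarrow> f x \<le> f y)" for f
    unfolding iso_iff2 Field_omega1_segment by (auto simp: bij_betw_def)
  then show ?thesis
    unfolding ordIso_def using assms Well_order_omega1_segment by auto
qed

text \<open>A strictly increasing \<open>f\<close> satisfies \<gamma> \<le>
  \<open>f \<gamma>\<close>, so it cannot map \<beta> below \<beta>. This makes the height of a node
  unique.\<close>

lemma omega1_segment_ordIso_imp_le:
  assumes "omega1_segment \<alpha> =o omega1_segment \<beta>"
  shows "\<alpha> \<le> \<beta>"
proof (rule ccontr)
  assume "\<not> \<alpha> \<le> \<beta>"
  then have ba: "\<beta> < \<alpha>" by simp
  obtain f where bij: "bij_betw f {..<\<alpha>} {..<\<beta>}"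
    and f: "\<forall>x\<in>{..<\<alpha>}. \<forall>y\<in>{..<\<alpha>}. (x, y) \<in> omega1_segment \<alpha> \<longleftrightarrow> f x \<le> f y"
    using assms unfolding ordIso_omega1_segment_iff[OF Well_order_omega1_segment] Field_omega1_segment
    by blast
  have mono: "f x < f y" if "x < y" "y < \<alpha>" for x y
    using f[rule_format, of y x] that by force
  have "\<gamma> \<le> f \<gamma>" if "\<gamma> < \<alpha>" for \<gamma>
    using that
  proof (induction \<gamma> rule: less_induct)
    case (less \<gamma>)
    show ?case
    proof (rule ccontr)
      assume "\<not> \<gamma> \<le> f \<gamma>"
      then have "f \<gamma> < \<gamma>" by simp
      then have "f \<gamma> \<le> f (f \<gamma>)" "f (f \<gamma>) < f \<gamma>" using less mono[of "f \<gamma>" \<gamma>] by auto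
      then show False by simp
    qed
  qed
  then have "\<beta> \<le> f \<beta>" using ba by blast
  moreover have "f \<beta> < \<beta>" using bij ba unfolding bij_betw_def by auto
  ultimately show False by simp
qed

locale omega1_order_tree =
  fixes r :: "'b rel"
  assumes tree: "order_tree r" and height: "height_omega1 r"
begin

lemma r_props: "refl_on (Field r) r" "trans r" "antisym r"
  using tree unfolding order_tree_def partial_order_on_def preorder_on_def by auto

definition ht :: "'b \<Rightarrow> omega1" where
  "ht t = (THE \<alpha>. Restr r (underS r t) =o omega1_segment \<alpha>)"

lemma ht_eq:
  assumes "Restr r (underS r t) =o omega1_segment \<alpha>"
  shows "ht t = \<alpha>"
  unfolding ht_def
proof (rule the_equality[where P = "\<lambda>\<alpha>. Restr r (underS r t) =o omega1_segment \<alpha>", OF assms])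
  fix \<beta> assume b: "Restr r (underS r t) =o omega1_segment \<beta>"
  have "omega1_segment \<alpha> =o omega1_segment \<beta>" "omega1_segment \<beta> =o omega1_segment \<alpha>"
    using assms b by (meson ordIso_symmetric ordIso_transitive)+
  then show "\<beta> = \<alpha>" using omega1_segment_ordIso_imp_le by (meson order_antisym)
qed

lemma ht_iso:
  assumes "t \<in> Field r"
  shows "Restr r (underS r t) =o omega1_segment (ht t)"
proof -
  have "Field r = (\<Union>\<alpha>. tree_level r \<alpha>)" using height unfolding height_omega1_def ..
  then obtain \<alpha> where "t \<in> tree_level r \<alpha>" using assms by auto
  then have "Restr r (underS r t) =o omega1_segment \<alpha>" unfolding tree_level_def by simp
  with ht_eq[OF this] show ?thesis by simp
qed

lemma tree_level_ht: "tree_level r \<alpha> = {t \<in> Field r. ht t = \<alpha>}"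
proof (intro equalityI subsetI)
  fix t assume "t \<in> tree_level r \<alpha>"
  then have "t \<in> Field r" "Restr r (underS r t) =o omega1_segment \<alpha>"
    unfolding tree_level_def by simp_all
  then show "t \<in> {t \<in> Field r. ht t = \<alpha>}" using ht_eq by simp
next
  fix t assume "t \<in> {t \<in> Field r. ht t = \<alpha>}"
  then have "t \<in> Field r" "ht t = \<alpha>" by auto
  then show "t \<in> tree_level r \<alpha>" unfolding tree_level_def using ht_iso[of t] by simp
qed

lemma underS_iff: "x \<in> underS r t \<longleftrightarrow> (x, t) \<in> r \<and> x \<noteq> t"
  unfolding underS_def by auto

lemma underS_Field: "x \<in> underS r t \<Longrightarrow> x \<in> Field r"
  unfolding underS_iff Field_def by auto

lemma underS_trans: "x \<in> underS r y \<Longrightarrow> y \<in> underS r z \<Longrightarrow> x \<in> underS r z"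
  using r_props(2,3) unfolding underS_iff trans_def antisym_def by blast

lemma Field_Restr_underS: "Field (Restr r (underS r t)) = underS r t"
proof -
  have "x \<in> Field (Restr r (underS r t))" if "x \<in> underS r t" for x
    using that r_props(1) underS_Field[OF that] by (auto simp: Field_def refl_on_def)
  moreover have "Field (Restr r (underS r t)) \<subseteq> underS r t" by (auto simp: Field_def)
  ultimately show ?thesis by blast
qed

lemma Well_order_underS: "t \<in> Field r \<Longrightarrow> Well_order (Restr r (underS r t))"
  using tree unfolding order_tree_def by blast

text \<open>An isomorphism \<open>f\<close> of the predecessors of \<open>t\<close> with an ordinal
  restricts, for each predecessor \<open>u\<close>, to one of \<open>underS r u\<close> with the
  ordinal \<open>f u\<close>; hence \<open>f\<close> is the height function.\<close>

lemma underS_iso: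
  assumes t: "t \<in> Field r"
  shows "bij_betw ht (underS r t) {..<ht t}"
    and "\<And>x y. x \<in> underS r t \<Longrightarrow> y \<in> underS r t \<Longrightarrow> (x, y) \<in> r \<longleftrightarrow> ht x \<le> ht y"
proof -
  obtain f where bij: "bij_betw f (underS r t) {..<ht t}"
    and f: "\<And>x y. x \<in> underS r t \<Longrightarrow> y \<in> underS r t \<Longrightarrow> (x, y) \<in> r \<longleftrightarrow> f x \<le> f y"
    using ht_iso[OF t]
    unfolding ordIso_omega1_segment_iff[OF Well_order_underS[OF t]] Field_Restr_underS by auto
  have inj: "inj_on f (underS r t)" using bij bij_betw_def by blast
  have fu: "f u = ht u" if u: "u \<in> underS r t" for u
  proof -
    have sub: "underS r u \<subseteq> underS r t" using underS_trans u by blast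
    have lt: "x \<in> underS r u \<longleftrightarrow> f x < f u" if x: "x \<in> underS r t" for x
      using f[OF x u] inj_onD[OF inj _ x u] unfolding underS_iff by (auto simp: order_le_less)
    have "bij_betw f (underS r u) {..<f u}"
      unfolding bij_betw_def
    proof
      show "inj_on f (underS r u)" using inj sub by (rule inj_on_subset)
      have "f u < ht t" using bij u unfolding bij_betw_def by blast
      show "f ` underS r u = {..<f u}"
      proof (intro equalityI subsetI)
        fix \<gamma> assume "\<gamma> \<in> {..<f u}"
        moreover from this have "\<gamma> \<in> f ` underS r t"
          using bij \<open>f u < ht t\<close> unfolding bij_betw_def by auto
        ultimately show "\<gamma> \<in> f ` underS r u" using lt by auto
      qed (use sub lt in auto)
    qed
    then have "Restr r (underS r u) =o omega1_segment (f u)"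
      unfolding ordIso_omega1_segment_iff[OF Well_order_underS[OF underS_Field[OF u]]] Field_Restr_underS
      using f sub by (intro exI[of _ f]) auto
    from ht_eq[OF this] show ?thesis by simp
  qed
  show "bij_betw ht (underS r t) {..<ht t}"
    using bij bij_betw_cong[of "underS r t" f ht "{..<ht t}", OF fu] by simp
  show "\<And>x y. x \<in> underS r t \<Longrightarrow> y \<in> underS r t \<Longrightarrow> (x, y) \<in> r \<longleftrightarrow> ht x \<le> ht y"
    using f fu by simp
qed

lemma ht_less: "x \<in> underS r t \<Longrightarrow> t \<in> Field r \<Longrightarrow> ht x < ht t"
  using underS_iso(1) unfolding bij_betw_def by blast

text \<open>
  Replacing each node by the chain below it makes the tree Hausdorff: two nodes on a limit level
  with the same predecessors are identified.
\<close>

definition cnodes :: "'b set set" where "cnodes = underS r ` Field r"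

text \<open>The choice of \<open>t\<close> does not matter, because \<open>ht t\<close> depends on
  \<open>underS r t\<close> only.\<close>

definition clev :: "'b set \<Rightarrow> omega1" where
  "clev S = ht (SOME t. t \<in> Field r \<and> underS r t = S)"

definition cres :: "omega1 \<Rightarrow> 'b set \<Rightarrow> 'b set" where
  "cres \<beta> S = {u \<in> S. ht u < \<beta>}"

lemma clev_underS:
  assumes "t \<in> Field r"
  shows "clev (underS r t) = ht t"
proof -
  have cong: "ht t' = ht t" if "underS r t' = underS r t" for t' unfolding ht_def that ..
  have "\<exists>t'. t' \<in> Field r \<and> underS r t' = underS r t" using assms by blast
  from cong[OF conjunct2[OF someI_ex[OF this]]] show ?thesis unfolding clev_def .
qed

lemma cres_underS:
  assumes t: "t \<in> Field r" and u: "u \<in> underS r t"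
  shows "cres (ht u) (underS r t) = underS r u"
proof (intro equalityI subsetI)
  fix x assume "x \<in> cres (ht u) (underS r t)"
  then have x: "x \<in> underS r t" "ht x < ht u" unfolding cres_def by auto
  then have "(x, u) \<in> r" using underS_iso(2)[OF t x(1) u] by simp
  then show "x \<in> underS r u" using x(2) unfolding underS_iff by auto
next
  fix x assume x: "x \<in> underS r u"
  then show "x \<in> cres (ht u) (underS r t)"
    unfolding cres_def using underS_trans[OF x u] ht_less[OF x underS_Field[OF u]] by simp
qed

lemma cres_clev: "S \<in> cnodes \<Longrightarrow> cres (clev S) S = S"
  unfolding cnodes_def cres_def using ht_less clev_underS by auto

lemma cres_cases:
  assumes "S \<in> cnodes" "\<beta> \<le> clev S"
  obtains t where "t \<in> Field r" "cres \<beta> S = underS r t" "ht t = \<beta>"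
proof -
  obtain t where t: "t \<in> Field r" "S = underS r t" using assms(1) cnodes_def by auto
  show ?thesis
  proof (cases "\<beta> = clev S")
    case True
    show ?thesis
    proof (rule that)
      show "t \<in> Field r" by (rule t(1))
      show "cres \<beta> S = underS r t" using cres_clev[OF assms(1)] True t(2) by metis
      show "ht t = \<beta>" using clev_underS[OF t(1)] True t(2) by metis
    qed
  next
    case False
    then have "\<beta> < ht t" using assms(2) t clev_underS by simp
    then have "\<beta> \<in> ht ` underS r t" using underS_iso(1)[OF t(1)] unfolding bij_betw_def by simp
    then obtain u where u: "u \<in> underS r t" "ht u = \<beta>" by auto
    show ?thesis
    proof (rule that)
      show "u \<in> Field r" "ht u = \<beta>" using u underS_Field by auto
      show "cres \<beta> S = underS r u" using cres_underS[OF t(1) u(1)] t(2) u(2) by simp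
    qed
  qed
qed

lemma antichain_of_nodes:
  assumes "\<And>x y. x \<in> A \<Longrightarrow> y \<in> A \<Longrightarrow> x \<in> underS r y \<Longrightarrow> False" "A \<subseteq> Field r"
  shows "tree_antichain r A"
  unfolding tree_antichain_def using assms unfolding underS_iff by blast

text \<open>On a limit level a chain is the union of its restrictions, so limit nodes are unique.
  Levels are countable because nodes of equal height form an antichain. The union of a branch would
  be a chain of \<open>r\<close> with members of every height, hence uncountable.\<close>

lemma omega1_tree_cnodes:
  assumes chains: "\<And>C. C \<in> Chains r \<Longrightarrow> countable C"
    and antichains: "\<And>A. tree_antichain r A \<Longrightarrow> countable A"
  shows "omega1_tree cnodes clev cres"
proof
  fix S T \<alpha> \<beta>
  show "cres \<beta> S \<in> cnodes" if "S \<in> cnodes" "\<beta> \<le> clev S"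
    using cres_cases[OF that] unfolding cnodes_def by blast
  show "clev (cres \<beta> S) = \<beta>" if "S \<in> cnodes" "\<beta> \<le> clev S"
    using cres_cases[OF that] clev_underS by metis
  show "cres (clev S) S = S" if "S \<in> cnodes" using cres_clev[OF that] .
  show "cres \<alpha> (cres \<beta> S) = cres \<alpha> S" if "\<alpha> \<le> \<beta>" using that unfolding cres_def by auto
  show "S = T" if S: "S \<in> cnodes" and T: "T \<in> cnodes" and l: "clev S = clev T" "olim (clev S)"
    and eq: "\<And>\<alpha>. \<alpha> < clev S \<Longrightarrow> cres \<alpha> S = cres \<alpha> T"
  proof -
    have "S = (\<Union>\<alpha>\<in>{..<clev S}. cres \<alpha> S)" if S: "S \<in> cnodes" "olim (clev S)" for S
    proof (intro equalityI subsetI)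
      fix u assume u: "u \<in> S"
      then have "ht u < clev S" using cres_clev[OF S(1)] unfolding cres_def by blast
      then have "osuc (ht u) < clev S" using S(2) olim_osuc by blast
      moreover have "u \<in> cres (osuc (ht u)) S" unfolding cres_def using u by simp
      ultimately show "u \<in> (\<Union>\<alpha>\<in>{..<clev S}. cres \<alpha> S)" by blast
    qed (auto simp: cres_def)
    from this[OF S l(2)] this[OF T] show ?thesis using eq l by simp
  qed
  have "tree_antichain r {t \<in> Field r. ht t = \<alpha>}"
  proof (rule antichain_of_nodes)
    fix x y assume "x \<in> {t \<in> Field r. ht t = \<alpha>}" "y \<in> {t \<in> Field r. ht t = \<alpha>}" "x \<in> underS r y"
    then show False using ht_less[of x y] by simp
  qed simp
  then have "countable (underS r ` {t \<in> Field r. ht t = \<alpha>})" using antichains by simp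
  moreover have "{S \<in> cnodes. clev S = \<alpha>} \<subseteq> underS r ` {t \<in> Field r. ht t = \<alpha>}"
    unfolding cnodes_def using clev_underS by auto
  ultimately show "countable {S \<in> cnodes. clev S = \<alpha>}" by (rule countable_subset[rotated])
  have "tree_level r \<alpha> \<noteq> {}" using height unfolding height_omega1_def by blast
  then obtain t where "t \<in> Field r" "ht t = \<alpha>" unfolding tree_level_ht by blast
  then show "\<exists>S\<in>cnodes. clev S = \<alpha>" unfolding cnodes_def using clev_underS by blast
next
  fix b
  show "\<not> (\<forall>\<beta>. b \<beta> \<in> cnodes \<and> clev (b \<beta>) = \<beta> \<and> (\<forall>\<alpha>\<le>\<beta>. cres \<alpha> (b \<beta>) = b \<alpha>))"
  proof
    assume b: "\<forall>\<beta>. b \<beta> \<in> cnodes \<and> clev (b \<beta>) = \<beta> \<and> (\<forall>\<alpha>\<le>\<beta>. cres \<alpha> (b \<beta>) = b \<alpha>)"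
    have mono: "b \<alpha> \<subseteq> b \<beta>" if "\<alpha> \<le> \<beta>" for \<alpha> \<beta>
    proof -
      have "cres \<alpha> (b \<beta>) = b \<alpha>" using b that by blast
      then show ?thesis unfolding cres_def by blast
    qed
    have node: "\<exists>t\<in>Field r. b \<beta> = underS r t \<and> ht t = \<beta>" for \<beta>
    proof -
      obtain t where "t \<in> Field r" "b \<beta> = underS r t" using b unfolding cnodes_def by blast
      then show ?thesis using b clev_underS by metis
    qed
    have "(\<Union>\<beta>. b \<beta>) \<in> Chains r"
      unfolding Chains_def mem_Collect_eq
    proof (intro ballI)
      fix x y assume "x \<in> (\<Union>\<beta>. b \<beta>)" "y \<in> (\<Union>\<beta>. b \<beta>)"
      then obtain \<beta> \<gamma> where "x \<in> b \<beta>" "y \<in> b \<gamma>" by blast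
      then have xy: "x \<in> b (max \<beta> \<gamma>)" "y \<in> b (max \<beta> \<gamma>)"
        using mono[of \<beta> "max \<beta> \<gamma>"] mono[of \<gamma> "max \<beta> \<gamma>"] by auto
      obtain t where "t \<in> Field r" "b (max \<beta> \<gamma>) = underS r t" using node by blast
      then show "(x, y) \<in> r \<or> (y, x) \<in> r"
        using underS_iso(2)[of t x y] underS_iso(2)[of t y x] xy linear[of "ht x" "ht y"] by auto
    qed
    then have "countable (ht ` (\<Union>\<beta>. b \<beta>))" using chains by simp
    then have "\<exists>\<beta>. \<forall>\<gamma>\<in>ht ` (\<Union>\<beta>. b \<beta>). \<gamma> < \<beta>" unfolding omega1_bounded_iff_countable .
    then obtain \<beta> where \<beta>: "\<forall>\<gamma>\<in>ht ` (\<Union>\<beta>. b \<beta>). \<gamma> < \<beta>" ..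
    obtain t where t: "t \<in> Field r" "b (osuc \<beta>) = underS r t" "ht t = osuc \<beta>" using node by blast
    then have "\<beta> \<in> ht ` b (osuc \<beta>)"
      using underS_iso(1)[OF t(1)] unfolding bij_betw_def by simp
    then have "\<beta> < \<beta>" using \<beta> by blast
    then show False by simp
  qed
qed

text \<open>Picking for each member of \<open>A\<close> one node with exactly these predecessors
  gives an antichain of the original tree.\<close>

lemma countable_antichain_cnodes:
  assumes chains: "\<And>C. C \<in> Chains r \<Longrightarrow> countable C"
    and antichains: "\<And>A. tree_antichain r A \<Longrightarrow> countable A"
    and A: "omega1_tree.antichain cnodes clev cres A"
  shows "countable A"
proof -
  interpret omega1_tree cnodes clev cres by (rule omega1_tree_cnodes[OF chains antichains])
  have AN: "A \<subseteq> cnodes" using A unfolding antichain_def by blast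
  have "\<exists>t. t \<in> Field r \<and> underS r t = S" if "S \<in> A" for S using AN that unfolding cnodes_def by blast
  then obtain \<tau> where \<tau>: "\<And>S. S \<in> A \<Longrightarrow> \<tau> S \<in> Field r \<and> underS r (\<tau> S) = S" by metis
  have "tree_antichain r (\<tau> ` A)"
  proof (rule antichain_of_nodes)
    fix x y assume "x \<in> \<tau> ` A" "y \<in> \<tau> ` A" and u: "x \<in> underS r y"
    then obtain S T where S: "S \<in> A" "x = \<tau> S" and T: "T \<in> A" "y = \<tau> T" by blast
    have x: "x \<in> Field r" "underS r x = S" "clev S = ht x"
      using \<tau>[OF S(1)] S(2) clev_underS[of x] by auto
    have y: "y \<in> Field r" "underS r y = T" "clev T = ht y"
      using \<tau>[OF T(1)] T(2) clev_underS[of y] by auto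
    have "clev S < clev T" using ht_less[OF u y(1)] x y by simp
    moreover have "cres (clev S) T = S" using cres_underS[OF y(1) u] x y by simp
    ultimately show False using A S(1) T(1) unfolding antichain_def by blast
  qed (use \<tau> in auto)
  then have "countable (underS r ` \<tau> ` A)" using antichains by simp
  moreover have "underS r ` \<tau> ` A = A" using \<tau> by (force simp: image_image)
  ultimately show ?thesis by simp
qed

end

section \<open>Assembly of the three spaces\<close>

theorem mainTheorem7:
  shows
    "(\<exists>Y :: real topology.
        property_star Y \<and> nonLindelof_closed_has_uncountable_closed_discrete Y) \<and>
     (diamond_star \<longrightarrow>
       (\<exists>Y :: real topology.
          property_star Y \<and> nonLindelof_closed_has_uncountable_closed_discrete Y \<and>
          collectionwise_Hausdorff Y)) \<and>
     ((\<exists>T :: 'b rel. Suslin_tree T) \<longrightarrow>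
       (\<exists>Y :: real topology.
          property_star Y \<and>
          (\<exists>Z. openin Y Z \<and> Y closure_of Z = topspace Y \<and>
            omega1_compact (subtopology Y Z) \<and> locally_compact_space (subtopology Y Z))))"
proof (intro conjI impI)
  \<comment> \<open>Without guesses the requirement at limit levels is only continuity, and the
    construction needs no further axiom.\<close>
  obtain L where "\<forall>\<alpha>. good_level (\<lambda>_. {}) L \<alpha> (L \<alpha>)" using good_levels_exist[of "\<lambda>_. {}"] by auto
  then interpret T: real_tree "\<lambda>_. {}" L by unfold_locales blast
  obtain nd :: "_ \<Rightarrow> nat \<Rightarrow> real" and dp where "tree_space T.rnodes fst T.rres nd dp"
    using T.tree_space_exists by blast
  then interpret Y: tree_space T.rnodes fst T.rres nd dp .
  show "\<exists>Y :: real topology. property_star Y \<and> nonLindelof_closed_has_uncountable_closed_discrete Y"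
  proof (intro exI conjI)
    show "property_star Y.Y" by (rule Y.property_star_Y)
    show "nonLindelof_closed_has_uncountable_closed_discrete Y.Y"
      by (rule Y.nonLindelof_closed_has_uncountable_closed_discrete_Y[OF T.uncountable_antichain])
  qed
next
  assume diamond_star
  then obtain \<A> where "(\<forall>\<alpha>. countable (\<A> \<alpha>) \<and> \<A> \<alpha> \<subseteq> Pow {..<\<alpha>}) \<and>
      (\<forall>E. \<exists>C. club C \<and> C \<subseteq> {\<alpha>. E \<inter> {..<\<alpha>} \<in> \<A> \<alpha>})"
    unfolding diamond_star_def ..
  then have A: "countable (\<A> \<alpha>)" "\<exists>C. club C \<and> C \<subseteq> {\<alpha>. E \<inter> {..<\<alpha>} \<in> \<A> \<alpha>}" for \<alpha> E by simp_all
  obtain c :: "omega1 \<times> nat \<Rightarrow> omega1" where c: "inj c" using omega1_times_nat_coding by blast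
  \<comment> \<open>The guesses of subsets of \<alpha>, decoded into guesses of sets of
    nodes.\<close>
  define G where "G \<alpha> = (\<lambda>E. c -` E) ` \<A> \<alpha>" for \<alpha>
  have "countable (G \<alpha>)" for \<alpha> unfolding G_def using A(1) by simp
  then obtain L where "\<forall>\<alpha>. good_level G L \<alpha> (L \<alpha>)" using good_levels_exist[of G] by blast
  then interpret T: real_tree G L by unfold_locales blast
  obtain nd :: "_ \<Rightarrow> nat \<Rightarrow> real" and dp where "tree_space T.rnodes fst T.rres nd dp"
    using T.tree_space_exists by blast
  then interpret Y: tree_space T.rnodes fst T.rres nd dp .
  have guess: "\<exists>C. cub C \<and> (\<forall>\<alpha>\<in>C. c -` (E \<inter> {..<\<alpha>}) \<in> G \<alpha>)" for E
  proof -
    obtain C where "club C" "C \<subseteq> {\<alpha>. E \<inter> {..<\<alpha>} \<in> \<A> \<alpha>}" using A(2) by blast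
    then have "cub C" "\<forall>\<alpha>\<in>C. c -` (E \<inter> {..<\<alpha>}) \<in> G \<alpha>"
      unfolding G_def using cub_of_club by (auto simp del: vimage_Int)
    then show ?thesis by blast
  qed
  show "\<exists>Y :: real topology. property_star Y \<and>
      nonLindelof_closed_has_uncountable_closed_discrete Y \<and> collectionwise_Hausdorff Y"
  proof (intro exI conjI)
    show "property_star Y.Y" by (rule Y.property_star_Y)
    show "nonLindelof_closed_has_uncountable_closed_discrete Y.Y"
      by (rule Y.nonLindelof_closed_has_uncountable_closed_discrete_Y[OF T.uncountable_antichain])
    show "collectionwise_Hausdorff Y.Y"
      by (rule Y.collectionwise_Hausdorff_Y[OF T.antichain_misses_cub[OF c guess]])
  qed
next
  assume "\<exists>T :: 'b rel. Suslin_tree T"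
  then obtain r :: "'b rel" where r: "Suslin_tree r" by blast
  then interpret S: omega1_order_tree r by unfold_locales (auto simp: Suslin_tree_def)
  have cnt: "\<And>C. C \<in> Chains r \<Longrightarrow> countable C" "\<And>A. tree_antichain r A \<Longrightarrow> countable A"
    using r unfolding Suslin_tree_def by auto
  interpret T: omega1_tree S.cnodes S.clev S.cres by (rule S.omega1_tree_cnodes[OF cnt])
  obtain nd :: "_ \<Rightarrow> nat \<Rightarrow> real" and dp where "tree_space S.cnodes S.clev S.cres nd dp"
    using T.tree_space_exists by blast
  then interpret Y: tree_space S.cnodes S.clev S.cres nd dp .
  show "\<exists>Y :: real topology. property_star Y \<and>
      (\<exists>Z. openin Y Z \<and> Y closure_of Z = topspace Y \<and>
        omega1_compact (subtopology Y Z) \<and> locally_compact_space (subtopology Y Z))"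
  proof (intro exI conjI)
    show "property_star Y.Y" by (rule Y.property_star_Y)
    show "openin Y.Y Y.nodes" by (rule Y.openin_nodes)
    show "Y.Y closure_of Y.nodes = topspace Y.Y" by (rule Y.closure_of_nodes)
    show "omega1_compact (subtopology Y.Y Y.nodes)"
      by (rule Y.omega1_compact_nodes[OF S.countable_antichain_cnodes[OF cnt]])
    show "locally_compact_space (subtopology Y.Y Y.nodes)" by (rule Y.locally_compact_nodes)
  qed
qed

end
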